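(* There is a polynomial-time randomized offline algorithm that returns, for every $k$-gossip instance on $n$ nodes, a schedule (disseminating all $k$ tokens to all $n$ nodes) of length $O((n+k)\log^2 n)$ with high probability.
   Context: $k$-gossip: there are $n$ nodes and $k$ distinct tokens, each initially held by at least one node; the goal is that every node holds all $k$ tokens. Communication proceeds in synchronous rounds; nodes store, copy and forward tokens, and in a round a node can send only tokens it held at the start of the round. An offline algorithm for $k$-gossip takes as input an initial token distribution and a sequence of $nk$ graphs $G_1,\dots,G_{nk}$ on the $n$ nodes, each of them connected, where $G_t$ represents the communication network in round $t$. The output is a schedule that specifies, for each $t$ and each edge $e$ of $G_t$, a token (if any) sent along $e$ in each direction in round $t$ (so a node may send distinct tokens to distinct neighbors in the same round). The length of the schedule is the largest $t$ for which a token is sent on any edge in round $t$. "With high probability" means with probability at least $1-n^{-a}$ for some constant $a>0$, over the random choices of the algorithm. *)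

theory Defs
  imports "HOL-Probability.Probability" "HOL-Computational_Algebra.Polynomial"
begin

text \<open>
  Model of computation: a structured random access machine with fair coin flips.  A program works
  on finitely many named registers and named one-dimensional arrays, all holding natural numbers.
  Every assignment, array update, coin flip and test costs one step.  The arithmetic operations
  are addition and truncated subtraction only.  As the expressions of a fixed program have bounded
  size, a value after \<open>t\<close> steps then has \<open>O(t + m)\<close> bits, where \<open>m\<close> is the input length, so that
  running times in this model and on probabilistic Turing machines agree up to a polynomial.
  (Multiplication at unit cost would break this.)
\<close>

datatype aexp =
    Const nat
  | Var string
  | Read string aexp
  | Plus aexp aexp
  | Minus aexp aexp

datatype bexp =
    BConst bool
  | BNot bexp
  | BAnd bexp bexp
  | BLess aexp aexp

datatype com =
    Skip
  | Assign string aexp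
  | Store string aexp aexp
  | Flip string
  | Seq com com
  | Cond bexp com com
  | While bexp com

record state =
  reg :: "string \<Rightarrow> nat"
  arr :: "string \<Rightarrow> nat \<Rightarrow> nat"

primrec aval :: "aexp \<Rightarrow> state \<Rightarrow> nat" where
  "aval (Const m) s = m"
| "aval (Var x) s = reg s x"
| "aval (Read a e) s = arr s a (aval e s)"
| "aval (Plus e f) s = aval e s + aval f s"
| "aval (Minus e f) s = aval e s - aval f s"

primrec bval :: "bexp \<Rightarrow> state \<Rightarrow> bool" where
  "bval (BConst b) s = b"
| "bval (BNot b) s = (\<not> bval b s)"
| "bval (BAnd b c) s = (bval b s \<and> bval c s)"
| "bval (BLess e f) s = (aval e s < aval f s)"

definition set_reg :: "string \<Rightarrow> nat \<Rightarrow> state \<Rightarrow> state" where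
  "set_reg x m s = s\<lparr>reg := (reg s)(x := m)\<rparr>"

definition set_arr :: "string \<Rightarrow> nat \<Rightarrow> nat \<Rightarrow> state \<Rightarrow> state" where
  "set_arr a i m s = s\<lparr>arr := (arr s)(a := (arr s a)(i := m))\<rparr>"

text \<open>A program has halted when it has been reduced to \<open>Skip\<close>.\<close>

primrec step :: "com \<Rightarrow> state \<Rightarrow> (com \<times> state) pmf" where
  "step Skip s = return_pmf (Skip, s)"
| "step (Assign x e) s = return_pmf (Skip, set_reg x (aval e s) s)"
| "step (Store a e f) s = return_pmf (Skip, set_arr a (aval e s) (aval f s) s)"
| "step (Flip x) s = map_pmf (\<lambda>b. (Skip, set_reg x (of_bool b) s)) (bernoulli_pmf (1/2))"
| "step (Seq c d) s =
     (if c = Skip then return_pmf (d, s)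
      else map_pmf (\<lambda>(c', s'). (Seq c' d, s')) (step c s))"
| "step (Cond b c d) s = return_pmf (if bval b s then c else d, s)"
| "step (While b c) s = return_pmf (if bval b s then Seq c (While b c) else Skip, s)"

primrec run :: "nat \<Rightarrow> com \<times> state \<Rightarrow> (com \<times> state) pmf" where
  "run 0 cs = return_pmf cs"
| "run (Suc t) cs = bind_pmf (step (fst cs) (snd cs)) (run t)"

definition initial_state :: "bool list \<Rightarrow> state" where
  "initial_state w =
     \<lparr>reg = (\<lambda>x. if x = ''length'' then length w else 0),
      arr = (\<lambda>a i. if a = ''input'' \<and> i < length w then of_bool (w ! i) else 0)\<rparr>"

definition halts_within :: "com \<Rightarrow> bool list \<Rightarrow> nat \<Rightarrow> bool" where
  "halts_within c w T \<longleftrightarrow> (\<forall>cs \<in> set_pmf (run T (c, initial_state w)). fst cs = Skip)"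

text \<open>Worst case over the coin flips; \<open>W\<close> is the set of admissible inputs.\<close>

definition polynomial_time :: "com \<Rightarrow> bool list set \<Rightarrow> bool" where
  "polynomial_time c W \<longleftrightarrow> (\<exists>p :: nat poly. \<forall>w\<in>W. halts_within c w (poly p (length w)))"

text \<open>
  Distribution of the final contents of the array \<open>output\<close>.  A halted configuration does not change
  any more, so every time bound within which the program halts gives the same distribution.
\<close>

definition output_pmf :: "com \<Rightarrow> bool list \<Rightarrow> (nat \<Rightarrow> nat) pmf" where
  "output_pmf c w =
     map_pmf (\<lambda>cs. arr (snd cs) ''output'')
       (run (LEAST T. halts_within c w T) (c, initial_state w))"


text \<open>
  The nodes are \<open>0, \<dots>, n - 1\<close>, the tokens are \<open>0, \<dots>, k - 1\<close> and the rounds are \<open>1, \<dots>, n * k\<close>.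
  An undirected simple graph is a symmetric irreflexive set of ordered pairs of nodes.
\<close>

definition connected_graph :: "nat \<Rightarrow> (nat \<times> nat) set \<Rightarrow> bool" where
  "connected_graph n E \<longleftrightarrow>
     E \<subseteq> {..<n} \<times> {..<n} \<and> sym E \<and> irrefl E \<and> (\<forall>u<n. \<forall>v<n. (u, v) \<in> E\<^sup>*)"

record gossip =
  nodes :: nat
  tokens :: nat
  init :: "(nat \<times> nat) set"  \<comment> \<open>pairs (node, token)\<close>
  graph :: "nat \<Rightarrow> (nat \<times> nat) set"

definition rounds :: "gossip \<Rightarrow> nat set" where
  "rounds I = {1..nodes I * tokens I}"

definition gossip_instance :: "gossip \<Rightarrow> bool" where
  "gossip_instance I \<longleftrightarrow>
     nodes I > 0 \<and>
     init I \<subseteq> {..<nodes I} \<times> {..<tokens I} \<and>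
     (\<forall>i<tokens I. \<exists>u<nodes I. (u, i) \<in> init I) \<and>
     (\<forall>t\<in>rounds I. connected_graph (nodes I) (graph I t))"

text \<open>\<open>S t u v\<close> is the token, if any, that \<open>u\<close> sends to \<open>v\<close> in round \<open>t\<close>.\<close>

type_synonym schedule = "nat \<Rightarrow> nat \<Rightarrow> nat \<Rightarrow> nat option"

text \<open>Tokens held by \<open>u\<close> at the end of round \<open>t\<close>, that is, at the start of round \<open>t + 1\<close>.\<close>

primrec held :: "gossip \<Rightarrow> schedule \<Rightarrow> nat \<Rightarrow> nat \<Rightarrow> nat set" where
  "held I S 0 u = {i. (u, i) \<in> init I}"
| "held I S (Suc t) u =
     held I S t u \<union> {i. \<exists>v. (v, u) \<in> graph I (Suc t) \<and> S (Suc t) v u = Some i}"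

definition valid_schedule :: "gossip \<Rightarrow> schedule \<Rightarrow> bool" where
  "valid_schedule I S \<longleftrightarrow>
     (\<forall>t u v i. S t u v = Some i \<longrightarrow>
        t \<in> rounds I \<and> (u, v) \<in> graph I t \<and> i \<in> held I S (t - 1) u)"

definition disseminates :: "gossip \<Rightarrow> schedule \<Rightarrow> bool" where
  "disseminates I S \<longleftrightarrow>
     (\<forall>u<nodes I. held I S (nodes I * tokens I) u = {..<tokens I})"

definition schedule_length :: "gossip \<Rightarrow> schedule \<Rightarrow> nat" where
  "schedule_length I S = Max (insert 0 {t \<in> rounds I. \<exists>u v. S t u v \<noteq> None})"

text \<open>
  Input: \<open>n\<close> and \<open>k\<close> in unary, the \<open>n \<times> k\<close> matrix of initial holdings, and the \<open>n \<times> n\<close> adjacency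
  matrices of the \<open>n * k\<close> graphs.
\<close>

definition encode :: "gossip \<Rightarrow> bool list" where
  "encode I =
     replicate (nodes I) True @ [False] @ replicate (tokens I) True @ [False] @
     [(u, i) \<in> init I. u \<leftarrow> [0..<nodes I], i \<leftarrow> [0..<tokens I]] @
     [(u, v) \<in> graph I t.
        t \<leftarrow> [1..<Suc (nodes I * tokens I)], u \<leftarrow> [0..<nodes I], v \<leftarrow> [0..<nodes I]]"

text \<open>
  Output: one array cell for each round and each ordered pair of nodes, in the same order as in the
  input, where \<open>0\<close> stands for no token and \<open>Suc i\<close> for token \<open>i\<close>.
\<close>

definition decode :: "gossip \<Rightarrow> (nat \<Rightarrow> nat) \<Rightarrow> schedule" where
  "decode I y t u v =
     (if t \<in> rounds I \<and> u < nodes I \<and> v < nodes I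
      then case y (((t - 1) * nodes I + u) * nodes I + v) of 0 \<Rightarrow> None | Suc i \<Rightarrow> Some i
      else None)"

end

(*
  Let A_L be the set of all nodes, L = O(log n), and draw A_(j-1) from A_j by keeping node 0 and
  each other member with probability 1/2, except that A_0 = {0}; with high probability A_1 = {0} as
  well.  Phase 0 gathers all tokens at node 0, as the time reversal of spreading them from
  there, and phase j > 0 sends every token from A_(j-1) to every node of A_j.  A phase takes
  O(n + k log n) rounds.  It is a multi-source flow in the time-expanded graph of its rounds, with
  unit capacity on the edges of the G_t, and is found by augmenting paths.

  By max-flow min-cut it suffices that every cut of a phase has enough capacity.  A closed cut is a
  decreasing sequence of node sets, so it stays constant in all but n rounds, and in a constant
  round its capacity is the number of boundary edges.  A connected graph has a linear arrangement in
  which every set C has at most as many runs as boundary edges.  Hence, if A_(j-1) hits every window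
  of O(log n) consecutive members of A_j in the arrangement, a set C that avoids A_(j-1) contains at
  most O(log n) members of A_j per boundary edge.  A single round has this property except with
  polynomially small probability, and by Markov's inequality most rounds of a phase have it.

  Tracing the flow of every packet back to its source gives the schedule.  If the available rounds
  do not suffice for all phases, or some flow does not exist, the algorithm floods the tokens one
  after the other, n rounds for each, so that its output is always correct.
*)
theory Submission
  imports Defs
begin

text \<open>A spreading phase is a flow with one commodity: all its sources know every token, so any
  path from a source to the destination of a packet will do. In the gathering phase the holders
  differ from token to token; reversing time gives one common source and one prescribed destination
  per token. Sending everything from node 0 directly to all nodes fails: behind a single edge there
  may be about \<open>n\<close> nodes demanding \<open>n * k\<close> units, and the edge passes one
  unit per round. Halving the levels keeps the demand per boundary edge and token logarithmic. A
  union bound over the cuts of the expanded network is hopeless, as there are too many. Randomness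
  is therefore confined to at most \<open>n\<close> windows of one arrangement per round, which
  depends on the graph only; what follows about cuts is deterministic. All coins are flipped at the
  start. The remaining program is verified for each coin array separately and its output is correct
  for all of them, so that probability concerns only the length.\<close>

subsection \<open>A Hoare logic with time bounds\<close>

text \<open>Bounds the running time if every loop is entered at most \<open>M\<close> times in a row.\<close>

primrec time_bound :: "nat \<Rightarrow> com \<Rightarrow> nat" where
  "time_bound M Skip = 0"
| "time_bound M (Assign x e) = 1"
| "time_bound M (Store a e f) = 1"
| "time_bound M (Flip x) = 1"
| "time_bound M (Seq c d) = Suc (time_bound M c + time_bound M d)"
| "time_bound M (Cond b c d) = Suc (time_bound M c + time_bound M d)"
| "time_bound M (While b c) = Suc (M * (time_bound M c + 2))"

text \<open>Each level of loop nesting contributes one factor \<open>M\<close>, and the program text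
  is fixed. As \<open>M\<close> will be linear in the input length, this is the whole running time
  analysis.\<close>

lemma time_bound_poly: "\<exists>p :: nat poly. \<forall>M. time_bound M c = poly p M"
proof (induction c)
  case Skip
  show ?case by (rule exI[of _ 0]) simp
next
  case (Seq c d)
  then obtain p q :: "nat poly" where "\<forall>M. time_bound M c = poly p M" "\<forall>M. time_bound M d = poly q M"
    by blast
  then show ?case by (intro exI[of _ "1 + p + q"]) simp
next
  case (Cond b c d)
  then obtain p q :: "nat poly" where "\<forall>M. time_bound M c = poly p M" "\<forall>M. time_bound M d = poly q M"
    by blast
  then show ?case by (intro exI[of _ "1 + p + q"]) simp
next
  case (While b c)
  then obtain p :: "nat poly" where "\<forall>M. time_bound M c = poly p M" by blast
  then show ?case by (intro exI[of _ "1 + [:0, 1:] * (p + 2)"]) simp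
qed (rule exI[of _ 1], simp)+

lemma run_Skip [simp]: "run t (Skip, s) = return_pmf (Skip, s)"
  by (induction t) (simp_all add: bind_return_pmf)

lemma run_add: "run (a + b) cs = bind_pmf (run a cs) (run b)"
proof (induction a arbitrary: cs)
  case (Suc a)
  have "run (a + b) = (\<lambda>cs. bind_pmf (run a cs) (run b))"
    by (rule ext) (rule Suc.IH)
  then show ?case by (simp add: bind_assoc_pmf)
qed (simp add: bind_return_pmf)

lemma run_halted:
  assumes "\<forall>cs \<in> set_pmf (run a cs0). fst cs = Skip" "a \<le> b"
  shows "run b cs0 = run a cs0"
proof -
  have "run b cs0 = bind_pmf (run a cs0) (run (b - a))"
    using assms(2) by (simp flip: run_add)
  also have "\<dots> = bind_pmf (run a cs0) return_pmf"
    by (rule bind_pmf_cong[OF refl]) (metis assms(1) run_Skip prod.collapse)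
  finally show ?thesis by (simp add: bind_return_pmf')
qed

text \<open>The extra step is the one from \<open>Seq Skip d\<close> to \<open>d\<close>. If
  \<open>c\<close> halts before its allowance is used up, the surplus is spent idly after
  \<open>d\<close> has halted, so upper bounds on the times of the parts suffice.\<close>

lemma run_Seq:
  assumes "\<forall>cs \<in> set_pmf (run a (c, s)). fst cs = Skip \<and>
      (\<forall>cs' \<in> set_pmf (run b (d, snd cs)). fst cs' = Skip)"
  shows "run (Suc (a + b)) (Seq c d, s) = bind_pmf (run a (c, s)) (\<lambda>cs. run b (d, snd cs))"
  using assms
proof (induction a arbitrary: c s)
  case 0
  then show ?case by (simp add: bind_return_pmf)
next
  case (Suc a)
  show ?case
  proof (cases "c = Skip")
    case True
    have "run (Suc (Suc a + b)) (Seq c d, s) = run (Suc a + b) (d, s)"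
      using True by (simp add: bind_return_pmf)
    also have "\<dots> = run b (d, s)"
      using Suc.prems unfolding True run_Skip by (intro run_halted) simp_all
    finally show ?thesis unfolding True run_Skip by (simp add: bind_return_pmf del: run.simps)
  next
    case False
    have "run (Suc (Suc a + b)) (Seq c d, s) =
        bind_pmf (step c s) (\<lambda>x. run (Suc (a + b)) (Seq (fst x) d, snd x))"
      using False by (subst run.simps(2)) (simp add: bind_map_pmf case_prod_unfold del: run.simps)
    also have "\<dots> = bind_pmf (step c s)
        (\<lambda>x. bind_pmf (run a (fst x, snd x)) (\<lambda>cs. run b (d, snd cs)))"
    proof (rule bind_pmf_cong[OF refl])
      fix x assume "x \<in> set_pmf (step c s)"
      then have "set_pmf (run a (fst x, snd x)) \<subseteq> set_pmf (run (Suc a) (c, s))"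
        by auto
      with Suc.prems show "run (Suc (a + b)) (Seq (fst x) d, snd x) =
          bind_pmf (run a (fst x, snd x)) (\<lambda>cs. run b (d, snd cs))"
        by (intro Suc.IH) blast
    qed
    also have "\<dots> = bind_pmf (run (Suc a) (c, s)) (\<lambda>cs. run b (d, snd cs))"
      by (simp only: run.simps(2) fst_conv snd_conv bind_assoc_pmf prod.collapse)
    finally show ?thesis .
  qed
qed

text \<open>Quantifying over the support treats coin flips as nondeterminism, which is right for
  correctness and worst-case time. The time depends only on \<open>M\<close> and the program text,
  not on the start state, so that runs can be composed by \<open>run_Seq\<close>.\<close>

definition hoare :: "nat \<Rightarrow> (state \<Rightarrow> bool) \<Rightarrow> com \<Rightarrow> (state \<Rightarrow> bool) \<Rightarrow> bool" where
  "hoare M P c Q \<longleftrightarrow>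
     (\<forall>s. P s \<longrightarrow> (\<forall>cs \<in> set_pmf (run (time_bound M c) (c, s)). fst cs = Skip \<and> Q (snd cs)))"

lemma hoare_conseq:
  assumes "hoare M P c Q" "\<And>s. P' s \<Longrightarrow> P s" "\<And>s. Q s \<Longrightarrow> Q' s"
  shows "hoare M P' c Q'"
  using assms unfolding hoare_def by blast

lemma hoare_pre: "hoare M P c Q \<Longrightarrow> (\<And>s. P' s \<Longrightarrow> P s) \<Longrightarrow> hoare M P' c Q"
  by (rule hoare_conseq)

lemma hoare_post: "hoare M P c Q \<Longrightarrow> (\<And>s. Q s \<Longrightarrow> Q' s) \<Longrightarrow> hoare M P c Q'"
  by (rule hoare_conseq)

lemma hoare_ex: "(\<And>x. hoare M (P x) c Q) \<Longrightarrow> hoare M (\<lambda>s. \<exists>x. P x s) c Q"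
  unfolding hoare_def by blast

lemma hoare_False: "(\<And>s. P s \<Longrightarrow> False) \<Longrightarrow> hoare M P c Q"
  unfolding hoare_def by blast

lemma hoare_Skip: "(\<And>s. P s \<Longrightarrow> Q s) \<Longrightarrow> hoare M P Skip Q"
  by (simp add: hoare_def)

lemma hoare_Assign: "(\<And>s. P s \<Longrightarrow> Q (set_reg x (aval e s) s)) \<Longrightarrow> hoare M P (Assign x e) Q"
  by (simp add: hoare_def bind_return_pmf)

lemma hoare_Store:
  "(\<And>s. P s \<Longrightarrow> Q (set_arr a (aval e s) (aval f s) s)) \<Longrightarrow> hoare M P (Store a e f) Q"
  by (simp add: hoare_def bind_return_pmf)

lemma hoare_Flip: "(\<And>s b. P s \<Longrightarrow> Q (set_reg x (of_bool b) s)) \<Longrightarrow> hoare M P (Flip x) Q"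
  by (auto simp: hoare_def bind_return_pmf bind_map_pmf set_bind_pmf)

lemma hoare_Seq:
  assumes "hoare M P c R" "hoare M R d Q"
  shows "hoare M P (Seq c d) Q"
  unfolding hoare_def
proof (intro allI impI)
  fix s assume "P s"
  with assms have "run (time_bound M (Seq c d)) (Seq c d, s) =
      bind_pmf (run (time_bound M c) (c, s)) (\<lambda>cs. run (time_bound M d) (d, snd cs))"
    unfolding time_bound.simps hoare_def by (intro run_Seq) blast
  with \<open>P s\<close> assms show "\<forall>cs \<in> set_pmf (run (time_bound M (Seq c d)) (Seq c d, s)). fst cs = Skip \<and> Q (snd cs)"
    unfolding hoare_def by auto
qed

lemma hoare_Cond:
  assumes "hoare M (\<lambda>s. P s \<and> bval b s) c Q" "hoare M (\<lambda>s. P s \<and> \<not> bval b s) d Q"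
  shows "hoare M P (Cond b c d) Q"
  unfolding hoare_def
proof (intro allI impI)
  fix s assume "P s"
  define e where "e = (if bval b s then c else d)"
  have "\<forall>cs \<in> set_pmf (run (time_bound M e) (e, s)). fst cs = Skip \<and> Q (snd cs)"
    using assms \<open>P s\<close> by (simp add: hoare_def e_def)
  moreover have "run (time_bound M (Cond b c d)) (Cond b c d, s) = run (time_bound M c + time_bound M d) (e, s)"
    by (simp add: bind_return_pmf e_def)
  \<comment> \<open>The allowance for the branch not taken becomes idle time.\<close>
  moreover have "run (time_bound M c + time_bound M d) (e, s) = run (time_bound M e) (e, s)"
    using calculation(1) by (intro run_halted) (auto simp: e_def)
  ultimately show "\<forall>cs \<in> set_pmf (run (time_bound M (Cond b c d)) (Cond b c d, s)). fst cs = Skip \<and> Q (snd cs)"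
    by simp
qed

text \<open>The variant also counts the iterations still to come: being at most \<open>M\<close>, it
  keeps them within what \<open>time_bound\<close> pays for.\<close>

lemma hoare_While:
  fixes V :: "state \<Rightarrow> nat"
  assumes body: "\<And>v. hoare M (\<lambda>s. I s \<and> bval b s \<and> V s = v) c (\<lambda>s. I s \<and> V s < v)"
    and V: "\<And>s. I s \<Longrightarrow> V s \<le> M" "\<And>s. I s \<Longrightarrow> bval b s \<Longrightarrow> 0 < V s"
  shows "hoare M I (While b c) (\<lambda>s. I s \<and> \<not> bval b s)"
proof -
  let ?w = "While b c" and ?t = "time_bound M c"
  have *: "I s \<Longrightarrow> V s \<le> v \<Longrightarrow> \<forall>cs \<in> set_pmf (run (Suc (v * (?t + 2))) (?w, s)).
      fst cs = Skip \<and> I (snd cs) \<and> \<not> bval b (snd cs)" for s v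
  proof (induction v arbitrary: s)
    case 0
    then have "\<not> bval b s" using V(2) by fastforce
    then show ?case using 0 by (simp add: bind_return_pmf)
  next
    case (Suc v)
    show ?case
    proof (cases "bval b s")
      case False
      then show ?thesis using Suc.prems by (simp add: bind_return_pmf)
    next
      case True
      have b: "\<forall>cs \<in> set_pmf (run ?t (c, s)). fst cs = Skip \<and> I (snd cs) \<and> V (snd cs) < V s"
        using body[of "V s"] Suc.prems True by (simp add: hoare_def)
      have rec: "\<forall>cs \<in> set_pmf (run ?t (c, s)). fst cs = Skip \<and>
          (\<forall>cs' \<in> set_pmf (run (Suc (v * (?t + 2))) (?w, snd cs)).
             fst cs' = Skip \<and> I (snd cs') \<and> \<not> bval b (snd cs'))"
      proof
        fix cs assume "cs \<in> set_pmf (run ?t (c, s))"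
        with b have "fst cs = Skip" "I (snd cs)" "V (snd cs) \<le> v"
          using Suc.prems(2) by (auto simp del: run.simps)
        with Suc.IH show "fst cs = Skip \<and> (\<forall>cs' \<in> set_pmf (run (Suc (v * (?t + 2))) (?w, snd cs)).
             fst cs' = Skip \<and> I (snd cs') \<and> \<not> bval b (snd cs'))" by blast
      qed
      \<comment> \<open>One step evaluates the test and one leaves the finished body; these are the
        \<open>2\<close> in the bound.\<close>
      have eq: "Suc (Suc v * (?t + 2)) = Suc (Suc (?t + Suc (v * (?t + 2))))" by simp
      have "run (Suc (Suc v * (?t + 2))) (?w, s) =
          run (Suc (?t + Suc (v * (?t + 2)))) (Seq c ?w, s)"
        unfolding eq by (subst run.simps(2)) (simp add: True bind_return_pmf del: run.simps)
      also have "\<dots> = bind_pmf (run ?t (c, s)) (\<lambda>cs. run (Suc (v * (?t + 2))) (?w, snd cs))"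
        using rec by (intro run_Seq) blast
      finally show ?thesis using rec by (simp del: run.simps)
    qed
  qed
  show ?thesis unfolding hoare_def using *[of _ M] V(1) by auto
qed

section \<open>Frame rule: what a program cannot change\<close>

primrec written_regs :: "com \<Rightarrow> string set" where
  "written_regs Skip = {}"
| "written_regs (Assign x e) = {x}"
| "written_regs (Store a e f) = {}"
| "written_regs (Flip x) = {x}"
| "written_regs (Seq c d) = written_regs c \<union> written_regs d"
| "written_regs (Cond b c d) = written_regs c \<union> written_regs d"
| "written_regs (While b c) = written_regs c"

primrec written_arrs :: "com \<Rightarrow> string set" where
  "written_arrs Skip = {}"
| "written_arrs (Assign x e) = {}"
| "written_arrs (Store a e f) = {a}"
| "written_arrs (Flip x) = {}"
| "written_arrs (Seq c d) = written_arrs c \<union> written_arrs d"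
| "written_arrs (Cond b c d) = written_arrs c \<union> written_arrs d"
| "written_arrs (While b c) = written_arrs c"

definition agree :: "string set \<Rightarrow> string set \<Rightarrow> state \<Rightarrow> state \<Rightarrow> bool" where
  "agree X A s s' \<longleftrightarrow> (\<forall>x. x \<notin> X \<longrightarrow> reg s' x = reg s x) \<and> (\<forall>a. a \<notin> A \<longrightarrow> arr s' a = arr s a)"

lemma agree_reg: "agree X A s s' \<Longrightarrow> x \<notin> X \<Longrightarrow> reg s' x = reg s x"
  by (simp add: agree_def)

lemma agree_arr: "agree X A s s' \<Longrightarrow> a \<notin> A \<Longrightarrow> arr s' a = arr s a"
  by (simp add: agree_def)

lemma reg_set_reg [simp]: "reg (set_reg x m s) y = (if y = x then m else reg s y)"
  and reg_set_arr [simp]: "reg (set_arr a i m s) = reg s"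
  and arr_set_reg [simp]: "arr (set_reg x m s) = arr s"
  and arr_set_arr [simp]: "arr (set_arr a i m s) b = (if b = a then (arr s b)(i := m) else arr s b)"
  by (simp_all add: set_reg_def set_arr_def)

lemma step_agree:
  "(c', s') \<in> set_pmf (step c s) \<Longrightarrow>
     agree (written_regs c) (written_arrs c) s s' \<and>
     written_regs c' \<subseteq> written_regs c \<and> written_arrs c' \<subseteq> written_arrs c"
proof (induction c arbitrary: c' s')
  case (Seq c d)
  show ?case
  proof (cases "c = Skip")
    case True
    then show ?thesis using Seq.prems by (simp add: agree_def)
  next
    case False
    then obtain c'' where c'': "c' = Seq c'' d" "(c'', s') \<in> set_pmf (step c s)"
      using Seq.prems by auto
    with Seq.IH(1)[OF c''(2)] show ?thesis by (auto simp: agree_def)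
  qed
qed (auto simp: agree_def split: if_splits)

lemma run_agree:
  "cs \<in> set_pmf (run t (c, s)) \<Longrightarrow> agree (written_regs c) (written_arrs c) s (snd cs)"
proof (induction t arbitrary: c s)
  case 0
  then show ?case by (simp add: agree_def)
next
  case (Suc t)
  then obtain c' s' where "(c', s') \<in> set_pmf (step c s)" "cs \<in> set_pmf (run t (c', s'))"
    by auto
  with step_agree[OF this(1)] Suc.IH[OF this(2)] show ?case
    unfolding agree_def by (intro conjI) (metis subsetD)+
qed

text \<open>Agreement outside the written variables is a semantic notion, so \<open>F\<close> may be
  any predicate on states and no syntax of assertions is required.\<close>

definition stable :: "(state \<Rightarrow> bool) \<Rightarrow> string set \<Rightarrow> string set \<Rightarrow> bool" where
  "stable F X A \<longleftrightarrow> (\<forall>s s'. F s \<longrightarrow> agree X A s s' \<longrightarrow> F s')"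

lemma hoare_frame:
  assumes "hoare M P c Q" "stable F (written_regs c) (written_arrs c)"
  shows "hoare M (\<lambda>s. P s \<and> F s) c (\<lambda>s. Q s \<and> F s)"
  using assms run_agree unfolding hoare_def stable_def by fast

lemma hoare_Seq_frame:
  assumes "hoare M P c R" "stable F (written_regs c) (written_arrs c)"
    "hoare M (\<lambda>s. R s \<and> F s) d Q" "\<And>s. P' s \<Longrightarrow> P s \<and> F s"
  shows "hoare M P' (Seq c d) Q"
  by (rule hoare_Seq[OF hoare_pre[OF hoare_frame[OF assms(1,2)] assms(4)] assms(3)])

text \<open>Meant for loop-free code. Mapping loops to \<open>False\<close> keeps
  \<open>hoare_wp\<close> sound without invariant annotations: it merely becomes useless
  there.\<close>

primrec wp :: "com \<Rightarrow> (state \<Rightarrow> bool) \<Rightarrow> state \<Rightarrow> bool" where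
  "wp Skip Q = Q"
| "wp (Assign x e) Q = (\<lambda>s. Q (set_reg x (aval e s) s))"
| "wp (Store a e f) Q = (\<lambda>s. Q (set_arr a (aval e s) (aval f s) s))"
| "wp (Flip x) Q = (\<lambda>s. \<forall>b. Q (set_reg x (of_bool b) s))"
| "wp (Seq c d) Q = wp c (wp d Q)"
| "wp (Cond b c d) Q = (\<lambda>s. if bval b s then wp c Q s else wp d Q s)"
| "wp (While b c) Q = (\<lambda>s. False)"

lemma hoare_wp: "(\<And>s. P s \<Longrightarrow> wp c Q s) \<Longrightarrow> hoare M P c Q"
proof (induction c arbitrary: P Q)
  case (Seq c d)
  show ?case
    by (rule hoare_Seq[OF Seq.IH(1) Seq.IH(2)]) (use Seq.prems in auto)
next
  case (Cond b c d)
  show ?case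
    by (rule hoare_Cond[OF Cond.IH(1) Cond.IH(2)]) (use Cond.prems in auto)
next
  case (While b c)
  show ?case by (rule hoare_False) (use While.prems in simp)
qed (simp_all add: hoare_Skip hoare_Assign hoare_Store hoare_Flip)

abbreviation seq :: "com \<Rightarrow> com \<Rightarrow> com" (infixr ";;" 55) where
  "c ;; d \<equiv> Seq c d"

abbreviation Incr :: "string \<Rightarrow> com" where
  "Incr x \<equiv> Assign x (Plus (Var x) (Const 1))"

definition For :: "string \<Rightarrow> aexp \<Rightarrow> com \<Rightarrow> com" where
  "For x e c = Seq (Assign x (Const 0)) (While (BLess (Var x) e) (Seq c (Incr x)))"

lemma written_For [simp]:
  "written_regs (For x e c) = insert x (written_regs c)"
  "written_arrs (For x e c) = written_arrs c"
  by (auto simp: For_def)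

text \<open>The invariant is split into \<open>F\<close>, which the loop cannot affect, and
  \<open>I j\<close>, which evolves. \<open>F\<close> fixes the value \<open>N\<close> of the limit
  once and for all, and as \<open>I\<close> does not look at the counter, the increment preserves
  it. The variant argument for counting loops is made only here.\<close>

lemma hoare_For:
  assumes F: "stable F (insert x (written_regs c)) (written_arrs c)"
    and e: "\<And>s. F s \<Longrightarrow> aval e s = N" and N: "N \<le> M" and x: "x \<notin> written_regs c"
    and I: "\<And>i j s. I j (set_reg x i s) = I j s"
    and body: "\<And>j. j < N \<Longrightarrow> hoare M (\<lambda>s. F s \<and> I j s \<and> reg s x = j) c (I (Suc j))"
  shows "hoare M (\<lambda>s. F s \<and> I 0 s) (For x e c) (\<lambda>s. F s \<and> I N s)"
proof -
  let ?b = "BLess (Var x) e" and ?c = "Seq c (Incr x)"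
  have Fx: "F (set_reg x i s) = F s" for i s
  proof
    assume "F s"
    then show "F (set_reg x i s)" using F unfolding stable_def agree_def by simp
  next
    assume *: "F (set_reg x i s)"
    have "agree {x} {} (set_reg x i s) s" by (simp add: agree_def)
    then have "agree (insert x (written_regs c)) (written_arrs c) (set_reg x i s) s"
      by (simp add: agree_def)
    then show "F s" using * F unfolding stable_def by blast
  qed
  define J where "J s = (F s \<and> reg s x \<le> N \<and> I (reg s x) s)" for s
  have "hoare M J (While ?b ?c) (\<lambda>s. J s \<and> \<not> bval ?b s)"
  proof (rule hoare_While[where V = "\<lambda>s. N - reg s x"])
    fix v
    have "hoare M (\<lambda>s. J s \<and> bval ?b s \<and> N - reg s x = v \<and> reg s x = j) ?c (\<lambda>s. J s \<and> N - reg s x < v)" for j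
    proof (cases "j < N")
      case True
      have st: "stable (\<lambda>s. F s \<and> reg s x = j) (written_regs c) (written_arrs c)"
        using F x unfolding stable_def agree_def by auto
      show ?thesis
      proof (rule hoare_Seq)
        show "hoare M (\<lambda>s. J s \<and> bval ?b s \<and> N - reg s x = v \<and> reg s x = j) c
           (\<lambda>s. I (Suc j) s \<and> F s \<and> reg s x = j \<and> N - j = v)"
        proof (cases "N - j = v")
          case v: True
          show ?thesis
            by (rule hoare_conseq[OF hoare_frame[OF body[OF True] st]]) (auto simp: J_def v)
        next
          case False
          then show ?thesis by (intro hoare_False) auto
        qed
        show "hoare M (\<lambda>s. I (Suc j) s \<and> F s \<and> reg s x = j \<and> N - j = v) (Incr x) (\<lambda>s. J s \<and> N - reg s x < v)"
          using True by (intro hoare_Assign) (auto simp: J_def Fx I)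
      qed
    next
      case False
      then show ?thesis by (intro hoare_False) (auto simp: J_def e)
    qed
    then show "hoare M (\<lambda>s. J s \<and> bval ?b s \<and> N - reg s x = v) ?c (\<lambda>s. J s \<and> N - reg s x < v)"
      by (rule hoare_pre[OF hoare_ex]) auto
  next
    show "N - reg s x \<le> M" if "J s" for s
      using N by simp
    show "0 < N - reg s x" if "J s" "bval ?b s" for s
      using that by (simp add: J_def e)
  qed
  then have *: "hoare M J (While ?b ?c) (\<lambda>s. F s \<and> I N s)"
    by (rule hoare_post) (auto simp: J_def e)
  show ?thesis unfolding For_def
    by (rule hoare_Seq[OF hoare_Assign *]) (auto simp: J_def Fx I)
qed

lemma hoare_For_conseq:
  assumes pre: "\<And>s. P s \<Longrightarrow> F s \<and> I 0 s"
    and F: "stable F (insert x (written_regs c)) (written_arrs c)"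
    and e: "\<And>s. F s \<Longrightarrow> aval e s = N" and N: "N \<le> M" and x: "x \<notin> written_regs c"
    and I: "\<And>i j s. I j (set_reg x i s) = I j s"
    and body: "\<And>j. j < N \<Longrightarrow> hoare M (\<lambda>s. F s \<and> I j s \<and> reg s x = j) c (I (Suc j))"
    and post: "\<And>s. F s \<Longrightarrow> I N s \<Longrightarrow> Q s"
  shows "hoare M P (For x e c) Q"
  by (rule hoare_conseq[OF hoare_For[where F = F and I = I and N = N]])
    (use assms in blast)+

lemma hoare_For_wp:
  assumes pre: "\<And>s. P s \<Longrightarrow> F s \<and> I 0 s"
    and F: "stable F (insert x (written_regs c)) (written_arrs c)"
    and e: "\<And>s. F s \<Longrightarrow> aval e s = N" and N: "N \<le> M" and x: "x \<notin> written_regs c"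
    and I: "\<And>i j s. I j (set_reg x i s) = I j s"
    and post: "\<And>s. F s \<Longrightarrow> I N s \<Longrightarrow> Q s"
    and body: "\<And>j s. j < N \<Longrightarrow> F s \<Longrightarrow> I j s \<Longrightarrow> reg s x = j \<Longrightarrow> wp c (I (Suc j)) s"
  shows "hoare M P (For x e c) Q"
  by (rule hoare_For_conseq[where F = F and I = I and N = N, OF pre F e N x I hoare_wp])
    (use body post in blast)+

lemmas stable_simps = stable_def agree_def

definition BEq :: "aexp \<Rightarrow> aexp \<Rightarrow> bexp" where
  "BEq e f = BAnd (BNot (BLess e f)) (BNot (BLess f e))"

lemma bval_BEq [simp]: "bval (BEq e f) s \<longleftrightarrow> aval e s = aval f s"
  by (auto simp: BEq_def)

subsection \<open>Residual networks\<close>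

text \<open>
  A flow is represented by its residual capacities \<open>r\<close>; the net flow from \<open>x\<close> to \<open>y\<close> is
  \<open>cap x y - r x y\<close>, so that \<open>out_sum W r x - out_sum W cap x\<close> is the net flow into \<open>x\<close>.
\<close>

definition residual :: "nat \<Rightarrow> (nat \<Rightarrow> nat \<Rightarrow> nat) \<Rightarrow> (nat \<Rightarrow> nat \<Rightarrow> nat) \<Rightarrow> bool" where
  "residual W cap r \<longleftrightarrow> (\<forall>x<W. \<forall>y<W. r x y + r y x = cap x y + cap y x)"

definition out_sum :: "nat \<Rightarrow> (nat \<Rightarrow> nat \<Rightarrow> nat) \<Rightarrow> nat \<Rightarrow> nat" where
  "out_sum W r x = (\<Sum>y<W. r x y)"

text \<open>Pushes one unit of flow from \<open>x\<close> to \<open>y\<close>, which may also mean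
  to cancel a unit flowing from \<open>y\<close> to \<open>x\<close>.\<close>

definition shift :: "nat \<Rightarrow> nat \<Rightarrow> (nat \<Rightarrow> nat \<Rightarrow> nat) \<Rightarrow> nat \<Rightarrow> nat \<Rightarrow> nat" where
  "shift x y r a b = (if a = x \<and> b = y then r a b - 1 else if a = y \<and> b = x then r a b + 1 else r a b)"

lemma residual_shift:
  assumes "residual W cap r" "0 < r x y" "x \<noteq> y"
  shows "residual W cap (shift x y r)"
  unfolding residual_def
proof (intro allI impI)
  fix a b assume "a < W" "b < W"
  then have "r a b + r b a = cap a b + cap b a"
    using assms(1) by (simp add: residual_def)
  then show "shift x y r a b + shift x y r b a = cap a b + cap b a"
    using assms(2,3) by (auto simp: shift_def)
qed

text \<open>The net inflow of \<open>x\<close> drops and that of \<open>y\<close> rises. The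
  corrections are added on both sides to avoid truncated subtraction.\<close>

lemma out_sum_shift:
  assumes "0 < r x y" "x \<noteq> y" "x < W" "y < W"
  shows "out_sum W (shift x y r) z + of_bool (z = x) = out_sum W r z + of_bool (z = y)"
proof -
  have rm: "out_sum W q z = q z w + (\<Sum>b\<in>{..<W} - {w}. q z b)" if "w < W" for q w
    using that unfolding out_sum_def by (simp add: sum.remove)
  consider "z = x" | "z = y" "z \<noteq> x" | "z \<noteq> x" "z \<noteq> y" by blast
  then show ?thesis
  proof cases
    case 1
    have "(\<Sum>b\<in>{..<W} - {y}. shift x y r z b) = (\<Sum>b\<in>{..<W} - {y}. r z b)"
      using assms 1 by (intro sum.cong) (auto simp: shift_def)
    then show ?thesis using rm[of y "shift x y r"] rm[of y r] assms 1 by (simp add: shift_def)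
  next
    case 2
    have "(\<Sum>b\<in>{..<W} - {x}. shift x y r z b) = (\<Sum>b\<in>{..<W} - {x}. r z b)"
      using assms 2 by (intro sum.cong) (auto simp: shift_def)
    then show ?thesis using rm[of x "shift x y r"] rm[of x r] assms 2 by (simp add: shift_def)
  next
    case 3
    then show ?thesis by (simp add: out_sum_def shift_def)
  qed
qed

text \<open>If no residual arc enters \<open>C\<close>, the net flow into \<open>C\<close> is the
  full capacity of the entering arcs. Flow between members of \<open>C\<close> cancels in the sum
  over \<open>C\<close>, so only this capacity remains.\<close>

lemma residual_cut:
  assumes r: "residual W cap r" and C: "C \<subseteq> {..<W}"
    and closed: "\<And>x y. x < W \<Longrightarrow> x \<notin> C \<Longrightarrow> y \<in> C \<Longrightarrow> r x y = 0"
  shows "(\<Sum>y\<in>C. out_sum W r y) = (\<Sum>y\<in>C. out_sum W cap y) + (\<Sum>y\<in>C. \<Sum>x\<in>{..<W} - C. cap x y)"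
proof -
  have fin: "finite C" using C finite_subset by blast
  have split: "out_sum W q y = (\<Sum>x\<in>C. q y x) + (\<Sum>x\<in>{..<W} - C. q y x)" for q y
  proof -
    have "sum (q y) {..<W} = sum (q y) ({..<W} - C) + sum (q y) C"
      by (rule sum.subset_diff[OF C]) simp
    then show ?thesis by (simp add: out_sum_def)
  qed
  \<comment> \<open>\<open>residual\<close> controls only the sum over both directions of a pair,
    hence double sums are symmetrised before they are compared.\<close>
  have double: "2 * (\<Sum>y\<in>C. \<Sum>x\<in>C. q y x) = (\<Sum>y\<in>C. \<Sum>x\<in>C. q y x + q x y)" for q :: "nat \<Rightarrow> nat \<Rightarrow> nat"
  proof -
    have "(\<Sum>y\<in>C. \<Sum>x\<in>C. q y x) = (\<Sum>y\<in>C. \<Sum>x\<in>C. q x y)" by (rule sum.swap)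
    then show ?thesis unfolding sum.distrib by linarith
  qed
  have "(\<Sum>y\<in>C. \<Sum>x\<in>C. r y x + r x y) = (\<Sum>y\<in>C. \<Sum>x\<in>C. cap y x + cap x y)"
    using r C by (intro sum.cong refl) (auto simp: residual_def)
  then have inner: "(\<Sum>y\<in>C. \<Sum>x\<in>C. r y x) = (\<Sum>y\<in>C. \<Sum>x\<in>C. cap y x)"
    using double[of r] double[of cap] by linarith
  have "r y x = cap y x + cap x y" if "y \<in> C" "x \<in> {..<W} - C" for x y
    using r C closed[of x y] that unfolding residual_def by fastforce
  then have outer: "(\<Sum>y\<in>C. \<Sum>x\<in>{..<W} - C. r y x) = (\<Sum>y\<in>C. \<Sum>x\<in>{..<W} - C. cap y x + cap x y)"
    by (intro sum.cong refl) simp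
  show ?thesis
    by (simp add: split sum.distrib inner outer)
qed

definition demand :: "(nat \<Rightarrow> nat) \<Rightarrow> nat set \<Rightarrow> nat \<Rightarrow> nat" where
  "demand dest J z = card {p \<in> J. dest p = z}"

lemma sum_demand:
  assumes "finite J" "finite C"
  shows "(\<Sum>z\<in>C. demand dest J z) = card {p \<in> J. dest p \<in> C}"
proof -
  have "{p \<in> J. dest p \<in> C} = (\<Union>z\<in>C. {p \<in> J. dest p = z})" by auto
  also have "card \<dots> = (\<Sum>z\<in>C. card {p \<in> J. dest p = z})"
    using assms by (intro card_UN_disjoint) auto
  finally show ?thesis by (simp add: demand_def)
qed

text \<open>One unit has been delivered for each packet in \<open>J\<close>, and the vertex
  \<open>s\<close> absorbs the balance. The routes of individual packets are not recorded; they are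
  recovered by tracing.\<close>

definition serves :: "nat \<Rightarrow> (nat \<Rightarrow> nat \<Rightarrow> nat) \<Rightarrow> (nat \<Rightarrow> nat) \<Rightarrow> nat set \<Rightarrow> nat \<Rightarrow> (nat \<Rightarrow> nat \<Rightarrow> nat) \<Rightarrow> bool" where
  "serves W cap dest J s r \<longleftrightarrow> residual W cap r \<and>
     (\<forall>z<W. z \<noteq> s \<longrightarrow> out_sum W r z = out_sum W cap z + demand dest J z)"

definition cut_condition :: "nat \<Rightarrow> (nat \<Rightarrow> nat \<Rightarrow> nat) \<Rightarrow> (nat \<Rightarrow> nat) \<Rightarrow> nat set \<Rightarrow> nat \<Rightarrow> bool" where
  "cut_condition W cap dest J s \<longleftrightarrow>
     (\<forall>C. C \<subseteq> {..<W} \<longrightarrow> s \<notin> C \<longrightarrow>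
        card {p \<in> J. dest p \<in> C} \<le> (\<Sum>y\<in>C. \<Sum>x\<in>{..<W} - C. cap x y))"

text \<open>This is the max-flow min-cut theorem in the form that it is needed for unit augmentations.\<close>

lemma augmentable:
  assumes r: "serves W cap dest {..<p} s r" and cut: "cut_condition W cap dest {..<P} s" and p: "p < P"
    and C: "C \<subseteq> {..<W}" "dest p \<in> C"
    and closed: "\<And>x y. x < W \<Longrightarrow> x \<notin> C \<Longrightarrow> y \<in> C \<Longrightarrow> r x y = 0"
  shows "s \<in> C"
proof (rule ccontr)
  assume s: "s \<notin> C"
  have fin: "finite C" using C finite_subset by blast
  have "(\<Sum>y\<in>C. out_sum W r y) = (\<Sum>y\<in>C. out_sum W cap y + demand dest {..<p} y)"
    using r C s by (intro sum.cong) (auto simp: serves_def)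
  then have "(\<Sum>y\<in>C. \<Sum>x\<in>{..<W} - C. cap x y) = card {p' \<in> {..<p}. dest p' \<in> C}"
    using residual_cut[of W cap r C] C(1) closed r fin by (simp add: serves_def sum.distrib sum_demand)
  also have "\<dots> < card {p' \<in> {..<P}. dest p' \<in> C}"
    using p C(2) by (intro psubset_card_mono) auto
  also have "\<dots> \<le> (\<Sum>y\<in>C. \<Sum>x\<in>{..<W} - C. cap x y)"
    using cut C(1) s unfolding cut_condition_def by blast
  finally show False by simp
qed

lemma demand_lessThan_Suc: "demand dest {..<Suc p} z = demand dest {..<p} z + of_bool (z = dest p)"
proof -
  have "{p' \<in> {..<Suc p}. dest p' = z} = {p' \<in> {..<p}. dest p' = z} \<union> (if z = dest p then {p} else {})"
    by (auto simp: less_Suc_eq)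
  then show ?thesis by (simp add: demand_def)
qed

lemma demand_atLeastLessThan:
  "p < P \<Longrightarrow> demand dest {p..<P} z = demand dest {Suc p..<P} z + of_bool (z = dest p)"
proof -
  assume "p < P"
  then have "{p' \<in> {p..<P}. dest p' = z} = {p' \<in> {Suc p..<P}. dest p' = z} \<union> (if z = dest p then {p} else {})"
    by (auto simp: Suc_le_eq le_less)
  then show ?thesis by (simp add: demand_def)
qed

lemma demand_empty [simp]: "demand dest {} z = 0"
  by (simp add: demand_def)

subsection \<open>Linear arrangements and cuts\<close>

text \<open>\<open>b\<close> tells whether the element before the list is in \<open>C\<close>.\<close>

primrec entries :: "'a set \<Rightarrow> bool \<Rightarrow> 'a list \<Rightarrow> nat" where
  "entries C b [] = 0"
| "entries C b (x # xs) = of_bool (\<not> b \<and> x \<in> C) + entries C (x \<in> C) xs"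

lemma entries_bounds:
  "entries C True xs \<le> entries C False xs \<and> entries C False xs \<le> Suc (entries C True xs)"
  by (cases xs) simp_all

text \<open>Deleting elements may merge runs but never creates one. Hence the runs among the members
  of a level are bounded by those in the arrangement of all nodes.\<close>

lemma entries_filter: "entries C b (filter P xs) \<le> entries C b xs"
proof (induction xs arbitrary: b)
  case (Cons x xs)
  show ?case
  proof (cases "P x")
    case False
    then have "entries C b (filter P (x # xs)) \<le> entries C b xs" using Cons.IH by simp
    also have "\<dots> \<le> entries C b (x # xs)"
      using entries_bounds[of C xs] by (cases b; cases "x \<in> C") auto
    finally show ?thesis .
  qed (use Cons.IH in simp)
qed simp

lemma entries_append: "entries C b (xs @ u # ys) = entries C b (xs @ [u]) + entries C (u \<in> C) ys"
  by (induction xs arbitrary: b) auto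

text \<open>A run is added only if exactly one of \<open>u\<close> and \<open>v\<close> lies in
  \<open>C\<close>, that is, if the edge along which \<open>v\<close> is attached crosses the
  boundary. This edge pays for the run.\<close>

lemma entries_insert_after:
  "entries C b (xs @ u # v # ys) \<le> entries C b (xs @ u # ys) + of_bool (u \<in> C \<longleftrightarrow> v \<notin> C)"
proof -
  have "of_bool (u \<notin> C \<and> v \<in> C) + entries C (v \<in> C) ys
      \<le> entries C (u \<in> C) ys + of_bool (u \<in> C \<longleftrightarrow> v \<notin> C)"
    using entries_bounds[of C ys] by (cases "u \<in> C"; cases "v \<in> C") auto
  then show ?thesis
    unfolding entries_append[of C b xs u "v # ys"] entries_append[of C b xs u ys] by simp
qed

definition cut_edges :: "('a \<times> 'a) set \<Rightarrow> 'a set \<Rightarrow> nat" where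
  "cut_edges E C = card {(u, v) \<in> E. u \<notin> C \<and> v \<in> C}"

lemma connected_graph_leaves:
  assumes "connected_graph n E" "S \<subseteq> {..<n}" "x \<in> S" "S \<noteq> {..<n}"
  obtains u v where "u \<in> S" "v \<in> {..<n} - S" "(u, v) \<in> E"
proof -
  obtain y where y: "y < n" "y \<notin> S" using assms(2,4) by blast
  have "(x, y) \<in> E\<^sup>*" using assms y by (auto simp: connected_graph_def)
  from this assms(3) y(2) have "\<exists>u v. u \<in> S \<and> v \<notin> S \<and> (u, v) \<in> E"
    by (induction rule: converse_rtrancl_induct) blast+
  then show ?thesis using that assms(1) unfolding connected_graph_def by blast
qed

text \<open>
  Every connected graph has an arrangement of its vertices in which each vertex set has at most as
  many runs as it has boundary edges: insert each new vertex right behind a neighbour.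
\<close>

lemma arrangement_exists:
  assumes G: "connected_graph n E" and n: "0 < n"
  obtains xs where "distinct xs" "set xs = {..<n}"
    "\<And>C. 0 \<notin> C \<Longrightarrow> entries C False xs \<le> cut_edges E C"
proof -
  have E: "E \<subseteq> {..<n} \<times> {..<n}" "sym E" using G by (auto simp: connected_graph_def)
  have "\<exists>xs. distinct xs \<and> set xs \<subseteq> {..<n} \<and> 0 \<in> set xs \<and> length xs = Suc m \<and>
      (\<forall>C. 0 \<notin> C \<longrightarrow> entries C False xs \<le> cut_edges (E \<inter> set xs \<times> set xs) C)" if "m < n" for m
    using that
  proof (induction m)
    case 0
    \<comment> \<open>Node 0 comes first and stays first, because insertions happen behind a vertex.
      A run starting at the head would have no edge to pay for it, whence the restriction to
      \<open>0 \<notin> C\<close>.\<close>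
    then show ?case using n by (intro exI[of _ "[0]"]) auto
  next
    case (Suc m)
    then obtain xs where xs: "distinct xs" "set xs \<subseteq> {..<n}" "0 \<in> set xs" "length xs = Suc m"
      "\<And>C. 0 \<notin> C \<Longrightarrow> entries C False xs \<le> cut_edges (E \<inter> set xs \<times> set xs) C"
      by auto
    have "card (set xs) = Suc m" using xs(1,4) by (simp add: distinct_card)
    with Suc.prems have "set xs \<noteq> {..<n}" by (metis card_lessThan less_irrefl)
    then obtain u v where uv: "u \<in> set xs" "v \<in> {..<n} - set xs" "(u, v) \<in> E"
      using connected_graph_leaves[OF G xs(2,3)] by blast
    obtain ys zs where split: "xs = ys @ u # zs" using split_list[OF uv(1)] by blast
    let ?xs = "ys @ u # v # zs"
    have set: "set ?xs = insert v (set xs)" by (auto simp: split)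
    have "entries C False ?xs \<le> cut_edges (E \<inter> set ?xs \<times> set ?xs) C" if "0 \<notin> C" for C
    proof -
      \<comment> \<open>\<open>?A\<close> are the old boundary edges, \<open>?N\<close> is the
        attaching edge in the orientation, if any, that enters \<open>C\<close>. They are disjoint
        because \<open>v\<close> is new.\<close>
      let ?A = "{(a, b) \<in> E \<inter> set xs \<times> set xs. a \<notin> C \<and> b \<in> C}"
      let ?B = "{(a, b) \<in> E \<inter> set ?xs \<times> set ?xs. a \<notin> C \<and> b \<in> C}"
      let ?N = "{(a, b). (a = u \<and> b = v \<or> a = v \<and> b = u) \<and> a \<notin> C \<and> b \<in> C}"
      have N: "?N = (if u \<notin> C \<and> v \<in> C then {(u, v)} else if u \<in> C \<and> v \<notin> C then {(v, u)} else {})"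
        by auto
      have "(v, u) \<in> E" using uv(3) E(2) by (rule symD[rotated])
      then have sub: "?A \<union> ?N \<subseteq> ?B" unfolding set using uv by blast
      have fin: "finite ?B" by (rule finite_subset[of _ "set ?xs \<times> set ?xs"]) auto
      have disj: "?A \<inter> ?N = {}" using uv by auto
      have "entries C False ?xs \<le> entries C False xs + of_bool (u \<in> C \<longleftrightarrow> v \<notin> C)"
        unfolding split by (rule entries_insert_after)
      also have "\<dots> \<le> card ?A + card ?N"
        using xs(5)[OF that] unfolding N by (auto simp: cut_edges_def)
      also have "\<dots> = card (?A \<union> ?N)"
        using fin sub disj by (intro card_Un_disjoint[symmetric]) (auto intro: finite_subset)
      also have "\<dots> \<le> card ?B" using sub fin by (rule card_mono[rotated])
      finally show ?thesis by (simp add: cut_edges_def)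
    qed
    moreover have "distinct ?xs" "length ?xs = Suc (Suc m)" "set ?xs \<subseteq> {..<n}" "0 \<in> set ?xs"
      using xs uv by (auto simp: split)
    ultimately show ?case by blast
  qed
  from this[of "n - 1"] n obtain xs where xs: "distinct xs" "set xs \<subseteq> {..<n}" "length xs = n"
    "\<And>C. 0 \<notin> C \<Longrightarrow> entries C False xs \<le> cut_edges (E \<inter> set xs \<times> set xs) C"
    by auto
  moreover have "set xs = {..<n}"
    using xs by (intro card_subset_eq) (auto simp: distinct_card)
  moreover have "E \<inter> {..<n} \<times> {..<n} = E" using E by blast
  ultimately show ?thesis by (intro that) auto
qed

text \<open>A list shorter than \<open>q\<close> contains no window, so that nothing is required of
  it.\<close>

definition hit_windows :: "nat \<Rightarrow> 'a set \<Rightarrow> 'a list \<Rightarrow> bool" where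
  "hit_windows q A ys \<longleftrightarrow> (\<forall>i. i + q \<le> length ys \<longrightarrow> (\<exists>j\<in>{i..<i + q}. ys ! j \<in> A))"

lemma hit_windows_drop: "hit_windows q A ys \<Longrightarrow> hit_windows q A (drop d ys)"
  unfolding hit_windows_def
proof (intro allI impI)
  fix i
  assume *: "\<forall>i. i + q \<le> length ys \<longrightarrow> (\<exists>j\<in>{i..<i + q}. ys ! j \<in> A)" and i: "i + q \<le> length (drop d ys)"
  show "\<exists>j\<in>{i..<i + q}. drop d ys ! j \<in> A"
  proof (cases "q = 0")
    case True
    then show ?thesis using *[rule_format, of 0] by simp
  next
    case False
    then have "d + i + q \<le> length ys" using i by auto
    then obtain j where "j \<in> {d + i..<d + i + q}" "ys ! j \<in> A" using * by blast
    then show ?thesis using \<open>d + i + q \<le> _\<close> by (intro bexI[of _ "j - d"]) auto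
  qed
qed

text \<open>A run of \<open>C\<close> avoids \<open>A\<close>, hence contains no window and has
  fewer than \<open>q\<close> elements; \<open>entries\<close> counts the runs.\<close>

lemma card_le_entries:
  assumes "hit_windows q A ys" "C \<inter> A = {}" "distinct ys"
  shows "card (C \<inter> set ys) \<le> q * entries C False ys"
  using assms
proof (induction "length ys" arbitrary: ys rule: less_induct)
  case less
  show ?case
  proof (cases ys)
    case (Cons y zs)
    show ?thesis
    proof (cases "y \<in> C")
      case False
      have "hit_windows q A zs" using hit_windows_drop[OF less.prems(1), of 1] Cons by simp
      then have "card (C \<inter> set zs) \<le> q * entries C False zs"
        using less Cons by simp
      then show ?thesis using False Cons by simp
    next
      case True
      \<comment> \<open>\<open>us\<close> is the first run. The rest is empty or starts outside
        \<open>C\<close>, so the number of runs drops by exactly one.\<close>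
      define us ws where "us = takeWhile (\<lambda>x. x \<in> C) ys" and "ws = dropWhile (\<lambda>x. x \<in> C) ys"
      have ys: "ys = us @ ws" by (simp add: us_def ws_def)
      have us: "set us \<subseteq> C" by (auto simp: us_def dest: set_takeWhileD)
      have us_ne: "us \<noteq> []" using True Cons by (simp add: us_def)
      have "length us < q"
      proof (rule ccontr)
        assume "\<not> length us < q"
        then obtain j where j: "j < q" "ys ! j \<in> A" "q \<le> length us"
          using less.prems(1)[unfolded hit_windows_def, rule_format, of 0] ys by auto
        then have "ys ! j \<in> C" using us ys by (simp add: nth_append subset_iff)
        then show False using j less.prems(2) by blast
      qed
      have ent: "set vs \<subseteq> C \<Longrightarrow> entries C True (vs @ ws) = entries C True ws" for vs
        by (induction vs) auto
      have "entries C True ws = entries C False ws"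
      proof (cases ws)
        case (Cons w ws')
        then have "w \<notin> C" using hd_dropWhile[of "\<lambda>x. x \<in> C" ys] by (simp add: ws_def)
        then show ?thesis using Cons by simp
      qed simp
      moreover have "entries C False ys = Suc (entries C True ws)"
        using ys us us_ne ent by (cases us) auto
      moreover have "hit_windows q A ws"
        using hit_windows_drop[OF less.prems(1), of "length us"] ys by simp
      then have "card (C \<inter> set ws) \<le> q * entries C False ws"
        using less ys us_ne by simp
      moreover have "card (C \<inter> set ys) \<le> length us + card (C \<inter> set ws)"
      proof -
        have "card (C \<inter> set ys) \<le> card (C \<inter> set us) + card (C \<inter> set ws)"
          unfolding ys by (metis Int_Un_distrib card_Un_le set_append)
        also have "card (C \<inter> set us) \<le> length us"
          by (rule order_trans[OF card_mono card_length]) auto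
        finally show ?thesis by simp
      qed
      ultimately show ?thesis using \<open>length us < q\<close> by simp
    qed
  qed simp
qed

subsection \<open>Cuts in a sequence of graphs\<close>

text \<open>
  A decreasing sequence of subsets of \<open>n\<close> nodes is constant except in \<open>n\<close> rounds, so that a cut in
  the time-expanded graph is static in most rounds.
\<close>

lemma dynamic_cut:
  fixes D :: "nat \<Rightarrow> nat set"
  assumes dec: "\<And>t. t < T \<Longrightarrow> D (Suc t) \<subseteq> D t" and D0: "D 0 \<subseteq> {..<n}"
    and Z: "Z \<subseteq> {..<T}" "n + k * q \<le> card Z"
    and good: "\<And>t. t \<in> Z \<Longrightarrow> D t = D (Suc t) \<Longrightarrow> w \<le> q * cut_edges (E t) (D (Suc t))"
    and fin: "\<And>t. t < T \<Longrightarrow> finite (E t)" and q: "0 < q"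
  shows "k * w \<le> (\<Sum>t<T. card {(u, v) \<in> E t. u \<notin> D t \<and> v \<in> D (Suc t)})"
proof -
  \<comment> \<open>The rounds in which the cut moves. Each of them removes a node, so there are at
    most \<open>n\<close>, and at least \<open>k * q\<close> good rounds with a static cut
    remain.\<close>
  define N where "N = {t. t < T \<and> D t \<noteq> D (Suc t)}"
  have sub0: "t \<le> T \<Longrightarrow> D t \<subseteq> D 0" for t
    by (induction t) (use dec in \<open>auto simp: Suc_le_eq\<close>)
  have finD: "t \<le> T \<Longrightarrow> finite (D t)" for t
    by (rule finite_subset[OF order_trans[OF sub0 D0]]) simp_all
  have "t \<le> T \<Longrightarrow> card {t'. t' < t \<and> D t' \<noteq> D (Suc t')} + card (D t) \<le> card (D 0)" for t
  proof (induction t)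
    case (Suc t)
    have *: "{t'. t' < Suc t \<and> D t' \<noteq> D (Suc t')} =
        {t'. t' < t \<and> D t' \<noteq> D (Suc t')} \<union> (if D t = D (Suc t) then {} else {t})"
      by (auto simp: less_Suc_eq)
    show ?case
    proof (cases "D t = D (Suc t)")
      case False
      then have "card (D (Suc t)) < card (D t)"
        using Suc.prems dec[of t] finD[of t] by (intro psubset_card_mono) auto
      then show ?thesis using Suc False unfolding * by simp
    qed (use Suc in \<open>simp add: *\<close>)
  qed simp
  from this[of T] have "card N \<le> card (D 0)" by (simp add: N_def)
  also have "\<dots> \<le> n" using card_mono[OF _ D0] by simp
  finally have "card N \<le> n" .
  then have "k * q \<le> card (Z - N)"
    using Z diff_card_le_card_Diff[of N Z] by (simp add: N_def)
  \<comment> \<open>A static good round contributes at least \<open>w / q\<close>. To stay within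
    the natural numbers all terms are multiplied by \<open>q\<close>, which is cancelled at the
    end.\<close>
  have "q * (k * w) \<le> card (Z - N) * w"
    using mult_right_mono[OF \<open>k * q \<le> _\<close>, of w] by (simp add: ac_simps)
  also have "\<dots> = (\<Sum>t\<in>Z - N. w)" by simp
  also have "\<dots> \<le> (\<Sum>t\<in>Z - N. q * card {(u, v) \<in> E t. u \<notin> D t \<and> v \<in> D (Suc t)})"
  proof (rule sum_mono)
    fix t assume t: "t \<in> Z - N"
    then have "D t = D (Suc t)" using Z by (auto simp: N_def)
    then show "w \<le> q * card {(u, v) \<in> E t. u \<notin> D t \<and> v \<in> D (Suc t)}"
      using good[of t] t by (simp add: cut_edges_def)
  qed
  also have "\<dots> \<le> (\<Sum>t<T. q * card {(u, v) \<in> E t. u \<notin> D t \<and> v \<in> D (Suc t)})"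
    using Z by (intro sum_mono2) auto
  finally show ?thesis using q by (simp flip: sum_distrib_left)
qed

subsection \<open>Time-expanded networks\<close>

text \<open>
  Vertex \<open>t * n + u\<close> is node \<open>u\<close> after \<open>t\<close> of \<open>T\<close> rounds, and \<open>Suc T * n\<close> is the source, which feeds
  the nodes of \<open>A\<close> at time \<open>0\<close>.
\<close>

definition expanded :: "nat \<Rightarrow> nat \<Rightarrow> nat \<Rightarrow> nat set \<Rightarrow> (nat \<Rightarrow> (nat \<times> nat) set) \<Rightarrow> nat \<Rightarrow> nat \<Rightarrow> nat" where
  "expanded n T big A G x y =
     (if x < Suc T * n then
        if y < Suc T * n \<and> y div n = Suc (x div n) then
          if x mod n = y mod n then big else of_bool ((x mod n, y mod n) \<in> G (x div n))
        else 0
      else if y < n \<and> y \<in> A then big else 0)"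

lemma index_less: "t \<le> T \<Longrightarrow> u < n \<Longrightarrow> t * n + u < Suc T * (n :: nat)"
proof -
  assume "t \<le> T" "u < n"
  then have "t * n + u < Suc t * n" by simp
  also have "\<dots> \<le> Suc T * n" using \<open>t \<le> T\<close> by (intro mult_le_mono1) simp
  finally show ?thesis .
qed

lemma mult_add_less: "a < b \<Longrightarrow> u < n \<Longrightarrow> a * n + u < b * (n :: nat)"
  using index_less[of a "b - 1" u n] by (cases b) auto

lemma card_filter_lessThan: "card {p \<in> {..<P :: nat}. Q p} \<le> P"
  by (rule order_trans[OF card_mono[of "{..<P}"]]) auto

lemma expanded_step:
  assumes "t < T" "u < n" "v < n"
  shows "expanded n T big A G (t * n + u) (Suc t * n + v) = (if u = v then big else of_bool ((u, v) \<in> G t))"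
proof -
  have "t * n + u < Suc T * n" "Suc t * n + v < Suc T * n"
    using assms index_less[of t T u n] index_less[of "Suc t" T v n] by simp_all
  moreover have "(Suc t * n + v) div n = Suc t" "(Suc t * n + v) mod n = v"
    using assms by (simp_all only: div_mult_self3 mod_mult_self3) simp_all
  ultimately show ?thesis using assms unfolding expanded_def by simp
qed

lemma expanded_source: "u < n \<Longrightarrow> expanded n T big A G (Suc T * n) u = (if u \<in> A then big else 0)"
  by (simp add: expanded_def)

lemma expanded_pos:
  assumes "0 < expanded n T big A G x y" "x \<le> Suc T * n" "0 < n"
  shows "(\<exists>t u v. t < T \<and> u < n \<and> v < n \<and> x = t * n + u \<and> y = Suc t * n + v \<and> (u = v \<or> (u, v) \<in> G t))
       \<or> (x = Suc T * n \<and> y < n \<and> y \<in> A)"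
proof (cases "x < Suc T * n")
  case True
  let ?t = "x div n"
  have *: "y < Suc T * n" "y div n = Suc ?t" "x mod n = y mod n \<or> (x mod n, y mod n) \<in> G ?t"
    using assms(1) True by (auto simp: expanded_def split: if_splits)
  have "Suc ?t < Suc T" using *(1,2) assms(3) less_mult_imp_div_less by metis
  moreover have "x = ?t * n + x mod n" by simp
  moreover have "y = Suc ?t * n + y mod n" by (metis *(2) div_mult_mod_eq)
  ultimately show ?thesis using *(3) assms(3) by (metis Suc_less_eq mod_less_divisor)
next
  case False
  then show ?thesis using assms by (auto simp: expanded_def split: if_splits)
qed

text \<open>A cut that separates a node from its own past, or the source from a node it feeds,
  contains an arc of capacity \<open>big\<close> and is large enough. Otherwise the layers of the
  cut decrease with time and avoid \<open>A\<close>, and the graph edges crossing it are those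
  counted in \<open>cut\<close>. So only decreasing sequences of node sets have to be
  examined.\<close>

lemma expanded_cut_condition:
  assumes n: "0 < n" and P: "P \<le> big"
    and dest: "\<And>p. p < P \<Longrightarrow> dest p = T * n + dn p" "\<And>p. p < P \<Longrightarrow> dn p < n"
    and fin: "\<And>t. t < T \<Longrightarrow> G t \<subseteq> {..<n} \<times> {..<n}"
    and cut: "\<And>D. (\<And>t. t < T \<Longrightarrow> D (Suc t) \<subseteq> D t) \<Longrightarrow> D 0 \<subseteq> {..<n} \<Longrightarrow> D 0 \<inter> A = {} \<Longrightarrow>
      card {p \<in> {..<P}. dn p \<in> D T} \<le> (\<Sum>t<T. card {(u, v) \<in> G t. u \<notin> D t \<and> v \<in> D (Suc t)})"
  shows "cut_condition (Suc (Suc T * n)) (expanded n T big A G) dest {..<P} (Suc T * n)"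
  unfolding cut_condition_def
proof (intro allI impI)
  fix C assume C: "C \<subseteq> {..<Suc (Suc T * n)}" "Suc T * n \<notin> C"
  let ?s = "Suc T * n" and ?c = "expanded n T big A G"
  let ?X = "{..<Suc ?s} - C"
  have fC: "finite C" using C finite_subset by blast
  define D where "D t = {u. u < n \<and> t * n + u \<in> C}" for t
  have demand: "{p \<in> {..<P}. dest p \<in> C} = {p \<in> {..<P}. dn p \<in> D T}"
    using dest by (auto simp: D_def)
  have single: "?c x y \<le> (\<Sum>y\<in>C. \<Sum>x\<in>?X. ?c x y)" if "x \<in> ?X" "y \<in> C" for x y
  proof -
    have "?c x y \<le> (\<Sum>x\<in>?X. ?c x y)" using that(1) by (intro member_le_sum) auto
    also have "\<dots> \<le> (\<Sum>y\<in>C. \<Sum>x\<in>?X. ?c x y)"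
      by (rule member_le_sum[where f = "\<lambda>y. \<Sum>x\<in>?X. ?c x y"]) (use that(2) fC in auto)
    finally show ?thesis .
  qed
  have big: "card {p \<in> {..<P}. dn p \<in> D T} \<le> big"
    using card_filter_lessThan P by (rule order_trans)
  consider (storage) t u where "t < T" "u < n" "Suc t * n + u \<in> C" "t * n + u \<notin> C"
    | (source) u where "u < n" "u \<in> A" "u \<in> C"
    | (neither) "\<And>t. t < T \<Longrightarrow> D (Suc t) \<subseteq> D t" "D 0 \<inter> A = {}"
    unfolding D_def by fastforce
  then show "card {p \<in> {..<P}. dest p \<in> C} \<le> (\<Sum>y\<in>C. \<Sum>x\<in>?X. ?c x y)"
  proof cases
    case storage
    have "t * n + u \<in> ?X" using storage index_less[of t T u n] by simp
    from single[OF this storage(3)] show ?thesis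
      using big storage unfolding demand expanded_step[OF storage(1,2,2)] by simp
  next
    case source
    have "?s \<in> ?X" using C by simp
    from single[OF this source(3)] show ?thesis
      using big source unfolding demand expanded_source[OF source(1)] by simp
  next
    case neither
    let ?E = "\<lambda>t. {(u, v) \<in> G t. u \<notin> D t \<and> v \<in> D (Suc t)}"
    \<comment> \<open>Crossing edges of the single rounds correspond to distinct arcs of the
      network, each of capacity 1, so their number is at most the capacity of the cut.\<close>
    let ?f = "\<lambda>(t, u, v). (Suc t * n + v, t * n + u)"
    let ?S = "SIGMA t:{..<T}. ?E t"
    have E: "u < n \<and> v < n \<and> u \<noteq> v \<and> t * n + u \<in> ?X \<and> Suc t * n + v \<in> C \<and> ?c (t * n + u) (Suc t * n + v) = 1"
      if "(t, u, v) \<in> ?S" for t u v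
    proof -
      have uv: "t < T" "(u, v) \<in> G t" "u \<notin> D t" "v \<in> D (Suc t)" using that by auto
      then have un: "u < n" "v < n" using fin[of t] by auto
      moreover have "u \<noteq> v" using uv neither(1)[of t] by auto
      moreover have "t * n + u \<in> ?X" using uv un index_less[of t T u n] by (simp add: D_def)
      moreover have "Suc t * n + v \<in> C" using uv by (simp add: D_def)
      ultimately show ?thesis using uv(1,2) by (simp add: expanded_step del: mult_Suc)
    qed
    have inj: "inj_on ?f ?S"
    proof (rule inj_onI)
      fix a b assume ab: "a \<in> ?S" "b \<in> ?S" "?f a = ?f b"
      obtain t u v t' u' v' where eq: "a = (t, u, v)" "b = (t', u', v')" by (metis prod_cases3)
      have lt: "u < n" "v < n" "u' < n" "v' < n" using E ab unfolding eq by blast+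
      have eqs: "t * n + u = t' * n + u'" "Suc t * n + v = Suc t' * n + v'" using ab(3) by (simp_all add: eq)
      have "t = (t * n + u) div n" "t' = (t' * n + u') div n" using lt by simp_all
      with eqs(1) have "t = t'" by metis
      with eqs show "a = b" by (simp add: eq)
    qed
    have "card {p \<in> {..<P}. dest p \<in> C} \<le> (\<Sum>t<T. card (?E t))"
      unfolding demand by (rule cut) (use neither in \<open>auto simp: D_def\<close>)
    also have "\<dots> = card ?S"
    proof (rule card_SigmaI[symmetric])
      show "\<forall>t\<in>{..<T}. finite (?E t)"
        using fin by (intro ballI finite_subset[of "?E _" "{..<n} \<times> {..<n}"]) auto
    qed simp
    also have "\<dots> = card (?f ` ?S)" by (rule card_image[symmetric, OF inj])
    also have "\<dots> = (\<Sum>z\<in>?f ` ?S. 1)" by simp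
    also have "\<dots> = (\<Sum>(y, x)\<in>?f ` ?S. ?c x y)"
      by (rule sum.cong) (use E in auto)
    also have "\<dots> \<le> (\<Sum>(y, x)\<in>C \<times> ?X. ?c x y)"
      by (rule sum_mono2) (use fC E in auto)
    also have "\<dots> = (\<Sum>y\<in>C. \<Sum>x\<in>?X. ?c x y)" by (rule sum.cartesian_product[symmetric])
    finally show ?thesis .
  qed
qed

text \<open>Each member of \<open>X\<close> inside the cut wants \<open>k\<close> tokens. If a
  boundary edge has to answer for at most \<open>q\<close> members, then \<open>k * q\<close> rounds
  with a static cut carry enough.\<close>

definition good_round :: "nat \<Rightarrow> nat set \<Rightarrow> nat set \<Rightarrow> (nat \<times> nat) set \<Rightarrow> bool" where
  "good_round q A X E \<longleftrightarrow> (\<forall>C. C \<inter> A = {} \<longrightarrow> card (C \<inter> X) \<le> q * cut_edges E C)"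

lemma good_roundI:
  assumes xs: "distinct xs" "set xs = {..<n}" "\<And>C. 0 \<notin> C \<Longrightarrow> entries C False xs \<le> cut_edges E C"
    and X: "X \<subseteq> {..<n}" "0 \<in> A" and hit: "hit_windows q A (filter (\<lambda>v. v \<in> X) xs)"
  shows "good_round q A X E"
  unfolding good_round_def
proof (intro allI impI)
  fix C assume C: "C \<inter> A = {}"
  have "C \<inter> X = C \<inter> set (filter (\<lambda>v. v \<in> X) xs)" using X xs by auto
  then have "card (C \<inter> X) \<le> q * entries C False (filter (\<lambda>v. v \<in> X) xs)"
    using card_le_entries[OF hit C] xs(1) by simp
  also have "\<dots> \<le> q * entries C False xs" by (simp add: entries_filter)
  also have "\<dots> \<le> q * cut_edges E C" using C X(2) by (intro mult_le_mono2 xs(3)) blast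
  finally show "card (C \<inter> X) \<le> q * cut_edges E C" .
qed

text \<open>Covers phase 1 in the likely event that only node 0 survives to level 1.\<close>

lemma good_round_subset:
  assumes X: "X \<subseteq> A"
  shows "good_round q A X E"
  unfolding good_round_def
proof (intro allI impI)
  fix C assume "C \<inter> A = {}"
  then have "C \<inter> X = {}" using X by blast
  then show "card (C \<inter> X) \<le> q * cut_edges E C" by simp
qed

lemma cut_edges_pos:
  assumes G: "connected_graph n E" and C: "C \<subseteq> {..<n}" "C \<noteq> {}" "0 \<notin> C" "0 < n"
  shows "0 < cut_edges E C"
proof -
  obtain u v where uv: "u \<in> {..<n} - C" "v \<in> {..<n} - ({..<n} - C)" "(u, v) \<in> E"
    by (rule connected_graph_leaves[OF G, of "{..<n} - C" 0]) (use C in auto)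
  have "finite E" using G finite_subset by (fastforce simp: connected_graph_def)
  then show ?thesis using uv unfolding cut_edges_def
    by (subst card_gt_0_iff) (auto intro: finite_subset[of _ E])
qed

lemma decreasing_below:
  fixes D :: "nat \<Rightarrow> 'a set"
  assumes "\<And>t. t < T \<Longrightarrow> D (Suc t) \<subseteq> D t" "t \<le> t'" "t' \<le> T"
  shows "D t' \<subseteq> D t"
  using assms(2,3)
proof (induction t' rule: dec_induct)
  case (step m)
  have "D (Suc m) \<subseteq> D m" using step.prems by (intro assms(1)) simp
  also have "D m \<subseteq> D t" using step by simp
  finally show ?case .
qed simp

text \<open>By connectivity every round carries at least one unit into a nonempty set without node
  0, and there are only \<open>k\<close> packets. Gathering thus involves neither randomness nor a
  logarithm.\<close>

lemma gather_cut_condition: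
  assumes n: "0 < n" and T: "n + k \<le> T" and big: "k \<le> big"
    and G: "\<And>t. t < T \<Longrightarrow> connected_graph n (G t)"
    and dest: "\<And>p. p < k \<Longrightarrow> dest p = T * n + dn p" "\<And>p. p < k \<Longrightarrow> dn p < n"
  shows "cut_condition (Suc (Suc T * n)) (expanded n T big {0} G) dest {..<k} (Suc T * n)"
proof (rule expanded_cut_condition[OF n big dest])
  show sub: "G t \<subseteq> {..<n} \<times> {..<n}" if "t < T" for t
    using G[OF that] by (simp add: connected_graph_def)
  fix D :: "nat \<Rightarrow> nat set"
  assume D: "\<And>t. t < T \<Longrightarrow> D (Suc t) \<subseteq> D t" "D 0 \<subseteq> {..<n}" "D 0 \<inter> {0} = {}"
  note dec = decreasing_below[of T D, OF D(1)]
  \<comment> \<open>The weight is 1 if any node is cut off at time \<open>T\<close>, and 0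
    otherwise, when there is no demand either.\<close>
  have "k * (if D T = {} then 0 else 1) \<le> (\<Sum>t<T. card {(u, v) \<in> G t. u \<notin> D t \<and> v \<in> D (Suc t)})"
  proof (rule dynamic_cut[OF D(1,2), where Z = "{..<T}" and q = 1])
    show "finite (G t)" if "t < T" for t
      by (rule finite_subset[OF sub[OF that]]) simp
    show "(if D T = {} then 0 else 1) \<le> 1 * cut_edges (G t) (D (Suc t))" if "t \<in> {..<T}" for t
    proof (cases "D T = {}")
      case False
      have "D T \<subseteq> D (Suc t)" "D (Suc t) \<subseteq> D 0" using dec[of "Suc t" T] dec[of 0 "Suc t"] that by auto
      then have "0 < cut_edges (G t) (D (Suc t))"
        using that False D n by (intro cut_edges_pos[OF G]) auto
      then show ?thesis by simp
    qed simp
  qed (use T in auto)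
  moreover have "card {p \<in> {..<k}. dn p \<in> D T} \<le> k"
    by (rule card_filter_lessThan)
  ultimately show "card {p \<in> {..<k}. dn p \<in> D T} \<le> (\<Sum>t<T. card {(u, v) \<in> G t. u \<notin> D t \<and> v \<in> D (Suc t)})"
    by (cases "D T = {}") simp_all
qed

text \<open>Packet \<open>v * k + i\<close> is meant for node \<open>v\<close>. If \<open>v\<close>
  is not in \<open>X\<close>, the packet goes to node 0, which is a source and keeps it over storage
  arcs; since \<open>0 \<in> A\<close>, such packets never count against a cut. This makes the
  number of packets the same in all spreading phases.\<close>

lemma spread_cut_condition:
  assumes n: "0 < n" and q: "0 < q" and X: "X \<subseteq> {..<n}" and A: "0 \<in> A"
    and G: "\<And>t. t < T \<Longrightarrow> connected_graph n (G t)"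
    and Z: "n + k * q \<le> card {t. t < T \<and> good_round q A X (G t)}"
    and dest: "\<And>p. p < n * k \<Longrightarrow> dest p = T * n + (if p div k \<in> X then p div k else 0)"
  shows "cut_condition (Suc (Suc T * n)) (expanded n T (n * k) A G) dest {..<n * k} (Suc T * n)"
proof (rule expanded_cut_condition[OF n order_refl dest])
  show sub: "G t \<subseteq> {..<n} \<times> {..<n}" if "t < T" for t
    using G[OF that] by (simp add: connected_graph_def)
  let ?dn = "\<lambda>p. if p div k \<in> X then p div k else 0"
  show "?dn p < n" for p
    using X n by auto
  fix D :: "nat \<Rightarrow> nat set"
  assume D: "\<And>t. t < T \<Longrightarrow> D (Suc t) \<subseteq> D t" "D 0 \<subseteq> {..<n}" "D 0 \<inter> A = {}"
  note dec = decreasing_below[of T D, OF D(1)]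
  have fin: "finite (D T)"
    by (rule finite_subset[OF order_trans[OF dec D(2)]]) simp_all
  have "k * card (D T \<inter> X) \<le> (\<Sum>t<T. card {(u, v) \<in> G t. u \<notin> D t \<and> v \<in> D (Suc t)})"
  proof (rule dynamic_cut[OF D(1,2) _ Z])
    show "finite (G t)" if "t < T" for t
      by (rule finite_subset[OF sub[OF that]]) simp
    show "card (D T \<inter> X) \<le> q * cut_edges (G t) (D (Suc t))"
      if "t \<in> {t. t < T \<and> good_round q A X (G t)}" for t
    proof -
      \<comment> \<open>The nodes cut off at the end are cut off in every round, so the demand is
        bounded by the members of \<open>X\<close> in any of the cuts.\<close>
      have "D T \<subseteq> D (Suc t)" "D (Suc t) \<subseteq> D 0" using dec[of "Suc t" T] dec[of 0 "Suc t"] that by auto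
      then have "card (D T \<inter> X) \<le> card (D (Suc t) \<inter> X)"
        using X by (intro card_mono finite_subset[OF _ finite_lessThan[of n]]) auto
      also have "\<dots> \<le> q * cut_edges (G t) (D (Suc t))"
        using that D(3) \<open>D (Suc t) \<subseteq> D 0\<close> unfolding good_round_def by blast
      finally show ?thesis .
    qed
  qed (use q in auto)
  moreover have "card {p \<in> {..<n * k}. ?dn p \<in> D T} \<le> k * card (D T \<inter> X)"
  proof -
    have "0 \<notin> D T" using A D(3) dec[of 0 T] by auto
    have "{p \<in> {..<n * k}. ?dn p \<in> D T} \<subseteq> (\<lambda>(v, i). v * k + i) ` ((D T \<inter> X) \<times> {..<k})"
    proof
      fix p assume p: "p \<in> {p \<in> {..<n * k}. ?dn p \<in> D T}"
      then have "p div k \<in> D T \<inter> X" using \<open>0 \<notin> D T\<close> by (auto split: if_splits)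
      moreover have "p mod k < k" using p by (cases k) auto
      ultimately show "p \<in> (\<lambda>(v, i). v * k + i) ` ((D T \<inter> X) \<times> {..<k})"
        by (intro image_eqI[of _ _ "(p div k, p mod k)"]) auto
    qed
    then have "card {p \<in> {..<n * k}. ?dn p \<in> D T} \<le> card ((D T \<inter> X) \<times> {..<k})"
      using fin by (intro surj_card_le) auto
    then show ?thesis by (simp add: card_cartesian_product mult.commute)
  qed
  ultimately show "card {p \<in> {..<n * k}. ?dn p \<in> D T}
      \<le> (\<Sum>t<T. card {(u, v) \<in> G t. u \<notin> D t \<and> v \<in> D (Suc t)})"
    by linarith
qed

subsection \<open>Schedules from routed phases\<close>

definition log_ceil :: "nat \<Rightarrow> nat" where
  "log_ceil n = (LEAST l. n \<le> 2 ^ l)"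

lemma log_ceil: "n \<le> 2 ^ log_ceil n"
  unfolding log_ceil_def by (rule LeastI[of _ n]) simp

lemma log_ceil_least: "l < log_ceil n \<Longrightarrow> 2 ^ l < n"
  unfolding log_ceil_def using not_less_Least by fastforce

text \<open>
  Phase \<open>0\<close> gathers all tokens at node \<open>0\<close>.  In phase \<open>ph > 0\<close> the tokens spread from the nodes of
  level \<open>ph - 1\<close>, which know all of them, to those of level \<open>ph\<close>.
\<close>

locale gossip_locale =
  fixes I :: gossip
  assumes gossip: "gossip_instance I"
begin

abbreviation n where "n \<equiv> nodes I"
abbreviation k where "k \<equiv> tokens I"

text \<open>The constants come from the failure probability. A window of \<open>width\<close>
  members is missed with probability \<open>2^-width\<close>, at most \<open>n^-8 / 2\<close>, which
  outweighs the numbers of windows and phases. A given node other than 0 survives to level 1 with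
  probability \<open>2^-(last_phase - 1)\<close>, at most \<open>2 * n^-4\<close>. A phase has twice
  the \<open>n + k * width\<close> good rounds that it needs, because Markov's inequality is applied
  to the event that half of the rounds are bad.\<close>

definition width where "width = 8 * log_ceil n + 1"
definition last_phase where "last_phase = 4 * log_ceil n"
definition duration where "duration = 2 * n + 2 * k * width"
definition total where "total = Suc last_phase * duration"

text \<open>Rounds are counted from \<open>0\<close> here.  Phase \<open>0\<close> runs backwards in time.\<close>

definition round_of :: "nat \<Rightarrow> nat \<Rightarrow> nat" where
  "round_of ph t = (if ph = 0 then duration - 1 - t else ph * duration + t)"

definition phase_graph :: "nat \<Rightarrow> nat \<Rightarrow> (nat \<times> nat) set" where
  "phase_graph ph t = graph I (Suc (round_of ph t))"

text \<open>A packet that moves from \<open>u\<close> to \<open>v\<close> in the reversed time of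
  phase 0 is a token sent from \<open>v\<close> to \<open>u\<close>, hence the exchanged
  roles.\<close>

definition cell :: "nat \<Rightarrow> nat \<Rightarrow> nat \<Rightarrow> nat \<Rightarrow> nat" where
  "cell ph t u v = (if ph = 0 then (round_of ph t * n + v) * n + u else (round_of ph t * n + u) * n + v)"

definition packets :: "nat \<Rightarrow> nat" where
  "packets ph = (if ph = 0 then k else n * k)"

text \<open>Packet \<open>p\<close> carries token \<open>p mod k\<close> along the walk \<open>\<pi> p\<close>.\<close>

definition routed :: "nat \<Rightarrow> nat set \<Rightarrow> (nat \<Rightarrow> nat) \<Rightarrow> (nat \<Rightarrow> nat) \<Rightarrow> bool" where
  "routed ph A dn y \<longleftrightarrow> (\<exists>\<pi>.
     (\<forall>p<packets ph. \<pi> p 0 \<in> A \<and> \<pi> p duration = dn p \<and>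
        (\<forall>t<duration. \<pi> p t = \<pi> p (Suc t) \<or>
           (\<pi> p t, \<pi> p (Suc t)) \<in> phase_graph ph t \<and>
           y (cell ph t (\<pi> p t) (\<pi> p (Suc t))) = Suc (p mod k))) \<and>
     (\<forall>t<duration. \<forall>u<n. \<forall>v<n. y (cell ph t u v) \<noteq> 0 \<longrightarrow>
        (\<exists>p<packets ph. \<pi> p t = u \<and> \<pi> p (Suc t) = v \<and> u \<noteq> v \<and> y (cell ph t u v) = Suc (p mod k))))"

lemma n_pos: "0 < n"
  using gossip by (simp add: gossip_instance_def)

lemma duration_pos: "0 < duration"
  using n_pos by (simp add: duration_def)

lemma round_of_less: "ph \<le> last_phase \<Longrightarrow> t < duration \<Longrightarrow> round_of ph t < total"
proof -
  assume "ph \<le> last_phase" "t < duration"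
  then have "ph * duration + t < Suc ph * duration" "Suc ph * duration \<le> total"
    by (simp, unfold total_def, intro mult_le_mono1) simp
  moreover have "duration \<le> total" by (simp add: total_def)
  ultimately show ?thesis using duration_pos by (auto simp: round_of_def)
qed

lemma graph_connected: "total \<le> n * k \<Longrightarrow> r < total \<Longrightarrow> connected_graph n (graph I (Suc r))"
  using gossip by (simp add: gossip_instance_def rounds_def)

lemma phase_graph_connected:
  "total \<le> n * k \<Longrightarrow> ph \<le> last_phase \<Longrightarrow> t < duration \<Longrightarrow> connected_graph n (phase_graph ph t)"
  unfolding phase_graph_def by (intro graph_connected round_of_less)

lemma held_mono: "t \<le> t' \<Longrightarrow> held I S t u \<subseteq> held I S t' u"
  by (induction t' rule: dec_induct) auto

lemma held_subset_tokens:
  assumes "valid_schedule I S"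
  shows "held I S t u \<subseteq> {..<k}"
proof (induction t arbitrary: u)
  case 0
  then show ?case using gossip by (auto simp: gossip_instance_def)
next
  case (Suc t)
  have "i < k" if "S (Suc t) v u = Some i" for v i
    using assms that Suc.IH[of v] by (fastforce simp: valid_schedule_def)
  then show ?case using Suc.IH[of u] by auto
qed

lemma schedule_length_le:
  assumes "\<And>t u v. t \<in> rounds I \<Longrightarrow> S t u v \<noteq> None \<Longrightarrow> t \<le> b"
  shows "schedule_length I S \<le> b"
  unfolding schedule_length_def using assms by (subst Max_le_iff) (auto simp: rounds_def)

lemma decode_Some:
  assumes "decode I y t u v = Some i"
  shows "t \<in> rounds I" "u < n" "v < n" "y (((t - 1) * n + u) * n + v) = Suc i"
  using assms by (auto simp: decode_def split: if_splits nat.splits)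

lemma decode_eq:
  assumes "r < n * k" "u < n" "v < n" "y ((r * n + u) * n + v) = Suc i"
  shows "decode I y (Suc r) u v = Some i"
  using assms by (simp add: decode_def rounds_def)

text \<open>Both halves of \<open>routed\<close> are essential. The walks show where tokens arrive;
  conversely every nonzero cell lies on a walk, whose packet is at the sender at that moment, and
  this gives validity. The sets \<open>B\<close> chain the phases: the nodes that know everything
  after one phase are the sources of the next.\<close>

theorem routed_schedule:
  fixes dn :: "nat \<Rightarrow> nat \<Rightarrow> nat"
  assumes routed: "\<And>ph. ph \<le> last_phase \<Longrightarrow> routed ph (B (ph - 1)) (dn ph) y"
    and B: "B 0 = {0}" "B last_phase = {..<n}" "\<And>ph. B ph \<subseteq> {..<n}"
    and dn0: "\<And>i. i < k \<Longrightarrow> (dn 0 i, i) \<in> init I"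
    and dn: "\<And>ph u i. ph \<noteq> 0 \<Longrightarrow> u \<in> B ph \<Longrightarrow> i < k \<Longrightarrow> dn ph (u * k + i) = u"
    and tot: "total \<le> n * k"
    and rest: "\<And>r u v. total \<le> r \<Longrightarrow> r < n * k \<Longrightarrow> u < n \<Longrightarrow> v < n \<Longrightarrow> y ((r * n + u) * n + v) = 0"
  shows "valid_schedule I (decode I y) \<and> disseminates I (decode I y) \<and> schedule_length I (decode I y) \<le> total"
proof -
  define S where "S = decode I y"
  let ?T = duration
  define R where "R ph \<pi> \<longleftrightarrow>
     (\<forall>p<packets ph. \<pi> p 0 \<in> B (ph - 1) \<and> \<pi> p duration = dn ph p \<and>
        (\<forall>t<duration. \<pi> p t = \<pi> p (Suc t) \<or>
           (\<pi> p t, \<pi> p (Suc t)) \<in> phase_graph ph t \<and>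
           y (cell ph t (\<pi> p t) (\<pi> p (Suc t))) = Suc (p mod k))) \<and>
     (\<forall>t<duration. \<forall>u<n. \<forall>v<n. y (cell ph t u v) \<noteq> 0 \<longrightarrow>
        (\<exists>p<packets ph. \<pi> p t = u \<and> \<pi> p (Suc t) = v \<and> u \<noteq> v \<and> y (cell ph t u v) = Suc (p mod k)))"
    for ph and \<pi> :: "nat \<Rightarrow> nat \<Rightarrow> nat"
  have "\<forall>ph. \<exists>\<pi>. ph \<le> last_phase \<longrightarrow> R ph \<pi>"
    using routed unfolding routed_def R_def by blast
  then obtain \<pi> where R: "\<forall>ph. ph \<le> last_phase \<longrightarrow> R ph (\<pi> ph)"
    by (rule choice[THEN exE])
  then have \<pi>:
     "\<And>ph p. ph \<le> last_phase \<Longrightarrow> p < packets ph \<Longrightarrow> \<pi> ph p 0 \<in> B (ph - 1) \<and> \<pi> ph p ?T = dn ph p"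
     "\<And>ph p t. ph \<le> last_phase \<Longrightarrow> p < packets ph \<Longrightarrow> t < ?T \<Longrightarrow> \<pi> ph p t = \<pi> ph p (Suc t) \<or>
           (\<pi> ph p t, \<pi> ph p (Suc t)) \<in> phase_graph ph t \<and>
           y (cell ph t (\<pi> ph p t) (\<pi> ph p (Suc t))) = Suc (p mod k)"
     "\<And>ph t u v. ph \<le> last_phase \<Longrightarrow> t < ?T \<Longrightarrow> u < n \<Longrightarrow> v < n \<Longrightarrow> y (cell ph t u v) \<noteq> 0 \<Longrightarrow>
        (\<exists>p<packets ph. \<pi> ph p t = u \<and> \<pi> ph p (Suc t) = v \<and> u \<noteq> v \<and> y (cell ph t u v) = Suc (p mod k))"
    unfolding R_def by blast+
  have graph: "u < n \<and> v < n \<and> (v, u) \<in> phase_graph ph t"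
    if "ph \<le> last_phase" "t < ?T" "(u, v) \<in> phase_graph ph t" for ph t u v
    using phase_graph_connected[OF tot that(1,2)] that(3) unfolding connected_graph_def
    by (auto dest: symD)
  have sent: "i \<in> held I S (Suc r) v" if "r < total" "(u, v) \<in> graph I (Suc r)" "u < n" "v < n"
    "y ((r * n + u) * n + v) = Suc i" for r u v i
    using decode_eq[of r u v y i] that tot by (auto simp: S_def)

  \<comment> \<open>Network time \<open>t\<close> is real time \<open>?T - t\<close>. The walk is
    followed from its end, an initial holder of the token, back to its start at node 0.\<close>
  have gather: "p \<in> held I S (?T - t) (\<pi> 0 p t)" if "t \<le> ?T" "p < k" for t p
    using that(1)
  proof (induction t rule: inc_induct)
    case base
    then show ?case using \<pi>(1)[of 0 p] dn0[of p] that(2) by (simp add: packets_def)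
  next
    case (step t)
    have T: "?T - t = Suc (?T - Suc t)" "round_of 0 t = ?T - Suc t"
      using step by (simp_all add: round_of_def)
    show ?case
    proof (cases "\<pi> 0 p t = \<pi> 0 p (Suc t)")
      case True
      have "?T - Suc t \<le> ?T - t" by simp
      then show ?thesis using step.IH True by (metis held_mono subsetD)
    next
      case False
      have m: "(\<pi> 0 p t, \<pi> 0 p (Suc t)) \<in> phase_graph 0 t" "y (cell 0 t (\<pi> 0 p t) (\<pi> 0 p (Suc t))) = Suc p"
        using False \<pi>(2)[of 0 p t] that(2) step by (simp_all add: packets_def)
      note g = graph[OF _ _ m(1)]
      show ?thesis
        unfolding T(1) using g m(2) step round_of_less[of 0 t] T(2)
        by (intro sent[of _ "\<pi> 0 p (Suc t)"]) (simp_all add: phase_graph_def cell_def)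
    qed
  qed

  \<comment> \<open>The flow decides in which source the walk starts. Every source knows all tokens,
    so token \<open>p mod k\<close> is available there.\<close>
  have spread: "p mod k \<in> held I S (ph * ?T + t) (\<pi> ph p t)"
    if know: "\<And>u. u \<in> B (ph - 1) \<Longrightarrow> {..<k} \<subseteq> held I S (ph * ?T) u"
      and ph: "ph \<noteq> 0" "ph \<le> last_phase" and p: "p < packets ph" and t: "t \<le> ?T" for ph p t
    using t
  proof (induction t)
    case 0
    have "0 < k" using p by (simp add: packets_def split: if_splits) (metis gr0I less_nat_zero_code mult_0_right)
    then show ?case using \<pi>(1)[OF ph(2) p] know[of "\<pi> ph p 0"] by (simp add: subset_iff)
  next
    case (Suc t)
    have r: "round_of ph t = ph * ?T + t" using ph by (simp add: round_of_def)
    show ?case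
    proof (cases "\<pi> ph p t = \<pi> ph p (Suc t)")
      case True
      have "ph * ?T + t \<le> ph * ?T + Suc t" "t \<le> ?T" using Suc.prems by simp_all
      then show ?thesis using Suc.IH True by (metis held_mono subsetD)
    next
      case False
      have m: "(\<pi> ph p t, \<pi> ph p (Suc t)) \<in> phase_graph ph t"
        "y (cell ph t (\<pi> ph p t) (\<pi> ph p (Suc t))) = Suc (p mod k)"
        using False \<pi>(2)[OF ph(2) p, of t] Suc.prems by simp_all
      have "p mod k \<in> held I S (Suc (ph * ?T + t)) (\<pi> ph p (Suc t))"
        using graph[OF ph(2) _ m(1)] m Suc.prems round_of_less[OF ph(2), of t] ph(1) r
        by (intro sent[of _ "\<pi> ph p t"]) (simp_all add: phase_graph_def cell_def)
      then show ?thesis by simp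
    qed
  qed

  have know: "ph \<le> last_phase \<Longrightarrow> u \<in> B ph \<Longrightarrow> {..<k} \<subseteq> held I S (Suc ph * ?T) u" for ph u
  proof (induction ph arbitrary: u)
    case 0
    have "i \<in> held I S ?T 0" if "i < k" for i
      using gather[of 0 i] \<pi>(1)[of 0 i] that B(1) by (simp add: packets_def)
    then show ?case using 0 B(1) by auto
  next
    case (Suc ph)
    show ?case
    proof
      fix i assume "i \<in> {..<k}"
      then have i: "i < k" by simp
      have u: "u < n" using Suc.prems B(3) by auto
      have p: "u * k + i < packets (Suc ph)"
      proof -
        have "u * k + i < Suc u * k" using i by simp
        also have "\<dots> \<le> n * k" using u by (intro mult_le_mono1) simp
        finally show ?thesis by (simp add: packets_def)
      qed
      have "(u * k + i) mod k \<in> held I S (Suc ph * ?T + ?T) (\<pi> (Suc ph) (u * k + i) ?T)"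
        using Suc by (intro spread p) auto
      then show "i \<in> held I S (Suc (Suc ph) * ?T) u"
        using \<pi>(1)[OF _ p] dn[of "Suc ph" u i] Suc.prems i by (simp add: add.commute)
    qed
  qed

  have sends: "i \<in> held I S r u \<and> (u, v) \<in> graph I (Suc r) \<and> r < total"
    if ruv: "r < n * k" "u < n" "v < n" "y ((r * n + u) * n + v) = Suc i" for r u v i
  proof -
    have r: "r < total" using rest ruv by (metis not_less old.nat.distinct(1))
    have k: "0 < k" using ruv by (cases k) auto
    show ?thesis
    proof (cases "r < ?T")
      case True
      let ?t = "?T - 1 - r"
      have t: "?t < ?T" "round_of 0 ?t = r" using True by (auto simp: round_of_def)
      have c: "cell 0 ?t v u = (r * n + u) * n + v" using t by (simp add: cell_def)
      from \<pi>(3)[of 0 ?t v u] t ruv c obtain p where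
        p: "p < k" "\<pi> 0 p ?t = v" "\<pi> 0 p (Suc ?t) = u" "u \<noteq> v" "i = p"
        by (auto simp: packets_def)
      have "(v, u) \<in> phase_graph 0 ?t" using \<pi>(2)[of 0 p ?t] p t by (auto simp: packets_def)
      from graph[OF _ t(1) this] have "(u, v) \<in> graph I (Suc r)" using t by (simp add: phase_graph_def)
      moreover have "p \<in> held I S (?T - Suc ?t) (\<pi> 0 p (Suc ?t))" using p t by (intro gather) auto
      ultimately show ?thesis using p True r by simp
    next
      case False
      let ?ph = "r div ?T" and ?t = "r mod ?T"
      have ph: "?ph \<noteq> 0" "?ph \<le> last_phase" "?t < ?T"
        using False r duration_pos less_mult_imp_div_less[of r "Suc last_phase" ?T]
        by (auto simp: total_def div_eq_0_iff)
      have t: "round_of ?ph ?t = r" using ph by (simp add: round_of_def)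
      have c: "cell ?ph ?t u v = (r * n + u) * n + v" using t ph by (simp add: cell_def)
      from \<pi>(3)[of ?ph ?t u v] ph ruv c obtain p where
        p: "p < packets ?ph" "\<pi> ?ph p ?t = u" "\<pi> ?ph p (Suc ?t) = v" "u \<noteq> v" "i = p mod k"
        by auto
      have "(u, v) \<in> graph I (Suc r)" using \<pi>(2)[of ?ph p ?t] p t ph by (auto simp: phase_graph_def)
      moreover have "p mod k \<in> held I S (?ph * ?T + ?t) (\<pi> ?ph p ?t)"
      proof (rule spread)
        show "{..<k} \<subseteq> held I S (?ph * ?T) w" if "w \<in> B (?ph - 1)" for w
          using know[of "?ph - 1" w] that ph by simp
      qed (use p ph in auto)
      ultimately show ?thesis using p r by simp
    qed
  qed

  have valid: "valid_schedule I S"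
    unfolding valid_schedule_def
  proof (intro allI impI)
    fix t u v i assume "S t u v = Some i"
    note d = decode_Some[OF this[unfolded S_def]]
    obtain r where r: "t = Suc r" "r < n * k" using d(1) by (cases t) (auto simp: rounds_def)
    show "t \<in> rounds I \<and> (u, v) \<in> graph I t \<and> i \<in> held I S (t - 1) u"
      using sends[OF r(2) d(2,3)] d(1,4) r(1) by simp
  qed
  have "held I S (n * k) u = {..<k}" if "u < n" for u
  proof
    show "held I S (n * k) u \<subseteq> {..<k}" by (rule held_subset_tokens[OF valid])
    have "{..<k} \<subseteq> held I S total u"
      using know[of last_phase u] that B(2) by (simp add: total_def)
    then show "{..<k} \<subseteq> held I S (n * k) u" using held_mono[OF tot] by blast
  qed
  then have "disseminates I S" by (simp add: disseminates_def)
  moreover have "schedule_length I S \<le> total"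
  proof (rule schedule_length_le)
    fix t u v assume "S t u v \<noteq> None"
    then obtain i where "S t u v = Some i" by blast
    note d = decode_Some[OF this[unfolded S_def]]
    obtain r where r: "t = Suc r" "r < n * k" using d(1) by (cases t) (auto simp: rounds_def)
    show "t \<le> total" using sends[OF r(2) d(2,3)] d(4) r(1) by simp
  qed
  ultimately show ?thesis using valid by (simp add: S_def)
qed

end

subsection \<open>Reading the input\<close>

definition parse :: com where
  "parse =
     While (BLess (Const 0) (Read ''input'' (Var ''n''))) (Incr ''n'') ;;
     While (BLess (Const 0) (Read ''input'' (Plus (Plus (Var ''n'') (Const 1)) (Var ''k'')))) (Incr ''k'')"

text \<open>Products are formed by repeated addition, and the logarithm by doubling
  \<open>pw\<close> until it reaches \<open>n\<close>. The register \<open>w\<close> holds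
  \<open>2 * width\<close>: for \<open>m = 4 * l\<close> this is \<open>4 * m + 2\<close>.\<close>

definition parameters :: com where
  "parameters =
     Assign ''nk'' (Const 0) ;;
     For ''i'' (Var ''k'') (Assign ''nk'' (Plus (Var ''nk'') (Var ''n''))) ;;
     Assign ''pw'' (Const 1) ;;
     Assign ''l'' (Const 0) ;;
     While (BLess (Var ''pw'') (Var ''n'')) (Assign ''pw'' (Plus (Var ''pw'') (Var ''pw'')) ;; Incr ''l'') ;;
     Assign ''m'' (Plus (Plus (Var ''l'') (Var ''l'')) (Plus (Var ''l'') (Var ''l''))) ;;
     Assign ''w'' (Plus (Plus (Plus (Var ''m'') (Var ''m'')) (Plus (Var ''m'') (Var ''m''))) (Const 2)) ;;
     Assign ''T'' (Plus (Var ''n'') (Var ''n'')) ;;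
     For ''i'' (Var ''k'') (Assign ''T'' (Plus (Var ''T'') (Var ''w''))) ;;
     Assign ''tot'' (Const 0) ;;
     For ''i'' (Plus (Var ''m'') (Const 1)) (Assign ''tot'' (Plus (Var ''tot'') (Var ''T''))) ;;
     Assign ''ib'' (Plus (Plus (Var ''n'') (Var ''k'')) (Const 2)) ;;
     Assign ''gb'' (Plus (Var ''ib'') (Var ''nk''))"

text \<open>Index computations need products with \<open>n\<close> and \<open>k\<close> as well as
  quotients and remainders modulo \<open>n\<close>, but expressions offer only addition and
  subtraction. The tables are filled by counting.\<close>

definition tables :: com where
  "tables =
     Assign ''x'' (Const 0) ;;
     For ''i'' (Var ''length'') (Store ''mun'' (Var ''i'') (Var ''x'') ;; Assign ''x'' (Plus (Var ''x'') (Var ''n''))) ;;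
     Assign ''x'' (Const 0) ;;
     For ''i'' (Var ''n'') (Store ''muk'' (Var ''i'') (Var ''x'') ;; Assign ''x'' (Plus (Var ''x'') (Var ''k''))) ;;
     Assign ''t'' (Const 0) ;;
     Assign ''u'' (Const 0) ;;
     For ''i'' (Var ''length'')
       (Store ''tim'' (Var ''i'') (Var ''t'') ;;
        Store ''nod'' (Var ''i'') (Var ''u'') ;;
        Incr ''u'' ;;
        Cond (BLess (Var ''u'') (Var ''n'')) Skip (Assign ''u'' (Const 0) ;; Incr ''t''))"

definition setup_com :: com where
  "setup_com = parse ;; parameters ;; tables"

lemma written_setup [simp]:
  "written_regs parse = {''n'', ''k''}" "written_arrs parse = {}"
  "written_regs parameters = {''nk'', ''i'', ''pw'', ''l'', ''m'', ''w'', ''T'', ''tot'', ''ib'', ''gb''}"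
  "written_arrs parameters = {}"
  "written_regs tables = {''x'', ''i'', ''t'', ''u''}" "written_arrs tables = {''mun'', ''muk'', ''tim'', ''nod''}"
  by (simp_all add: parse_def parameters_def tables_def insert_commute)

lemma nth_concat_map:
  assumes "\<And>x. x \<in> set xs \<Longrightarrow> length (g x) = c" "a < length xs" "b < c"
  shows "concat (map g xs) ! (a * c + b) = g (xs ! a) ! b"
  using assms
proof (induction xs arbitrary: a)
  case (Cons x xs)
  show ?case
  proof (cases a)
    case (Suc a')
    then show ?thesis using Cons by (simp add: nth_append)
  qed (use Cons in \<open>simp add: nth_append\<close>)
qed simp

lemma length_concat_map:
  assumes "\<And>x. x \<in> set xs \<Longrightarrow> length (g x) = c"
  shows "length (concat (map g xs)) = length xs * c"
  using assms by (induction xs) auto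

context gossip_locale
begin

definition input where "input = encode I"
text \<open>One iteration limit for all loops. When phases are run, the network has at most as many
  vertices as the input has bits. The factor also makes room for the
  \<open>4 * log_ceil n + 1\<close> iterations that add up \<open>total\<close> before it is known
  whether this fits.\<close>

definition bound where "bound = 8 * length input + 8"

lemma input_eq:
  "input = replicate n True @ [False] @ replicate k True @ [False] @
     concat (map (\<lambda>u. map (\<lambda>i. (u, i) \<in> init I) [0..<k]) [0..<n]) @
     concat (map (\<lambda>t. concat (map (\<lambda>u. map (\<lambda>v. (u, v) \<in> graph I t) [0..<n]) [0..<n])) [1..<Suc (n * k)])"
  unfolding input_def encode_def by (simp add: map_concat comp_def concat_map_singleton)

lemma length_input: "length input = n + k + 2 + n * k + n * k * (n * n)"
proof -
  have 1: "length (concat (map (\<lambda>u. map (\<lambda>i. (u, i) \<in> init I) [0..<k]) [0..<n])) = n * k"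
    by (subst length_concat_map[where c = k]) auto
  have 2: "length (concat (map (\<lambda>u. map (\<lambda>v. (u, v) \<in> graph I t) [0..<n]) [0..<n])) = n * n" for t
    by (subst length_concat_map[where c = n]) auto
  have 3: "length (concat (map (\<lambda>t. concat (map (\<lambda>u. map (\<lambda>v. (u, v) \<in> graph I t) [0..<n]) [0..<n])) [1..<Suc (n * k)])) = n * k * (n * n)"
    by (subst length_concat_map[where c = "n * n"]) (auto simp: 2)
  show ?thesis unfolding input_eq using 1 3 by simp
qed

lemma input_n: "i < n \<Longrightarrow> input ! i" "\<not> input ! n"
  by (simp_all add: input_eq nth_append)

lemma input_k: "i < k \<Longrightarrow> input ! (n + 1 + i)" "\<not> input ! (n + 1 + k)"
  by (simp_all add: input_eq nth_append)

lemma input_init: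
  assumes "u < n" "i < k"
  shows "input ! (n + k + 2 + (u * k + i)) \<longleftrightarrow> (u, i) \<in> init I"
proof -
  let ?X = "concat (map (\<lambda>u. map (\<lambda>i. (u, i) \<in> init I) [0..<k]) [0..<n])"
  have len: "length ?X = n * k" by (subst length_concat_map[where c = k]) auto
  have "u * k + i < n * k"
    using index_less[of u "n - 1" i k] assms by simp
  then have "input ! (n + k + 2 + (u * k + i)) = ?X ! (u * k + i)"
    unfolding input_eq using len by (simp add: nth_append)
  also have "\<dots> = map (\<lambda>i. (u, i) \<in> init I) [0..<k] ! i"
    by (subst nth_concat_map[where c = k]) (use assms in auto)
  finally show ?thesis using assms by simp
qed

lemma input_graph:
  assumes "r < n * k" "u < n" "v < n"
  shows "input ! (n + k + 2 + n * k + ((r * n + u) * n + v)) \<longleftrightarrow> (u, v) \<in> graph I (Suc r)"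
proof -
  let ?X = "concat (map (\<lambda>u. map (\<lambda>i. (u, i) \<in> init I) [0..<k]) [0..<n])"
  let ?g = "\<lambda>t. concat (map (\<lambda>u. map (\<lambda>v. (u, v) \<in> graph I t) [0..<n]) [0..<n])"
  have len: "length ?X = n * k" by (subst length_concat_map[where c = k]) auto
  have leng: "length (?g t) = n * n" for t by (subst length_concat_map[where c = n]) auto
  have i: "(r * n + u) * n + v = r * (n * n) + (u * n + v)" by (simp add: algebra_simps)
  have uv: "u * n + v < n * n" using index_less[of u "n - 1" v n] assms by simp
  have "input ! (n + k + 2 + n * k + ((r * n + u) * n + v)) = concat (map ?g [1..<Suc (n * k)]) ! ((r * n + u) * n + v)"
    unfolding input_eq using len by (simp add: nth_append)
  also have "\<dots> = ?g ([1..<Suc (n * k)] ! r) ! (u * n + v)"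
    unfolding i by (rule nth_concat_map) (use assms uv leng in \<open>auto simp del: upt_Suc\<close>)
  also have "\<dots> = ?g (Suc r) ! (u * n + v)"
    using assms by (simp del: upt_Suc)
  also have "\<dots> = map (\<lambda>v. (u, v) \<in> graph I (Suc r)) [0..<n] ! v"
    by (subst nth_concat_map[where c = n]) (use assms in auto)
  finally show ?thesis using assms by simp
qed

definition has_input :: "state \<Rightarrow> bool" where
  "has_input s \<longleftrightarrow> reg s ''length'' = length input \<and>
     arr s ''input'' = (\<lambda>i. of_bool (i < length input \<and> input ! i))"

definition has_params :: "state \<Rightarrow> bool" where
  "has_params s \<longleftrightarrow> reg s ''n'' = n \<and> reg s ''k'' = k \<and> reg s ''nk'' = n * k \<and>
     reg s ''m'' = last_phase \<and> reg s ''T'' = duration \<and> reg s ''tot'' = total \<and>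
     reg s ''ib'' = n + k + 2 \<and> reg s ''gb'' = n + k + 2 + n * k"

definition has_tables :: "state \<Rightarrow> bool" where
  "has_tables s \<longleftrightarrow> (\<forall>i<length input. arr s ''mun'' i = i * n) \<and> (\<forall>i<n. arr s ''muk'' i = i * k) \<and>
     (\<forall>i<length input. arr s ''tim'' i = i div n) \<and> (\<forall>i<length input. arr s ''nod'' i = i mod n)"

definition env :: "state \<Rightarrow> bool" where
  "env s \<longleftrightarrow> has_input s \<and> has_params s \<and> has_tables s"

lemma parse_correct:
  "hoare bound (\<lambda>s. has_input s \<and> reg s ''n'' = 0 \<and> reg s ''k'' = 0) parse
     (\<lambda>s. has_input s \<and> reg s ''n'' = n \<and> reg s ''k'' = k)"
proof -
  have in_n: "0 < arr s ''input'' i \<longleftrightarrow> i < n" if "has_input s" "i \<le> n" for s i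
    using that input_n length_input by (cases "i = n") (auto simp: has_input_def)
  have in_k: "0 < arr s ''input'' (Suc (n + i)) \<longleftrightarrow> i < k" if "has_input s" "i \<le> k" for s i
    using that input_k length_input by (cases "i = k") (auto simp: has_input_def)
  have hi: "has_input (set_reg ''n'' i s) = has_input s" "has_input (set_reg ''k'' i s) = has_input s" for i s
    by (simp_all add: has_input_def)
  have "hoare bound (\<lambda>s. has_input s \<and> reg s ''n'' \<le> n \<and> reg s ''k'' = 0)
      (While (BLess (Const 0) (Read ''input'' (Var ''n''))) (Incr ''n''))
      (\<lambda>s. (has_input s \<and> reg s ''n'' \<le> n \<and> reg s ''k'' = 0) \<and> \<not> bval (BLess (Const 0) (Read ''input'' (Var ''n''))) s)"
    by (rule hoare_While[where V = "\<lambda>s. n - reg s ''n''"])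
      (auto intro!: hoare_wp simp: in_n hi bound_def length_input)
  then have 1: "hoare bound (\<lambda>s. has_input s \<and> reg s ''n'' = 0 \<and> reg s ''k'' = 0)
      (While (BLess (Const 0) (Read ''input'' (Var ''n''))) (Incr ''n''))
      (\<lambda>s. has_input s \<and> reg s ''n'' = n \<and> reg s ''k'' \<le> k)"
  proof (rule hoare_conseq, goal_cases)
    case (2 s)
    then show ?case using in_n[of s "reg s ''n''"] by auto
  qed simp
  have "hoare bound (\<lambda>s. has_input s \<and> reg s ''n'' = n \<and> reg s ''k'' \<le> k)
      (While (BLess (Const 0) (Read ''input'' (Plus (Plus (Var ''n'') (Const 1)) (Var ''k'')))) (Incr ''k''))
      (\<lambda>s. (has_input s \<and> reg s ''n'' = n \<and> reg s ''k'' \<le> k) \<and>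
        \<not> bval (BLess (Const 0) (Read ''input'' (Plus (Plus (Var ''n'') (Const 1)) (Var ''k'')))) s)"
    by (rule hoare_While[where V = "\<lambda>s. k - reg s ''k''"])
      (auto intro!: hoare_wp simp: in_k hi bound_def length_input)
  then have 2: "hoare bound (\<lambda>s. has_input s \<and> reg s ''n'' = n \<and> reg s ''k'' \<le> k)
      (While (BLess (Const 0) (Read ''input'' (Plus (Plus (Var ''n'') (Const 1)) (Var ''k'')))) (Incr ''k''))
      (\<lambda>s. has_input s \<and> reg s ''n'' = n \<and> reg s ''k'' = k)"
  proof (rule hoare_conseq, goal_cases)
    case (2 s)
    then show ?case using in_k[of s "reg s ''k''"] by auto
  qed simp
  show ?thesis unfolding parse_def by (rule hoare_Seq[OF 1 2])
qed

lemma log_ceil_le: "log_ceil n \<le> n"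
  unfolding log_ceil_def by (rule Least_le) simp

lemma parameters_correct:
  "hoare bound (\<lambda>s. has_input s \<and> reg s ''n'' = n \<and> reg s ''k'' = k) parameters
     (\<lambda>s. has_input s \<and> has_params s)"
proof -
  define F where "F s \<longleftrightarrow> reg s ''n'' = n \<and> reg s ''k'' = k" for s :: state
  have b: "n \<le> bound" "k \<le> bound" "Suc last_phase \<le> bound" "log_ceil n \<le> bound"
    using log_ceil_le by (simp_all add: bound_def length_input last_phase_def)
  have nk: "hoare bound (\<lambda>s. F s \<and> reg s ''nk'' = 0)
      (For ''i'' (Var ''k'') (Assign ''nk'' (Plus (Var ''nk'') (Var ''n''))))
      (\<lambda>s. F s \<and> reg s ''nk'' = n * k)"
    by (rule hoare_For_wp[where F = F and I = "\<lambda>j s. reg s ''nk'' = n * j" and N = k])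
      (simp_all add: F_def b stable_simps)
  define F1 where "F1 s \<longleftrightarrow> F s \<and> reg s ''nk'' = n * k" for s
  define J where "J s \<longleftrightarrow> F1 s \<and> reg s ''l'' \<le> log_ceil n \<and> reg s ''pw'' = 2 ^ reg s ''l''" for s
  have less: "l < log_ceil n" if "2 ^ l < n" for l
    using log_ceil[of n] that by (metis leD le_less_trans not_le one_less_numeral_iff power_strict_increasing_iff semiring_norm(76) order.strict_trans2)
  have lb: "hoare bound J
      (While (BLess (Var ''pw'') (Var ''n'')) (Seq (Assign ''pw'' (Plus (Var ''pw'') (Var ''pw''))) (Incr ''l'')))
      (\<lambda>s. J s \<and> \<not> bval (BLess (Var ''pw'') (Var ''n'')) s)"
    by (rule hoare_While[where V = "\<lambda>s. log_ceil n - reg s ''l''"])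
      (use b(4) less in \<open>auto intro!: hoare_wp diff_less_mono2 simp: J_def F1_def F_def Suc_le_eq\<close>)
  have l: "hoare bound J
      (While (BLess (Var ''pw'') (Var ''n'')) (Seq (Assign ''pw'' (Plus (Var ''pw'') (Var ''pw''))) (Incr ''l'')))
      (\<lambda>s. F1 s \<and> reg s ''l'' = log_ceil n)"
  proof (rule hoare_post[OF lb])
    fix s assume s: "J s \<and> \<not> bval (BLess (Var ''pw'') (Var ''n'')) s"
    then have "log_ceil n \<le> reg s ''l''"
      unfolding log_ceil_def by (intro Least_le) (simp add: J_def F1_def F_def)
    then show "F1 s \<and> reg s ''l'' = log_ceil n" using s by (simp add: J_def)
  qed
  define F2 where "F2 s \<longleftrightarrow> F1 s \<and> reg s ''m'' = last_phase \<and> reg s ''w'' = 2 * width" for s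
  have T: "hoare bound (\<lambda>s. F2 s \<and> reg s ''T'' = 2 * n)
      (For ''i'' (Var ''k'') (Assign ''T'' (Plus (Var ''T'') (Var ''w''))))
      (\<lambda>s. F2 s \<and> reg s ''T'' = duration)"
    by (rule hoare_For_wp[where F = F2 and I = "\<lambda>j s. reg s ''T'' = 2 * n + 2 * j * width" and N = k])
      (simp_all add: F2_def F1_def F_def b duration_def stable_simps)
  have tot: "hoare bound (\<lambda>s. (F2 s \<and> reg s ''T'' = duration) \<and> reg s ''tot'' = 0)
      (For ''i'' (Plus (Var ''m'') (Const 1)) (Assign ''tot'' (Plus (Var ''tot'') (Var ''T''))))
      (\<lambda>s. F2 s \<and> reg s ''T'' = duration \<and> reg s ''tot'' = total)"
    by (rule hoare_For_wp[where F = "\<lambda>s. F2 s \<and> reg s ''T'' = duration" and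
          I = "\<lambda>j s. reg s ''tot'' = j * duration" and N = "Suc last_phase"])
      (simp_all add: F2_def F1_def F_def b total_def stable_simps)
  have "hoare bound F parameters has_params"
    unfolding parameters_def
    apply (rule hoare_Seq[OF hoare_wp hoare_Seq[OF nk]])
     apply (simp add: F_def)
    apply (rule hoare_Seq[where R = "\<lambda>s. F1 s \<and> reg s ''pw'' = 1"])
     apply (rule hoare_wp, simp add: F1_def F_def)
    apply (rule hoare_Seq[where R = J])
     apply (rule hoare_wp, simp add: F1_def F_def J_def)
    apply (rule hoare_Seq[OF l])
    apply (rule hoare_Seq[where R = "\<lambda>s. F1 s \<and> reg s ''m'' = last_phase"])
     apply (rule hoare_wp, simp add: F1_def F_def last_phase_def)
    apply (rule hoare_Seq[where R = F2])
     apply (rule hoare_wp, simp add: F1_def F_def F2_def last_phase_def width_def)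
    apply (rule hoare_Seq[OF hoare_wp hoare_Seq[OF T]])
     apply (simp add: F1_def F_def F2_def)
    apply (rule hoare_Seq[OF hoare_wp hoare_Seq[OF tot]])
     apply (simp add: F1_def F_def F2_def)
    apply (rule hoare_wp, simp add: F1_def F_def F2_def has_params_def)
    done
  then have "hoare bound (\<lambda>s. F s \<and> has_input s) parameters (\<lambda>s. has_params s \<and> has_input s)"
    by (rule hoare_frame) (simp add: stable_def agree_def has_input_def)
  then show ?thesis by (rule hoare_conseq) (auto simp: F_def)
qed

lemma tables_correct:
  "hoare bound (\<lambda>s. has_input s \<and> has_params s) tables env"
proof -
  define F where "F s \<longleftrightarrow> reg s ''n'' = n \<and> reg s ''k'' = k \<and> reg s ''length'' = length input" for s :: state
  have b: "n \<le> bound" "length input \<le> bound"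
    by (simp_all add: bound_def length_input)
  let ?mun = "\<lambda>j s. \<forall>i<j. arr s ''mun'' i = i * n"
  let ?muk = "\<lambda>j s. \<forall>i<j. arr s ''muk'' i = i * k"
  let ?dm = "\<lambda>j s. \<forall>i<j. arr s ''tim'' i = i div n \<and> arr s ''nod'' i = i mod n"
  have 1: "hoare bound (\<lambda>s. F s \<and> reg s ''x'' = 0)
      (For ''i'' (Var ''length'') (Seq (Store ''mun'' (Var ''i'') (Var ''x'')) (Assign ''x'' (Plus (Var ''x'') (Var ''n'')))))
      (\<lambda>s. F s \<and> ?mun (length input) s)"
    by (rule hoare_For_wp[where F = F and N = "length input" and
        I = "\<lambda>j s. reg s ''x'' = j * n \<and> ?mun j s"])
      (simp_all add: F_def b All_less_Suc stable_simps)
  have 2: "hoare bound (\<lambda>s. (F s \<and> ?mun (length input) s) \<and> reg s ''x'' = 0)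
      (For ''i'' (Var ''n'') (Seq (Store ''muk'' (Var ''i'') (Var ''x'')) (Assign ''x'' (Plus (Var ''x'') (Var ''k'')))))
      (\<lambda>s. F s \<and> ?mun (length input) s \<and> ?muk n s)"
    by (rule hoare_For_wp[where F = "\<lambda>s. F s \<and> ?mun (length input) s" and N = n and
        I = "\<lambda>j s. reg s ''x'' = j * k \<and> ?muk j s"])
      (simp_all add: F_def b All_less_Suc stable_simps)
  have 3: "hoare bound (\<lambda>s. (F s \<and> ?mun (length input) s \<and> ?muk n s) \<and> reg s ''t'' = 0 \<and> reg s ''u'' = 0)
      (For ''i'' (Var ''length'')
       (Store ''tim'' (Var ''i'') (Var ''t'') ;;
        Store ''nod'' (Var ''i'') (Var ''u'') ;;
        Incr ''u'' ;;
        Cond (BLess (Var ''u'') (Var ''n'')) Skip (Assign ''u'' (Const 0) ;; Incr ''t''))) has_tables"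
  proof (rule hoare_For_wp[where F = "\<lambda>s. F s \<and> ?mun (length input) s \<and> ?muk n s" and N = "length input" and
        I = "\<lambda>j s. reg s ''t'' = j div n \<and> reg s ''u'' = j mod n \<and> ?dm j s"], goal_cases)
    case (8 j s)
    have "Suc j mod n = (if Suc (j mod n) < n then Suc (j mod n) else 0)"
      "Suc j div n = (if Suc (j mod n) < n then j div n else Suc (j div n))"
      using n_pos by (auto simp: mod_Suc div_Suc intro: Suc_lessI)
    with 8 show ?case by (simp add: F_def All_less_Suc)
  qed (simp_all add: F_def b has_tables_def stable_def agree_def)
  have "hoare bound F tables has_tables"
    unfolding tables_def
    apply (rule hoare_Seq[OF hoare_wp hoare_Seq[OF 1]])
     apply (simp add: F_def)
    apply (rule hoare_Seq[OF hoare_wp hoare_Seq[OF 2]])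
     apply (simp add: F_def)
    apply (rule hoare_Seq[where R = "\<lambda>s. (F s \<and> ?mun (length input) s \<and> ?muk n s) \<and> reg s ''t'' = 0"])
     apply (rule hoare_wp, simp add: F_def)
    apply (rule hoare_Seq[OF hoare_wp 3])
    apply (simp add: F_def)
    done
  then have "hoare bound (\<lambda>s. F s \<and> has_input s \<and> has_params s) tables (\<lambda>s. has_tables s \<and> has_input s \<and> has_params s)"
    by (rule hoare_frame) (simp add: stable_def agree_def has_input_def has_params_def)
  then show ?thesis by (rule hoare_conseq) (auto simp: F_def env_def has_input_def has_params_def)
qed

lemma setup_correct:
  "hoare bound (\<lambda>s. has_input s \<and> reg s ''n'' = 0 \<and> reg s ''k'' = 0) setup_com env"
  unfolding setup_com_def
  by (rule hoare_Seq[OF parse_correct hoare_Seq[OF parameters_correct tables_correct]])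

end

subsection \<open>Augmenting paths\<close>

text \<open>Searching backwards from the destination makes the \<open>nxt\<close> pointers lead from
  the source towards it, the order in which \<open>augment\<close> walks. The queue is processed by
  a counting loop over \<open>W\<close> positions that idles beyond \<open>tail\<close>; as no
  vertex is queued twice, \<open>W\<close> positions suffice.\<close>

definition search :: com where
  "search =
     For ''x'' (Var ''W'') (Store ''mark'' (Var ''x'') (Const 0)) ;;
     Assign ''d'' (Read ''dest'' (Var ''p'')) ;;
     Store ''mark'' (Var ''d'') (Const 1) ;;
     Store ''queue'' (Const 0) (Var ''d'') ;;
     Assign ''tail'' (Const 1) ;;
     For ''h'' (Var ''W'')
       (Cond (BLess (Var ''h'') (Var ''tail''))
         (Assign ''y'' (Read ''queue'' (Var ''h'')) ;;
          For ''x'' (Var ''W'')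
            (Cond (BAnd (BLess (Const 0) (Read ''r'' (Plus (Read ''muW'' (Var ''x'')) (Var ''y''))))
                        (BEq (Read ''mark'' (Var ''x'')) (Const 0)))
              (Store ''queue'' (Var ''tail'') (Var ''x'') ;;
               Incr ''tail'' ;;
               Store ''mark'' (Var ''x'') (Var ''tail'') ;;
               Store ''nxt'' (Var ''x'') (Var ''y''))
              Skip))
         Skip)"

text \<open>\<open>mark\<close> decreases along \<open>nxt\<close> and is 1 only at the destination.
  It thus provides both the stopping test and the variant.\<close>

definition augment :: com where
  "augment =
     Assign ''x'' (Var ''s'') ;;
     While (BLess (Const 1) (Read ''mark'' (Var ''x'')))
       (Assign ''y'' (Read ''nxt'' (Var ''x'')) ;;
        Assign ''e'' (Plus (Read ''muW'' (Var ''x'')) (Var ''y'')) ;;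
        Store ''r'' (Var ''e'') (Minus (Read ''r'' (Var ''e'')) (Const 1)) ;;
        Assign ''e'' (Plus (Read ''muW'' (Var ''y'')) (Var ''x'')) ;;
        Store ''r'' (Var ''e'') (Plus (Read ''r'' (Var ''e'')) (Const 1)) ;;
        Assign ''x'' (Var ''y''))"

definition flow :: com where
  "flow =
     For ''p'' (Var ''P'')
       (Cond (BEq (Var ''fail'') (Const 0))
         (search ;;
          Cond (BLess (Const 0) (Read ''mark'' (Var ''s''))) augment (Assign ''fail'' (Const 1)))
         Skip)"

lemma written_flow [simp]:
  "written_regs search = {''d'', ''h'', ''tail'', ''x'', ''y''}"
  "written_arrs search = {''mark'', ''nxt'', ''queue''}"
  "written_regs augment = {''e'', ''x'', ''y''}"
  "written_arrs augment = {''r''}"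
  "written_regs flow = {''d'', ''e'', ''fail'', ''h'', ''p'', ''tail'', ''x'', ''y''}"
  "written_arrs flow = {''mark'', ''nxt'', ''queue'', ''r''}"
  by (simp_all add: search_def augment_def flow_def set_eq_subset)

lemma index_eq_iff: "y < W \<Longrightarrow> y' < W \<Longrightarrow> x * W + y = x' * W + y' \<longleftrightarrow> x = x' \<and> y = (y' :: nat)"
proof
  assume *: "y < W" "y' < W" "x * W + y = x' * W + y'"
  have "(x * W + y) div W = x" "(x' * W + y') div W = x'" using *(1,2) by simp_all
  with *(3) have "x = x'" by simp
  with *(3) show "x = x' \<and> y = y'" by simp
qed simp

section \<open>Correctness of search, augmentation and flow computation\<close>

definition entry :: "string \<Rightarrow> nat \<Rightarrow> state \<Rightarrow> nat \<Rightarrow> nat \<Rightarrow> nat" where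
  "entry a W s x y = arr s a (x * W + y)"

definition net_env :: "nat \<Rightarrow> state \<Rightarrow> bool" where
  "net_env W s \<longleftrightarrow> reg s ''W'' = W \<and> (\<forall>x<W. arr s ''muW'' x = x * W)"

lemma residual_cong:
  "(\<And>x y. x < W \<Longrightarrow> y < W \<Longrightarrow> r x y = r' x y) \<Longrightarrow> residual W cap r = residual W cap r'"
  by (simp add: residual_def)

lemma out_sum_cong:
  "(\<And>x y. x < W \<Longrightarrow> y < W \<Longrightarrow> r x y = r' x y) \<Longrightarrow> z < W \<Longrightarrow> out_sum W r z = out_sum W r' z"
  by (simp add: out_sum_def)

text \<open>
  Breadth-first search backwards from \<open>d\<close>.  \<open>mark x\<close> is the position of \<open>x\<close> in the queue, counted from
  \<open>1\<close>, and \<open>0\<close> for unvisited vertices.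
\<close>

definition search_inv ::
  "nat \<Rightarrow> (nat \<Rightarrow> nat \<Rightarrow> nat) \<Rightarrow> nat \<Rightarrow> (nat \<Rightarrow> nat) \<Rightarrow> (nat \<Rightarrow> nat) \<Rightarrow> (nat \<Rightarrow> nat) \<Rightarrow> nat \<Rightarrow> bool" where
  "search_inv W r d mark queue succ tail \<longleftrightarrow>
     0 < tail \<and> queue 0 = d \<and>
     (\<forall>i<tail. queue i < W \<and> mark (queue i) = Suc i) \<and>
     (\<forall>x<W. mark x \<noteq> 0 \<longrightarrow> mark x \<le> tail \<and> queue (mark x - 1) = x) \<and>
     (\<forall>x<W. 1 < mark x \<longrightarrow> succ x < W \<and> 0 < r x (succ x) \<and> 0 < mark (succ x) \<and> mark (succ x) < mark x)"

text \<open>At \<open>h = W\<close> the whole queue has been scanned and no residual arc enters the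
  marked set from outside. If the source is unmarked, this set is a saturated cut.\<close>

definition closed_upto ::
  "nat \<Rightarrow> (nat \<Rightarrow> nat \<Rightarrow> nat) \<Rightarrow> (nat \<Rightarrow> nat) \<Rightarrow> (nat \<Rightarrow> nat) \<Rightarrow> nat \<Rightarrow> nat \<Rightarrow> bool" where
  "closed_upto W r mark queue tail h \<longleftrightarrow>
     (\<forall>i<h. i < tail \<longrightarrow> (\<forall>x<W. 0 < r x (queue i) \<longrightarrow> mark x \<noteq> 0))"

lemma search_inv_init:
  assumes "d < W" "\<And>x. x < W \<Longrightarrow> x \<noteq> d \<Longrightarrow> mark x = 0" "mark d = Suc 0" "queue 0 = d"
  shows "search_inv W r d mark queue succ (Suc 0)"
proof -
  have d: "x = d" if "x < W" "mark x \<noteq> 0" for x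
    by (rule ccontr) (use assms(2) that in simp)
  have A1: "\<forall>i<Suc 0. queue i < W \<and> mark (queue i) = Suc i"
    using assms(1,3,4) by simp
  have A2: "\<forall>x<W. mark x \<noteq> 0 \<longrightarrow> mark x \<le> Suc 0 \<and> queue (mark x - 1) = x"
    using d assms(3,4) by force
  have A3: "\<forall>x<W. 1 < mark x \<longrightarrow> succ x < W \<and> 0 < r x (succ x) \<and> 0 < mark (succ x) \<and> mark (succ x) < mark x"
    using d assms(3) by force
  show ?thesis unfolding search_inv_def by (intro conjI A1 A2 A3 zero_less_Suc assms(4))
qed

lemma search_inv_push:
  assumes inv: "search_inv W r d mark queue succ tail" and x: "x < W" "mark x = 0"
    and h: "h < tail" "0 < r x (queue h)"
  shows "search_inv W r d (mark(x := Suc tail)) (queue(tail := x)) (succ(x := queue h)) (Suc tail)"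
proof -
  have ne: "queue i \<noteq> x" if "i < tail" for i
  proof -
    have "mark (queue i) = Suc i" using inv that by (simp add: search_inv_def)
    then show ?thesis using x(2) by auto
  qed
  have 1: "(queue(tail := x)) i < W \<and> (mark(x := Suc tail)) ((queue(tail := x)) i) = Suc i" if "i < Suc tail" for i
  proof (cases "i = tail")
    case False
    then have "i < tail" using that by simp
    then show ?thesis using inv ne by (simp add: search_inv_def)
  qed (use x in simp)
  have 2: "(mark(x := Suc tail)) z \<le> Suc tail \<and> (queue(tail := x)) ((mark(x := Suc tail)) z - 1) = z"
    if "z < W" "(mark(x := Suc tail)) z \<noteq> 0" for z
  proof (cases "z = x")
    case False
    then have "mark z \<noteq> 0" using that by simp
    then have "mark z \<le> tail" "queue (mark z - 1) = z" using inv that by (simp_all add: search_inv_def)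
    moreover have "mark z - 1 \<noteq> tail" using calculation(1) \<open>mark z \<noteq> 0\<close> by simp
    ultimately show ?thesis using False by simp
  qed simp
  have 3: "(succ(x := queue h)) z < W \<and> 0 < r z ((succ(x := queue h)) z) \<and>
      0 < (mark(x := Suc tail)) ((succ(x := queue h)) z) \<and>
      (mark(x := Suc tail)) ((succ(x := queue h)) z) < (mark(x := Suc tail)) z"
    if "z < W" "1 < (mark(x := Suc tail)) z" for z
  proof (cases "z = x")
    case True
    then show ?thesis using inv h ne[OF h(1)] by (simp add: search_inv_def)
  next
    case False
    then have "succ z < W" "0 < r z (succ z)" "0 < mark (succ z)" "mark (succ z) < mark z"
      using inv that by (simp_all add: search_inv_def)
    moreover have "succ z \<noteq> x" using calculation(3) x(2) by auto
    ultimately show ?thesis using False by simp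
  qed
  have 0: "(queue(tail := x)) 0 = d" using inv by (simp add: search_inv_def)
  note A1 = allI[OF impI, OF 1] and A2 = allI[OF impI, OF impI, OF 2] and A3 = allI[OF impI, OF impI, OF 3]
  show ?thesis unfolding search_inv_def by (intro conjI zero_less_Suc 0 A1 A2 A3)
qed

text \<open>The queue has no repetitions because \<open>mark\<close> inverts it.\<close>

lemma search_inv_tail: "search_inv W r d mark queue succ tail \<Longrightarrow> tail \<le> W"
proof -
  assume inv: "search_inv W r d mark queue succ tail"
  have "inj_on queue {..<tail}"
  proof (rule inj_onI)
    fix i j assume ij: "i \<in> {..<tail}" "j \<in> {..<tail}" "queue i = queue j"
    have "mark (queue i) = Suc i" "mark (queue j) = Suc j"
      using inv ij(1,2) by (simp_all add: search_inv_def)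
    then show "i = j" unfolding ij(3) by linarith
  qed
  moreover have "queue ` {..<tail} \<subseteq> {..<W}" using inv by (auto simp: search_inv_def)
  ultimately show ?thesis using card_inj_on_le[of queue "{..<tail}" "{..<W}"] by simp
qed

lemma closed_upto_push:
  assumes "closed_upto W r mark queue tail h" "h \<le> tail"
  shows "closed_upto W r (mark(x := Suc v)) (queue(tail := x)) (Suc tail) h"
  using assms by (auto simp: closed_upto_def)

lemma search_correct:
  assumes d: "d < W" and W: "W \<le> M"
  shows "hoare M (\<lambda>s. net_env W s \<and> (\<forall>x<W. \<forall>y<W. entry ''r'' W s x y = r x y) \<and> arr s ''dest'' (reg s ''p'') = d) search
    (\<lambda>s. search_inv W r d (arr s ''mark'') (arr s ''queue'') (arr s ''nxt'') (reg s ''tail'') \<and>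
       closed_upto W r (arr s ''mark'') (arr s ''queue'') (reg s ''tail'') W)"
proof -
  define F where "F s \<longleftrightarrow> net_env W s \<and> (\<forall>x<W. \<forall>y<W. entry ''r'' W s x y = r x y)" for s
  define J where "J h s \<longleftrightarrow>
      search_inv W r d (arr s ''mark'') (arr s ''queue'') (arr s ''nxt'') (reg s ''tail'') \<and>
      closed_upto W r (arr s ''mark'') (arr s ''queue'') (reg s ''tail'') h" for h and s :: state
  have clear: "hoare M (\<lambda>s. net_env W s \<and> (\<forall>x<W. \<forall>y<W. entry ''r'' W s x y = r x y) \<and> arr s ''dest'' (reg s ''p'') = d)
      (For ''x'' (Var ''W'') (Store ''mark'' (Var ''x'') (Const 0)))
      (\<lambda>s. (F s \<and> arr s ''dest'' (reg s ''p'') = d) \<and> (\<forall>x<W. arr s ''mark'' x = 0))"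
    by (rule hoare_For_wp[where F = "\<lambda>s. F s \<and> arr s ''dest'' (reg s ''p'') = d" and N = W and
          I = "\<lambda>j s. \<forall>x<j. arr s ''mark'' x = 0"])
      (simp_all add: F_def net_env_def entry_def W stable_simps All_less_Suc)
  have inner: "hoare M (\<lambda>s. (F s \<and> reg s ''h'' = h \<and> h < reg s ''tail'' \<and> reg s ''y'' = arr s ''queue'' h) \<and> J h s)
      (For ''x'' (Var ''W'')
            (Cond (BAnd (BLess (Const 0) (Read ''r'' (Plus (Read ''muW'' (Var ''x'')) (Var ''y''))))
                        (BEq (Read ''mark'' (Var ''x'')) (Const 0)))
              (Store ''queue'' (Var ''tail'') (Var ''x'') ;;
               Incr ''tail'' ;;
               Store ''mark'' (Var ''x'') (Var ''tail'') ;;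
               Store ''nxt'' (Var ''x'') (Var ''y''))
              Skip))
      (J (Suc h))" for h
  proof (rule hoare_For_wp[where F = "\<lambda>s. F s \<and> reg s ''h'' = h" and N = W and
        I = "\<lambda>j s. h < reg s ''tail'' \<and> reg s ''y'' = arr s ''queue'' h \<and> J h s \<and>
           (\<forall>x<j. 0 < r x (arr s ''queue'' h) \<longrightarrow> arr s ''mark'' x \<noteq> 0)"], goal_cases)
    case (7 s)
    then show ?case by (auto simp: J_def closed_upto_def less_Suc_eq)
  next
    case (8 j s)
    then have inv: "search_inv W r d (arr s ''mark'') (arr s ''queue'') (arr s ''nxt'') (reg s ''tail'')"
      by (simp add: J_def)
    have q: "arr s ''queue'' h < W" using 8 inv by (auto simp: search_inv_def)
    have muW: "arr s ''muW'' j = j * W" and rj: "arr s ''r'' (j * W + arr s ''queue'' h) = r j (arr s ''queue'' h)"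
      using 8 q by (simp_all add: F_def net_env_def entry_def)
    show ?case
    proof (cases "0 < r j (arr s ''queue'' h) \<and> arr s ''mark'' j = 0")
      case True
      have "search_inv W r d ((arr s ''mark'')(j := Suc (reg s ''tail''))) ((arr s ''queue'')(reg s ''tail'' := j))
          ((arr s ''nxt'')(j := arr s ''queue'' h)) (Suc (reg s ''tail''))"
        using 8 True by (intro search_inv_push[OF inv]) simp_all
      moreover have "closed_upto W r ((arr s ''mark'')(j := Suc (reg s ''tail''))) ((arr s ''queue'')(reg s ''tail'' := j))
          (Suc (reg s ''tail'')) h"
        using 8 by (intro closed_upto_push) (simp_all add: J_def)
      ultimately show ?thesis using 8 True by (simp add: muW rj J_def All_less_Suc)
    next
      case False
      then show ?thesis using 8 by (auto simp: muW rj J_def All_less_Suc)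
    qed
  qed (simp_all add: F_def J_def net_env_def entry_def W stable_simps)
  have outer: "hoare M (\<lambda>s. F s \<and> J 0 s)
     (For ''h'' (Var ''W'')
       (Cond (BLess (Var ''h'') (Var ''tail''))
         (Assign ''y'' (Read ''queue'' (Var ''h'')) ;;
          For ''x'' (Var ''W'')
            (Cond (BAnd (BLess (Const 0) (Read ''r'' (Plus (Read ''muW'' (Var ''x'')) (Var ''y''))))
                        (BEq (Read ''mark'' (Var ''x'')) (Const 0)))
              (Store ''queue'' (Var ''tail'') (Var ''x'') ;;
               Incr ''tail'' ;;
               Store ''mark'' (Var ''x'') (Var ''tail'') ;;
               Store ''nxt'' (Var ''x'') (Var ''y''))
              Skip))
         Skip)) (J W)"
  proof (rule hoare_For_conseq[where F = F and N = W and I = J], goal_cases)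
    case (7 h)
    show ?case
    proof (rule hoare_Cond)
      show "hoare M (\<lambda>s. (F s \<and> J h s \<and> reg s ''h'' = h) \<and> bval (BLess (Var ''h'') (Var ''tail'')) s)
         (Assign ''y'' (Read ''queue'' (Var ''h'')) ;;
          For ''x'' (Var ''W'')
            (Cond (BAnd (BLess (Const 0) (Read ''r'' (Plus (Read ''muW'' (Var ''x'')) (Var ''y''))))
                        (BEq (Read ''mark'' (Var ''x'')) (Const 0)))
              (Store ''queue'' (Var ''tail'') (Var ''x'') ;;
               Incr ''tail'' ;;
               Store ''mark'' (Var ''x'') (Var ''tail'') ;;
               Store ''nxt'' (Var ''x'') (Var ''y''))
              Skip)) (J (Suc h))"
        by (rule hoare_Seq[OF hoare_wp inner[of h]]) (simp add: F_def J_def net_env_def entry_def)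
      show "hoare M (\<lambda>s. (F s \<and> J h s \<and> reg s ''h'' = h) \<and> \<not> bval (BLess (Var ''h'') (Var ''tail'')) s) Skip (J (Suc h))"
        by (rule hoare_Skip) (auto simp: J_def closed_upto_def less_Suc_eq)
    qed
  qed (simp_all add: F_def J_def net_env_def entry_def W stable_simps)
  show ?thesis unfolding search_def
  proof (rule hoare_Seq[OF clear])
    let ?R = "\<lambda>s. F s \<and> (\<forall>x<W. arr s ''mark'' x = 0) \<and> reg s ''d'' = d"
    let ?R2 = "\<lambda>s. F s \<and> (\<forall>x<W. x \<noteq> d \<longrightarrow> arr s ''mark'' x = 0) \<and> arr s ''mark'' d = 1 \<and> reg s ''d'' = d"
    show "hoare M (\<lambda>s. (F s \<and> arr s ''dest'' (reg s ''p'') = d) \<and> (\<forall>x<W. arr s ''mark'' x = 0))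
       (Assign ''d'' (Read ''dest'' (Var ''p'')) ;;
        Store ''mark'' (Var ''d'') (Const 1) ;;
        Store ''queue'' (Const 0) (Var ''d'') ;;
        Assign ''tail'' (Const 1) ;;
        For ''h'' (Var ''W'')
       (Cond (BLess (Var ''h'') (Var ''tail''))
         (Assign ''y'' (Read ''queue'' (Var ''h'')) ;;
          For ''x'' (Var ''W'')
            (Cond (BAnd (BLess (Const 0) (Read ''r'' (Plus (Read ''muW'' (Var ''x'')) (Var ''y''))))
                        (BEq (Read ''mark'' (Var ''x'')) (Const 0)))
              (Store ''queue'' (Var ''tail'') (Var ''x'') ;;
               Incr ''tail'' ;;
               Store ''mark'' (Var ''x'') (Var ''tail'') ;;
               Store ''nxt'' (Var ''x'') (Var ''y''))
              Skip))
         Skip))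
        (\<lambda>s. search_inv W r d (arr s ''mark'') (arr s ''queue'') (arr s ''nxt'') (reg s ''tail'') \<and>
          closed_upto W r (arr s ''mark'') (arr s ''queue'') (reg s ''tail'') W)"
      apply (rule hoare_Seq[where R = ?R])
       apply (rule hoare_wp, simp add: F_def net_env_def entry_def)
      apply (rule hoare_Seq[where R = ?R2])
       apply (rule hoare_wp, simp add: F_def net_env_def entry_def)
      apply (rule hoare_Seq[where R = "\<lambda>s. ?R2 s \<and> arr s ''queue'' 0 = d"])
       apply (rule hoare_wp, simp add: F_def net_env_def entry_def)
      apply (rule hoare_Seq[OF hoare_wp hoare_post[OF outer]])
       apply (use d in \<open>simp add: F_def J_def net_env_def entry_def closed_upto_def search_inv_init\<close>)
      apply (simp add: J_def)
      done
  qed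
qed

text \<open>\<open>q\<close> is \<open>r\<close> after pushing a unit along the path from
  \<open>src\<close> to the current \<open>x\<close>. The last clause lets the walk go on: marks
  strictly decrease, so arcs between vertices marked at most \<open>mark x\<close> are untouched,
  and the arc ahead still has the residual capacity that the search found.\<close>

definition augment_inv ::
  "nat \<Rightarrow> (nat \<Rightarrow> nat \<Rightarrow> nat) \<Rightarrow> (nat \<Rightarrow> nat \<Rightarrow> nat) \<Rightarrow> nat \<Rightarrow> (nat \<Rightarrow> nat) \<Rightarrow> nat \<Rightarrow> (nat \<Rightarrow> nat \<Rightarrow> nat) \<Rightarrow> bool" where
  "augment_inv W cap r src mark x q \<longleftrightarrow>
     x < W \<and> mark x \<noteq> 0 \<and> residual W cap q \<and>
     (\<forall>z<W. out_sum W q z + of_bool (z = src) = out_sum W r z + of_bool (z = x)) \<and>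
     (\<forall>a<W. \<forall>b<W. 0 < mark a \<longrightarrow> mark a \<le> mark x \<longrightarrow> 0 < mark b \<longrightarrow> mark b \<le> mark x \<longrightarrow> q a b = r a b)"

lemma augment_inv_step:
  assumes inv: "augment_inv W cap r src mark x q" and search: "search_inv W r d mark queue succ tail"
    and x: "1 < mark x" and q': "\<And>a b. a < W \<Longrightarrow> b < W \<Longrightarrow> q' a b = shift x (succ x) q a b"
  shows "augment_inv W cap r src mark (succ x) q'" "succ x < W" "mark (succ x) < mark x" "0 < mark (succ x)" "x \<noteq> succ x"
proof -
  have xW: "x < W" using inv by (simp add: augment_inv_def)
  then have y: "succ x < W" "0 < r x (succ x)" "0 < mark (succ x)" "mark (succ x) < mark x"
    using search x by (simp_all add: search_inv_def)
  then show "succ x < W" "mark (succ x) < mark x" "0 < mark (succ x)" by simp_all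
  show ne: "x \<noteq> succ x" using y by auto
  have q: "0 < q x (succ x)" using inv y xW x by (simp add: augment_inv_def)
  have "residual W cap q'"
    using residual_shift[of W cap q x "succ x"] q ne inv residual_cong[of W q' "shift x (succ x) q"] q'
    by (simp add: augment_inv_def)
  moreover have "out_sum W q' z + of_bool (z = src) = out_sum W r z + of_bool (z = succ x)" if "z < W" for z
  proof -
    have "out_sum W q' z = out_sum W (shift x (succ x) q) z" using q' that by (rule out_sum_cong)
    moreover have "out_sum W (shift x (succ x) q) z + of_bool (z = x) = out_sum W q z + of_bool (z = succ x)"
      using q ne xW y(1) by (rule out_sum_shift)
    moreover have "out_sum W q z + of_bool (z = src) = out_sum W r z + of_bool (z = x)"
      using inv that by (simp add: augment_inv_def)
    ultimately show ?thesis by linarith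
  qed
  moreover have "q' a b = r a b"
    if "a < W" "b < W" "0 < mark a" "mark a \<le> mark (succ x)" "0 < mark b" "mark b \<le> mark (succ x)" for a b
  proof -
    have "a \<noteq> x" "b \<noteq> x" using that y(4) by auto
    then have "q' a b = q a b" using q' that by (simp add: shift_def)
    then show ?thesis using inv that y(4) by (simp add: augment_inv_def)
  qed
  ultimately show "augment_inv W cap r src mark (succ x) q'"
    using y by (simp add: augment_inv_def)
qed

lemma shift_array:
  assumes "x < W" "y < W" "x \<noteq> y" "a < W" "b < W"
  shows "(f(x * W + y := f (x * W + y) - 1, y * W + x := Suc (f (y * W + x)))) (a * W + b) =
    shift x y (\<lambda>a b. f (a * W + b)) a b"
  using assms by (simp add: shift_def index_eq_iff)

lemma augment_correct:
  assumes W: "W \<le> M" "src < W" and r: "residual W cap r"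
  shows "hoare M (\<lambda>s. net_env W s \<and> (\<forall>x<W. \<forall>y<W. entry ''r'' W s x y = r x y) \<and> reg s ''s'' = src \<and>
       search_inv W r d (arr s ''mark'') (arr s ''queue'') (arr s ''nxt'') (reg s ''tail'') \<and> 0 < arr s ''mark'' src)
     augment
     (\<lambda>s. residual W cap (entry ''r'' W s) \<and>
       (\<forall>z<W. out_sum W (entry ''r'' W s) z + of_bool (z = src) = out_sum W r z + of_bool (z = d)))"
proof -
  define J where "J s \<longleftrightarrow> net_env W s \<and>
      search_inv W r d (arr s ''mark'') (arr s ''queue'') (arr s ''nxt'') (reg s ''tail'') \<and>
      augment_inv W cap r src (arr s ''mark'') (reg s ''x'') (entry ''r'' W s)" for s
  let ?b = "BLess (Const 1) (Read ''mark'' (Var ''x''))"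
  have loop: "hoare M J (While ?b
       (Assign ''y'' (Read ''nxt'' (Var ''x'')) ;;
        Assign ''e'' (Plus (Read ''muW'' (Var ''x'')) (Var ''y'')) ;;
        Store ''r'' (Var ''e'') (Minus (Read ''r'' (Var ''e'')) (Const 1)) ;;
        Assign ''e'' (Plus (Read ''muW'' (Var ''y'')) (Var ''x'')) ;;
        Store ''r'' (Var ''e'') (Plus (Read ''r'' (Var ''e'')) (Const 1)) ;;
        Assign ''x'' (Var ''y''))) (\<lambda>s. J s \<and> \<not> bval ?b s)"
  proof (rule hoare_While[where V = "\<lambda>s. arr s ''mark'' (reg s ''x'')"], goal_cases)
    case (1 v)
    show ?case
    proof (rule hoare_wp)
      fix s assume s: "J s \<and> bval ?b s \<and> arr s ''mark'' (reg s ''x'') = v"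
      let ?x = "reg s ''x''" and ?y = "arr s ''nxt'' (reg s ''x'')" and ?f = "arr s ''r''"
      have J: "net_env W s" "search_inv W r d (arr s ''mark'') (arr s ''queue'') (arr s ''nxt'') (reg s ''tail'')"
        "augment_inv W cap r src (arr s ''mark'') ?x (entry ''r'' W s)" "1 < arr s ''mark'' ?x"
        using s by (simp_all add: J_def)
      have x: "?x < W" using J(3) by (simp add: augment_inv_def)
      let ?g = "?f(?x * W + ?y := ?f (?x * W + ?y) - 1, ?y * W + ?x := Suc (?f (?y * W + ?x)))"
      let ?q = "\<lambda>a b. ?g (a * W + b)"
      have y: "?y < W" "?x \<noteq> ?y"
        using augment_inv_step(2,5)[OF J(3,2,4)] by blast+
      have q: "?q a b = shift ?x ?y (entry ''r'' W s) a b" if "a < W" "b < W" for a b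
        using shift_array[OF x y(1,2) that, of ?f] unfolding entry_def .
      note step = augment_inv_step[OF J(3,2,4) q]
      have idx: "?y * W + ?x \<noteq> ?x * W + ?y" using x y by (simp add: index_eq_iff)
      show "wp (Assign ''y'' (Read ''nxt'' (Var ''x'')) ;;
        Assign ''e'' (Plus (Read ''muW'' (Var ''x'')) (Var ''y'')) ;;
        Store ''r'' (Var ''e'') (Minus (Read ''r'' (Var ''e'')) (Const 1)) ;;
        Assign ''e'' (Plus (Read ''muW'' (Var ''y'')) (Var ''x'')) ;;
        Store ''r'' (Var ''e'') (Plus (Read ''r'' (Var ''e'')) (Const 1)) ;;
        Assign ''x'' (Var ''y'')) (\<lambda>s. J s \<and> arr s ''mark'' (reg s ''x'') < v) s"
        using J(1,2) step(1,3) s x y(1) idx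
        by (simp add: J_def net_env_def entry_def[abs_def] fun_upd_other del: fun_upd_apply)
    qed
  next
    case (2 s)
    then have "arr s ''mark'' (reg s ''x'') \<le> reg s ''tail''"
      by (auto simp: J_def search_inv_def augment_inv_def)
    also have "\<dots> \<le> W" by (rule search_inv_tail[of W r d "arr s ''mark''" "arr s ''queue''" "arr s ''nxt''"]) (use 2 in \<open>unfold J_def, blast\<close>)
    finally show ?case using W by simp
  qed simp
  have init: "J (set_reg ''x'' (reg s ''s'') s)"
    if "net_env W s \<and> (\<forall>x<W. \<forall>y<W. entry ''r'' W s x y = r x y) \<and> reg s ''s'' = src \<and>
       search_inv W r d (arr s ''mark'') (arr s ''queue'') (arr s ''nxt'') (reg s ''tail'') \<and> 0 < arr s ''mark'' src" for s
  proof -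
    have "residual W cap (entry ''r'' W s)"
      using that r residual_cong[of W "entry ''r'' W s" r] by simp
    moreover have "out_sum W (entry ''r'' W s) z = out_sum W r z" if "z < W" for z
      by (rule out_sum_cong[OF _ that]) (use \<open>net_env W s \<and> _\<close> in simp)
    ultimately have "augment_inv W cap r src (arr s ''mark'') src (entry ''r'' W s)"
      using that W(2) by (simp add: augment_inv_def)
    then show ?thesis using that by (simp add: J_def net_env_def entry_def[abs_def])
  qed
  have fin: "residual W cap (entry ''r'' W s) \<and>
       (\<forall>z<W. out_sum W (entry ''r'' W s) z + of_bool (z = src) = out_sum W r z + of_bool (z = d))"
    if "J s \<and> \<not> bval ?b s" for s
  proof -
    \<comment> \<open>Mark 1 belongs to the head of the queue, which is \<open>d\<close>.\<close>
    have "reg s ''x'' = d"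
    proof -
      have x: "reg s ''x'' < W" "arr s ''mark'' (reg s ''x'') = 1"
        using that by (auto simp: J_def augment_inv_def)
      then have "arr s ''queue'' 0 = reg s ''x''" "arr s ''queue'' 0 = d"
        using that by (auto simp: J_def search_inv_def)
      then show ?thesis by simp
    qed
    then show ?thesis using that by (simp add: J_def augment_inv_def)
  qed
  show ?thesis unfolding augment_def
    by (rule hoare_Seq[OF hoare_Assign hoare_post[OF loop]]) (use init fin in auto)
qed

lemma serves_cong:
  "(\<And>x y. x < W \<Longrightarrow> y < W \<Longrightarrow> r x y = r' x y) \<Longrightarrow> serves W cap dest J s r = serves W cap dest J s r'"
  using residual_cong[of W r r' cap] out_sum_cong[of W r r'] by (auto simp: serves_def)

text \<open>The two implications serve different purposes. Absence of failure certifies a flow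
  whether or not the cut condition holds, so the output can always be trusted. The cut condition
  excludes failure, which is what the length bound relies on.\<close>

lemma flow_correct:
  assumes W: "W = Suc src" "W \<le> M" "P \<le> M" and dest: "\<And>p. p < P \<Longrightarrow> dest p < src"
  shows "hoare M (\<lambda>s. net_env W s \<and> reg s ''s'' = src \<and> reg s ''P'' = P \<and> (\<forall>p<P. arr s ''dest'' p = dest p) \<and>
       (\<forall>x<W. \<forall>y<W. entry ''r'' W s x y = cap x y) \<and> reg s ''fail'' = f)
     flow
     (\<lambda>s. (reg s ''fail'' = 0 \<longrightarrow> f = 0 \<and> serves W cap dest {..<P} src (entry ''r'' W s)) \<and>
       (f = 0 \<and> cut_condition W cap dest {..<P} src \<longrightarrow> reg s ''fail'' = 0))"
proof -
  define F where "F s \<longleftrightarrow> net_env W s \<and> reg s ''s'' = src \<and> reg s ''P'' = P \<and> (\<forall>p<P. arr s ''dest'' p = dest p)" for s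
  define J where "J p s \<longleftrightarrow> (reg s ''fail'' = 0 \<longrightarrow> f = 0 \<and> serves W cap dest {..<p} src (entry ''r'' W s)) \<and>
       (f = 0 \<and> cut_condition W cap dest {..<P} src \<longrightarrow> reg s ''fail'' = 0)" for p s
  let ?a = "Cond (BLess (Const 0) (Read ''mark'' (Var ''s''))) augment (Assign ''fail'' (Const 1))"
  have body: "hoare M (\<lambda>s. F s \<and> J p s \<and> reg s ''p'' = p \<and> reg s ''fail'' = 0) (search ;; ?a) (J (Suc p))" if p: "p < P" for p
  proof -
    \<comment> \<open>The current residual network is frozen as a logical variable \<open>r\<close>,
      so that the specifications of \<open>search\<close> and \<open>augment\<close> can refer to
      it.\<close>
    have "hoare M (\<lambda>s. F s \<and> J p s \<and> reg s ''p'' = p \<and> reg s ''fail'' = 0 \<and> entry ''r'' W s = r) (search ;; ?a) (J (Suc p))" for r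
    proof (cases "f = 0 \<and> serves W cap dest {..<p} src r")
      case False
      then show ?thesis by (intro hoare_False) (auto simp: J_def)
    next
      case True
      then have r: "serves W cap dest {..<p} src r" "f = 0" by simp_all
      let ?G = "\<lambda>s. F s \<and> reg s ''fail'' = 0 \<and> entry ''r'' W s = r"
      let ?Q = "\<lambda>s. search_inv W r (dest p) (arr s ''mark'') (arr s ''queue'') (arr s ''nxt'') (reg s ''tail'') \<and>
         closed_upto W r (arr s ''mark'') (arr s ''queue'') (reg s ''tail'') W"
      have dW: "dest p < W" using dest[OF p] W by simp
      have closed: "r x y = 0" if "?Q s" "x < W" "arr s ''mark'' x = 0" "y < W" "arr s ''mark'' y \<noteq> 0" for s x y
      proof -
        let ?i = "arr s ''mark'' y - 1"
        have y: "arr s ''mark'' y \<le> reg s ''tail''" "arr s ''queue'' ?i = y"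
          using that by (simp_all add: search_inv_def)
        have "reg s ''tail'' \<le> W" using that search_inv_tail by blast
        then have "?i < W" "?i < reg s ''tail''" using y that(5) by linarith+
        then show ?thesis using that(1,2,3) y(2) unfolding closed_upto_def by (metis gr0I)
      qed
      show ?thesis
      proof (rule hoare_Seq_frame[OF search_correct[OF dW W(2), of r], where F = ?G])
        show "stable ?G (written_regs search) (written_arrs search)"
          by (simp add: stable_simps F_def net_env_def entry_def[abs_def])
        show "(net_env W s \<and> (\<forall>x<W. \<forall>y<W. entry ''r'' W s x y = r x y) \<and> arr s ''dest'' (reg s ''p'') = dest p) \<and> ?G s"
          if "F s \<and> J p s \<and> reg s ''p'' = p \<and> reg s ''fail'' = 0 \<and> entry ''r'' W s = r" for s
          using that p by (auto simp: F_def)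
        show "hoare M (\<lambda>s. ?Q s \<and> ?G s) ?a (J (Suc p))"
        proof (rule hoare_Cond)
          have st: "stable (\<lambda>s. reg s ''fail'' = 0) (written_regs augment) (written_arrs augment)"
            by (simp add: stable_simps)
          show "hoare M (\<lambda>s. (?Q s \<and> ?G s) \<and> bval (BLess (Const 0) (Read ''mark'' (Var ''s''))) s) augment (J (Suc p))"
          proof (rule hoare_conseq[OF hoare_frame[OF augment_correct[OF W(2), of src cap r "dest p"] st]])
            show "src < W" "residual W cap r" using W r by (simp_all add: serves_def)
          next
            fix s assume "(?Q s \<and> ?G s) \<and> bval (BLess (Const 0) (Read ''mark'' (Var ''s''))) s"
            then show "(net_env W s \<and> (\<forall>x<W. \<forall>y<W. entry ''r'' W s x y = r x y) \<and> reg s ''s'' = src \<and>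
               search_inv W r (dest p) (arr s ''mark'') (arr s ''queue'') (arr s ''nxt'') (reg s ''tail'') \<and> 0 < arr s ''mark'' src) \<and>
               reg s ''fail'' = 0"
              by (auto simp: F_def)
          next
            fix s assume s: "(residual W cap (entry ''r'' W s) \<and>
               (\<forall>z<W. out_sum W (entry ''r'' W s) z + of_bool (z = src) = out_sum W r z + of_bool (z = dest p))) \<and>
               reg s ''fail'' = 0"
            have "out_sum W (entry ''r'' W s) z = out_sum W cap z + demand dest {..<Suc p} z" if "z < W" "z \<noteq> src" for z
            proof -
              have "out_sum W (entry ''r'' W s) z + of_bool (z = src) = out_sum W r z + of_bool (z = dest p)"
                using s that(1) by blast
              moreover have "out_sum W r z = out_sum W cap z + demand dest {..<p} z"
                using r(1) that by (simp add: serves_def)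
              ultimately show ?thesis using that(2) by (simp add: demand_lessThan_Suc)
            qed
            then show "J (Suc p) s" using s r(2) by (simp add: J_def serves_def)
          qed
          show "hoare M (\<lambda>s. (?Q s \<and> ?G s) \<and> \<not> bval (BLess (Const 0) (Read ''mark'' (Var ''s''))) s) (Assign ''fail'' (Const 1)) (J (Suc p))"
          proof (rule hoare_Assign)
            fix s assume s: "(?Q s \<and> ?G s) \<and> \<not> bval (BLess (Const 0) (Read ''mark'' (Var ''s''))) s"
            \<comment> \<open>The marked vertices would be a closed set with the destination but
              without the source, which \<open>augmentable\<close> excludes.\<close>
            have "\<not> cut_condition W cap dest {..<P} src"
            proof
              assume cut: "cut_condition W cap dest {..<P} src"
              let ?C = "{x. x < W \<and> arr s ''mark'' x \<noteq> 0}"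
              have m: "arr s ''mark'' (dest p) \<noteq> 0" using s by (auto simp: search_inv_def)
              have "src \<in> ?C"
              proof (rule augmentable[OF r(1) cut p])
                show "?C \<subseteq> {..<W}" by auto
                show "dest p \<in> ?C" using dW m by simp
                show "r x y = 0" if "x < W" "x \<notin> ?C" "y \<in> ?C" for x y
                  using closed[of s x y] s that by simp
              qed
              then show False using s by (auto simp: F_def)
            qed
            then show "J (Suc p) (set_reg ''fail'' (aval (Const 1) s) s)" by (simp add: J_def)
          qed
        qed
      qed
    qed
    then show ?thesis by (rule hoare_pre[OF hoare_ex[of M "\<lambda>r s. F s \<and> J p s \<and> reg s ''p'' = p \<and> reg s ''fail'' = 0 \<and> entry ''r'' W s = r"]]) auto
  qed
  show ?thesis unfolding flow_def
  proof (rule hoare_For_conseq[where F = F and N = P and I = J], goal_cases)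
    case (1 s)
    have "serves W cap dest {} src (entry ''r'' W s) = serves W cap dest {} src cap"
      using 1 by (intro serves_cong) simp
    also have "\<dots>" by (simp add: serves_def residual_def)
    finally show ?case using 1 by (simp add: F_def J_def)
  next
    case (7 p)
    show ?case
    proof (rule hoare_Cond)
      show "hoare M (\<lambda>s. (F s \<and> J p s \<and> reg s ''p'' = p) \<and> bval (BEq (Var ''fail'') (Const 0)) s) (search ;; ?a) (J (Suc p))"
        by (rule hoare_pre[OF body[OF 7]]) simp
      show "hoare M (\<lambda>s. (F s \<and> J p s \<and> reg s ''p'' = p) \<and> \<not> bval (BEq (Var ''fail'') (Const 0)) s) Skip (J (Suc p))"
        by (rule hoare_Skip) (simp add: J_def)
    qed
  qed (simp_all add: F_def J_def net_env_def entry_def[abs_def] W stable_simps)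
qed

subsection \<open>Building the networks of the phases\<close>

text \<open>Invariant of loops that fill a matrix row by row. \<open>(x, W)\<close> and
  \<open>(Suc x, 0)\<close> describe the same prefix, which is how a finished inner loop hands over
  to the next row.\<close>

definition filled :: "nat \<Rightarrow> (nat \<Rightarrow> nat) \<Rightarrow> (nat \<Rightarrow> nat \<Rightarrow> nat) \<Rightarrow> nat \<Rightarrow> nat \<Rightarrow> bool" where
  "filled W a f x y \<longleftrightarrow>
     (\<forall>x'<x. \<forall>y'<W. a (x' * W + y') = f x' y') \<and> (\<forall>y'<y. a (x * W + y') = f x y')"

lemma filled_0 [simp]: "filled W a f 0 0"
  by (simp add: filled_def)

lemma filled_row: "filled W a f x W \<longleftrightarrow> filled W a f (Suc x) 0"
  by (auto simp: filled_def less_Suc_eq)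

lemma filled_upd:
  assumes "filled W a f x y" "y < W" "v = f x y"
  shows "filled W (a(x * W + y := v)) f x (Suc y)"
  using assms by (simp add: filled_def index_eq_iff All_less_Suc)

lemma filledD: "filled W a f x 0 \<Longrightarrow> x' < x \<Longrightarrow> y' < W \<Longrightarrow> a (x' * W + y') = f x' y'"
  by (simp add: filled_def)

definition compute_levels :: com where
  "compute_levels =
     For ''j'' (Plus (Var ''m'') (Const 1))
       (For ''v'' (Var ''n'')
         (Assign ''b'' (Const 1) ;;
          Cond (BLess (Const 0) (Var ''j'')) Skip (Assign ''b'' (Const 0)) ;;
          For ''i'' (Minus (Var ''m'') (Var ''j''))
            (Cond (BLess (Const 0) (Read ''coin'' (Plus (Read ''mun'' (Var ''i'')) (Var ''v'')))) Skip
              (Assign ''b'' (Const 0))) ;;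
          Cond (BLess (Const 0) (Var ''v'')) Skip (Assign ''b'' (Const 1)) ;;
          Store ''mem'' (Plus (Read ''mun'' (Var ''j'')) (Var ''v'')) (Var ''b'')))"

definition prepare :: com where
  "prepare =
     compute_levels ;;
     Assign ''s'' (Plus (Read ''mun'' (Var ''T'')) (Var ''n'')) ;;
     Assign ''W'' (Plus (Var ''s'') (Const 1)) ;;
     Assign ''x'' (Const 0) ;;
     For ''i'' (Var ''W'') (Store ''muW'' (Var ''i'') (Var ''x'') ;; Assign ''x'' (Plus (Var ''x'') (Var ''W'')))"

text \<open>\<open>o\<close> is one more than the output cell of the edge, so that 0 can mark arcs
  without a cell, such as storage arcs.\<close>

definition build_edge :: com where
  "build_edge =
     (Cond (BEq (Var ''ph'') (Const 0))
        (Assign ''rd'' (Minus (Minus (Var ''T'') (Const 1)) (Read ''tim'' (Var ''x''))))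
        (Assign ''rd'' (Plus (Var ''pT'') (Read ''tim'' (Var ''x'')))) ;;
      Cond (BLess (Const 0) (Read ''input'' (Plus (Var ''gb'')
             (Plus (Read ''mun'' (Plus (Read ''mun'' (Var ''rd'')) (Read ''nod'' (Var ''x'')))) (Read ''nod'' (Var ''y''))))))
        (Assign ''c'' (Const 1) ;;
         Cond (BEq (Var ''ph'') (Const 0))
           (Assign ''o'' (Plus (Plus (Read ''mun'' (Plus (Read ''mun'' (Var ''rd'')) (Read ''nod'' (Var ''y'')))) (Read ''nod'' (Var ''x''))) (Const 1)))
           (Assign ''o'' (Plus (Plus (Read ''mun'' (Plus (Read ''mun'' (Var ''rd'')) (Read ''nod'' (Var ''x'')))) (Read ''nod'' (Var ''y''))) (Const 1))))
        Skip)"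

text \<open>\<open>cap\<close> is stored beside \<open>r\<close> because tracing needs the net flow,
  which is their difference.\<close>

definition build_cell :: com where
  "build_cell =
     (Assign ''e'' (Plus (Read ''muW'' (Var ''x'')) (Var ''y'')) ;;
      Assign ''c'' (Const 0) ;;
      Assign ''o'' (Const 0) ;;
      Cond (BLess (Var ''x'') (Var ''s''))
        (Cond (BAnd (BLess (Var ''y'') (Var ''s'')) (BEq (Read ''tim'' (Var ''y'')) (Plus (Read ''tim'' (Var ''x'')) (Const 1))))
          (Cond (BEq (Read ''nod'' (Var ''x'')) (Read ''nod'' (Var ''y''))) (Assign ''c'' (Var ''nk'')) build_edge)
          Skip)
        (Cond (BAnd (BLess (Var ''y'') (Var ''n'')) (BLess (Const 0) (Read ''mem'' (Plus (Read ''mun'' (Minus (Var ''ph'') (Const 1))) (Var ''y'')))))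
          (Assign ''c'' (Var ''nk''))
          Skip) ;;
      Store ''cap'' (Var ''e'') (Var ''c'') ;;
      Store ''r'' (Var ''e'') (Var ''c'') ;;
      Store ''eo'' (Var ''e'') (Var ''o''))"

definition build :: com where
  "build = For ''x'' (Var ''W'') (For ''y'' (Var ''W'') build_cell)"

text \<open>Any initial holder of a token can be its destination in reversed time; the loop keeps
  the last one found.\<close>

definition gather_packets :: com where
  "gather_packets =
     For ''i'' (Var ''k'')
       (Assign ''h'' (Const 0) ;;
        For ''u'' (Var ''n'')
          (Cond (BLess (Const 0) (Read ''input'' (Plus (Var ''ib'') (Plus (Read ''muk'' (Var ''u'')) (Var ''i'')))))
            (Assign ''h'' (Var ''u'')) Skip) ;;
        Store ''dest'' (Var ''i'') (Plus (Read ''mun'' (Var ''T'')) (Var ''h'')) ;;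
        Store ''tok'' (Var ''i'') (Var ''i'')) ;;
     Assign ''P'' (Var ''k'')"

definition spread_packets :: com where
  "spread_packets =
     For ''v'' (Var ''n'')
       (For ''i'' (Var ''k'')
         (Assign ''d'' (Const 0) ;;
          Cond (BLess (Const 0) (Read ''mem'' (Plus (Read ''mun'' (Var ''ph'')) (Var ''v'')))) (Assign ''d'' (Var ''v'')) Skip ;;
          Store ''dest'' (Plus (Read ''muk'' (Var ''v'')) (Var ''i'')) (Plus (Read ''mun'' (Var ''T'')) (Var ''d'')) ;;
          Store ''tok'' (Plus (Read ''muk'' (Var ''v'')) (Var ''i'')) (Var ''i''))) ;;
     Assign ''P'' (Var ''nk'')"

definition make_packets :: com where
  "make_packets = Cond (BEq (Var ''ph'') (Const 0)) gather_packets spread_packets"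

lemma written_build [simp]:
  "written_regs compute_levels = {''b'', ''i'', ''j'', ''v''}" "written_arrs compute_levels = {''mem''}"
  "written_regs prepare = {''W'', ''b'', ''i'', ''j'', ''s'', ''v'', ''x''}" "written_arrs prepare = {''mem'', ''muW''}"
  "written_regs build_edge = {''c'', ''o'', ''rd''}" "written_arrs build_edge = {}"
  "written_regs build_cell = {''c'', ''e'', ''o'', ''rd''}" "written_arrs build_cell = {''cap'', ''eo'', ''r''}"
  "written_regs build = {''c'', ''e'', ''o'', ''rd'', ''x'', ''y''}" "written_arrs build = {''cap'', ''eo'', ''r''}"
  "written_regs gather_packets = {''P'', ''h'', ''i'', ''u''}" "written_arrs gather_packets = {''dest'', ''tok''}"
  "written_regs spread_packets = {''P'', ''d'', ''i'', ''v''}" "written_arrs spread_packets = {''dest'', ''tok''}"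
  "written_regs make_packets = {''P'', ''d'', ''h'', ''i'', ''u'', ''v''}" "written_arrs make_packets = {''dest'', ''tok''}"
  by (simp_all add: compute_levels_def prepare_def build_edge_def build_cell_def build_def
      gather_packets_def spread_packets_def make_packets_def set_eq_subset)

section \<open>Levels, networks and packets as computed by the program\<close>

context gossip_locale
begin

text \<open>Row \<open>i\<close> of the coins has one coin per node. The step from level
  \<open>j\<close> to level \<open>j - 1\<close> consults exactly one more row, number
  \<open>last_phase - j\<close>, which is the source of independence. The conjunct
  \<open>0 < j\<close> shrinks level 0 to node 0 whatever the coins are.\<close>

definition level :: "(nat \<Rightarrow> nat) \<Rightarrow> nat \<Rightarrow> nat set" where
  "level c j = {v. v < n \<and> (v = 0 \<or> (0 < j \<and> (\<forall>i<last_phase - j. 0 < c (i * n + v))))}"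

definition src :: nat where "src = Suc duration * n"

definition W :: nat where "W = Suc src"

lemmas env_simps = env_def has_input_def has_params_def has_tables_def

lemma env_regs:
  assumes "env s"
  shows "reg s ''length'' = length input" "reg s ''n'' = n" "reg s ''k'' = k" "reg s ''nk'' = n * k"
    "reg s ''m'' = last_phase" "reg s ''T'' = duration" "reg s ''tot'' = total"
    "reg s ''ib'' = n + k + 2" "reg s ''gb'' = n + k + 2 + n * k"
    "i < length input \<Longrightarrow> arr s ''mun'' i = i * n" "u < n \<Longrightarrow> arr s ''muk'' u = u * k"
    "i < length input \<Longrightarrow> arr s ''tim'' i = i div n" "i < length input \<Longrightarrow> arr s ''nod'' i = i mod n"
  using assms by (simp_all add: env_simps)

lemma env_init:
  assumes "env s" "u < n" "i < k"
  shows "arr s ''input'' (n + k + 2 + (u * k + i)) = of_bool ((u, i) \<in> init I)"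
proof -
  have "u * k + i < n * k" using assms(2,3) by (rule mult_add_less)
  then show ?thesis using assms(1) input_init[OF assms(2,3)] by (simp add: env_simps length_input)
qed

lemma env_graph:
  assumes "env s" "r < n * k" "u < n" "v < n"
  shows "arr s ''input'' (n + k + 2 + n * k + ((r * n + u) * n + v)) = of_bool ((u, v) \<in> graph I (Suc r))"
proof -
  have "(r * n + u) * n + v < n * k * n * n"
    by (rule mult_add_less[OF mult_add_less]) (use assms in simp_all)
  then show ?thesis using assms(1) input_graph[OF assms(2-4)] by (simp add: env_simps length_input ac_simps)
qed

lemma row_less_length: "r < n * k \<Longrightarrow> u < n \<Longrightarrow> r * n + u < length input"
proof -
  assume *: "r < n * k" "u < n"
  have "r * n + u < n * k * n" by (rule mult_add_less[OF *])
  also have "\<dots> \<le> n * k * (n * n)" using n_pos by simp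
  finally show ?thesis by (simp add: length_input)
qed

lemma nk_less_length: "n * k < length input"
  by (simp add: length_input)

definition env_net :: "(nat \<Rightarrow> nat) \<Rightarrow> state \<Rightarrow> bool" where
  "env_net c s \<longleftrightarrow> env s \<and> reg s ''s'' = src \<and> net_env W s \<and>
     (\<forall>j\<le>last_phase. \<forall>v<n. arr s ''mem'' (j * n + v) = of_bool (v \<in> level c j))"

lemma env_net_env: "env_net c s \<Longrightarrow> env s"
  by (simp add: env_net_def)

lemma env_net_regs:
  assumes "env_net c s"
  shows "reg s ''s'' = src" "reg s ''W'' = W" "x < W \<Longrightarrow> arr s ''muW'' x = x * W"
    "j \<le> last_phase \<Longrightarrow> v < n \<Longrightarrow> arr s ''mem'' (j * n + v) = of_bool (v \<in> level c j)"
  using assms by (simp_all add: env_net_def net_env_def)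

lemma stable_env_net:
  assumes "\<forall>x \<in> {''length'', ''n'', ''k'', ''nk'', ''m'', ''T'', ''tot'', ''ib'', ''gb'', ''s'', ''W''}. x \<notin> X"
    "\<forall>x \<in> {''input'', ''mun'', ''muk'', ''tim'', ''nod'', ''muW'', ''mem''}. x \<notin> A" "stable F X A"
  shows "stable (\<lambda>s. env_net c s \<and> F s) X A"
  unfolding stable_def
proof (intro allI impI)
  fix s s' assume s: "env_net c s \<and> F s" "agree X A s s'"
  have r: "reg s' x = reg s x" if "x \<in> {''length'', ''n'', ''k'', ''nk'', ''m'', ''T'', ''tot'', ''ib'', ''gb'', ''s'', ''W''}" for x
    by (rule agree_reg[OF s(2)]) (rule bspec[OF assms(1) that])
  have a: "arr s' x = arr s x" if "x \<in> {''input'', ''mun'', ''muk'', ''tim'', ''nod'', ''muW'', ''mem''}" for x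
    by (rule agree_arr[OF s(2)]) (rule bspec[OF assms(2) that])
  have "env_net c s'" using s(1) by (simp add: env_net_def net_env_def env_simps r a)
  moreover have "F s'" using assms(3) s unfolding stable_def by blast
  ultimately show "env_net c s' \<and> F s'" by simp
qed

lemma levels_correct:
  assumes tot: "total \<le> n * k"
  shows "hoare bound (\<lambda>s. env s \<and> arr s ''coin'' = c) compute_levels
    (\<lambda>s. env s \<and> (\<forall>j\<le>last_phase. \<forall>v<n. arr s ''mem'' (j * n + v) = of_bool (v \<in> level c j)))"
proof -
  let ?f = "\<lambda>j v. of_bool (v \<in> level c j)"
  have m: "Suc last_phase \<le> n * k"
    using mult_le_mono2[of 1 duration "Suc last_phase"] duration_pos tot by (simp add: total_def)
  have b: "Suc last_phase \<le> bound" "n \<le> bound"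
    using m by (simp_all add: bound_def length_input)
  have ml: "j \<le> last_phase \<Longrightarrow> j < length input" for j
    using m nk_less_length by simp
  let ?inner = "For ''i'' (Minus (Var ''m'') (Var ''j''))
            (Cond (BLess (Const 0) (Read ''coin'' (Plus (Read ''mun'' (Var ''i'')) (Var ''v'')))) Skip
              (Assign ''b'' (Const 0)))"
  let ?F = "\<lambda>s. env s \<and> arr s ''coin'' = c"
  have inner: "hoare bound (\<lambda>s. ((?F s \<and> reg s ''j'' = j) \<and> filled n (arr s ''mem'') ?f j v \<and> reg s ''v'' = v) \<and> reg s ''b'' = of_bool (0 < j)) ?inner
      (\<lambda>s. ((?F s \<and> reg s ''j'' = j) \<and> filled n (arr s ''mem'') ?f j v \<and> reg s ''v'' = v) \<and>
        reg s ''b'' = of_bool (0 < j \<and> (\<forall>i<last_phase - j. 0 < c (i * n + v))))" if "v < n" for j v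
  proof (rule hoare_For_wp[where F = "\<lambda>s. (?F s \<and> reg s ''j'' = j) \<and> filled n (arr s ''mem'') ?f j v \<and> reg s ''v'' = v"
        and N = "last_phase - j" and I = "\<lambda>i s. reg s ''b'' = of_bool (0 < j \<and> (\<forall>i'<i. 0 < c (i' * n + v)))"], goal_cases)
    case (8 i s)
    then show ?case using ml[of i] by (simp add: env_regs All_less_Suc)
  qed (use b in \<open>simp_all add: stable_simps env_simps\<close>)
  have body: "hoare bound (\<lambda>s. (?F s \<and> reg s ''j'' = j) \<and> filled n (arr s ''mem'') ?f j v \<and> reg s ''v'' = v)
     (Assign ''b'' (Const 1) ;;
          Cond (BLess (Const 0) (Var ''j'')) Skip (Assign ''b'' (Const 0)) ;;
          ?inner ;;
          Cond (BLess (Const 0) (Var ''v'')) Skip (Assign ''b'' (Const 1)) ;;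
          Store ''mem'' (Plus (Read ''mun'' (Var ''j'')) (Var ''v'')) (Var ''b''))
     (\<lambda>s. filled n (arr s ''mem'') ?f j (Suc v))" if v: "v < n" and j: "j < Suc last_phase" for j v
  proof (rule hoare_Seq[OF hoare_wp hoare_Seq[OF hoare_wp hoare_Seq[OF inner[OF v] hoare_wp]]])
    let ?R = "\<lambda>s. ((?F s \<and> reg s ''j'' = j) \<and> filled n (arr s ''mem'') ?f j v \<and> reg s ''v'' = v) \<and> reg s ''b'' = 1"
    show "wp (Assign ''b'' (Const 1)) ?R s" if "(?F s \<and> reg s ''j'' = j) \<and> filled n (arr s ''mem'') ?f j v \<and> reg s ''v'' = v" for s
      using that by (simp add: env_simps)
    show "wp (Cond (BLess (Const 0) (Var ''j'')) Skip (Assign ''b'' (Const 0)))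
      (\<lambda>s. ((?F s \<and> reg s ''j'' = j) \<and> filled n (arr s ''mem'') ?f j v \<and> reg s ''v'' = v) \<and> reg s ''b'' = of_bool (0 < j)) s"
      if "?R s" for s using that by (cases "j = 0") (simp_all add: env_simps)
    show "wp (Cond (BLess (Const 0) (Var ''v'')) Skip (Assign ''b'' (Const 1)) ;;
          Store ''mem'' (Plus (Read ''mun'' (Var ''j'')) (Var ''v'')) (Var ''b''))
     (\<lambda>s. filled n (arr s ''mem'') ?f j (Suc v)) s"
      if "((?F s \<and> reg s ''j'' = j) \<and> filled n (arr s ''mem'') ?f j v \<and> reg s ''v'' = v) \<and>
        reg s ''b'' = of_bool (0 < j \<and> (\<forall>i<last_phase - j. 0 < c (i * n + v)))" for s
    proof -
      have "filled n ((arr s ''mem'')(j * n + v := w)) ?f j (Suc v)" if "w = of_bool (v \<in> level c j)" for w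
        using filled_upd[of n "arr s ''mem''" ?f j v w] \<open>_ \<and> reg s ''b'' = _\<close> v that by blast
      note upd = this
      have lev: "v \<in> level c j \<longleftrightarrow> v = 0 \<or> (0 < j \<and> (\<forall>i<last_phase - j. 0 < c (i * n + v)))"
        using v by (simp add: level_def)
      have "reg s ''n'' = n" "arr s ''mun'' j = j * n" using that j ml[of j] by (simp_all add: env_regs)
      moreover have "filled n ((arr s ''mem'')(j * n + v := if v = 0 then 1 else reg s ''b'')) ?f j (Suc v)"
        by (rule upd) (use that lev in auto)
      ultimately show ?thesis using that by (cases "v = 0") simp_all
    qed
  qed
  have row: "hoare bound (\<lambda>s. ?F s \<and> filled n (arr s ''mem'') ?f j 0 \<and> reg s ''j'' = j)
     (For ''v'' (Var ''n'')
         (Assign ''b'' (Const 1) ;;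
          Cond (BLess (Const 0) (Var ''j'')) Skip (Assign ''b'' (Const 0)) ;;
          ?inner ;;
          Cond (BLess (Const 0) (Var ''v'')) Skip (Assign ''b'' (Const 1)) ;;
          Store ''mem'' (Plus (Read ''mun'' (Var ''j'')) (Var ''v'')) (Var ''b'')))
     (\<lambda>s. filled n (arr s ''mem'') ?f (Suc j) 0)" if "j < Suc last_phase" for j
  proof (rule hoare_For_conseq[where F = "\<lambda>s. ?F s \<and> reg s ''j'' = j" and N = n and I = "\<lambda>v s. filled n (arr s ''mem'') ?f j v"], goal_cases)
    case (7 v)
    show ?case by (rule body[OF 7 that])
  qed (use b in \<open>simp_all add: stable_simps env_simps filled_row\<close>)
  show ?thesis unfolding compute_levels_def
  proof (rule hoare_For_conseq[where F = ?F and N = "Suc last_phase" and I = "\<lambda>j s. filled n (arr s ''mem'') ?f j 0"], goal_cases)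
    case (7 j)
    show ?case by (rule row[OF 7])
  next
    case (8 s)
    then show ?case using filledD[OF 8(2)] by simp
  qed (use b in \<open>simp_all add: stable_simps env_simps\<close>)
qed

text \<open>Phases that fit into the \<open>n * k\<close> given rounds also have a network small
  enough for the tables and the loop limit.\<close>

lemma W_bounds:
  assumes tot: "total \<le> n * k"
  shows "W \<le> bound" "src < length input" "duration < length input" "duration \<le> n * k"
proof -
  show T: "duration \<le> n * k" using tot by (simp add: total_def)
  then show "duration < length input" using nk_less_length by simp
  have "src \<le> n * k * n + n" using T by (simp add: src_def add.commute)
  also have "n * k * n \<le> n * k * (n * n)" using n_pos by simp
  finally show "src < length input" by (simp add: length_input)
  then show "W \<le> bound" by (simp add: bound_def W_def)
qed

lemma prepare_correct:
  assumes tot: "total \<le> n * k"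
  shows "hoare bound (\<lambda>s. env s \<and> arr s ''coin'' = c) prepare (env_net c)"
  unfolding prepare_def
proof (rule hoare_Seq[OF levels_correct[OF tot]])
  let ?F = "\<lambda>s. env s \<and> (\<forall>j\<le>last_phase. \<forall>v<n. arr s ''mem'' (j * n + v) = of_bool (v \<in> level c j))"
  let ?G = "\<lambda>s. ?F s \<and> reg s ''s'' = src \<and> reg s ''W'' = W"
  have l: "hoare bound (\<lambda>s. ?G s \<and> reg s ''x'' = 0)
    (For ''i'' (Var ''W'') (Store ''muW'' (Var ''i'') (Var ''x'') ;; Assign ''x'' (Plus (Var ''x'') (Var ''W'')))) (env_net c)"
    by (rule hoare_For_wp[where F = ?G and N = W and I = "\<lambda>i s. reg s ''x'' = i * W \<and> (\<forall>x<i. arr s ''muW'' x = x * W)"])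
      (use W_bounds[OF tot] in \<open>simp_all add: stable_simps env_simps env_net_def net_env_def All_less_Suc\<close>)
  show "hoare bound ?F (Assign ''s'' (Plus (Read ''mun'' (Var ''T'')) (Var ''n'')) ;;
     Assign ''W'' (Plus (Var ''s'') (Const 1)) ;;
     Assign ''x'' (Const 0) ;;
     For ''i'' (Var ''W'') (Store ''muW'' (Var ''i'') (Var ''x'') ;; Assign ''x'' (Plus (Var ''x'') (Var ''W'')))) (env_net c)"
    apply (rule hoare_Seq[where R = "\<lambda>s. ?F s \<and> reg s ''s'' = src"])
     apply (rule hoare_wp)
     apply (use W_bounds[OF tot] in \<open>simp add: env_simps src_def\<close>)
    apply (rule hoare_Seq[where R = ?G])
     apply (rule hoare_wp, simp add: env_simps W_def)
    apply (rule hoare_Seq[OF hoare_wp l])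
    apply (simp add: env_simps)
    done
qed

definition capacity :: "(nat \<Rightarrow> nat) \<Rightarrow> nat \<Rightarrow> nat \<Rightarrow> nat \<Rightarrow> nat" where
  "capacity c ph = expanded n duration (n * k) (level c (ph - 1)) (phase_graph ph)"

definition edge_cell :: "nat \<Rightarrow> nat \<Rightarrow> nat \<Rightarrow> nat" where
  "edge_cell ph x y =
     (if x < src \<and> y < src \<and> y div n = Suc (x div n) \<and> x mod n \<noteq> y mod n \<and>
         (x mod n, y mod n) \<in> phase_graph ph (x div n)
      then Suc (cell ph (x div n) (x mod n) (y mod n)) else 0)"

lemma build_cell_correct:
  assumes tot: "total \<le> n * k" and ph: "ph \<le> last_phase" and xy: "x < W" "y < W"
    and s: "env_net c s" "reg s ''ph'' = ph" "reg s ''pT'' = ph * duration" "reg s ''x'' = x" "reg s ''y'' = y"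
    and f: "filled W (arr s ''cap'') (capacity c ph) x y" "filled W (arr s ''r'') (capacity c ph) x y"
      "filled W (arr s ''eo'') (edge_cell ph) x y"
  shows "wp build_cell (\<lambda>s. filled W (arr s ''cap'') (capacity c ph) x (Suc y) \<and>
      filled W (arr s ''r'') (capacity c ph) x (Suc y) \<and> filled W (arr s ''eo'') (edge_cell ph) x (Suc y)) s"
proof -
  note b = W_bounds[OF tot]
  have fin: "filled W ((arr s ''cap'')(x * W + y := v)) (capacity c ph) x (Suc y)"
    "filled W ((arr s ''r'')(x * W + y := v)) (capacity c ph) x (Suc y)" if "v = capacity c ph x y" for v
    using filled_upd f xy(2) that by blast+
  have fin2: "filled W ((arr s ''eo'')(x * W + y := v)) (edge_cell ph) x (Suc y)" if "v = edge_cell ph x y" for v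
    using filled_upd f xy(2) that by blast
  have len: "x < src \<Longrightarrow> x < length input" "y < src \<Longrightarrow> y < length input" using b by simp_all
  have ph1: "ph - 1 \<le> last_phase" "ph - 1 < length input"
  proof -
    show "ph - 1 \<le> last_phase" using ph by simp
    have "ph - 1 \<le> Suc last_phase * 1" using ph by simp
    also have "\<dots> \<le> total" unfolding total_def using duration_pos by (intro mult_le_mono2) simp
    also note tot
    also note nk_less_length
    finally show "ph - 1 < length input" .
  qed
  note fcs = fin(1)[OF refl] fin(2)[OF refl] fin2[OF refl]
  note E = env_regs[OF env_net_env[OF s(1)]] env_net_regs(1,2)[OF s(1)] env_net_regs(3)[OF s(1) xy(1)]
  show ?thesis
  proof (cases "x < src")
    case x: True
    show ?thesis
    proof (cases "y < src \<and> y div n = Suc (x div n)")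
      case y: True
      let ?t = "x div n" and ?u = "x mod n" and ?v = "y mod n"
      have uv: "?u < n" "?v < n" using n_pos by simp_all
      have t: "?t < duration"
      proof -
        have "y div n < Suc duration" using y by (intro less_mult_imp_div_less) (simp add: src_def)
        then show ?thesis using y by simp
      qed
      define rd where "rd = round_of ph ?t"
      have rd: "rd < n * k" using round_of_less[OF ph t] tot by (simp add: rd_def)
      have rdl: "rd < length input" using rd nk_less_length by simp
      have cells: "rd * n + ?u < length input" "rd * n + ?v < length input"
        using row_less_length[OF rd] uv by simp_all
      have cap: "capacity c ph x y = (if ?u = ?v then n * k else of_bool ((?u, ?v) \<in> phase_graph ph ?t))"
        using x y by (simp add: capacity_def expanded_def src_def)
      have g: "arr s ''input'' (n + k + 2 + n * k + ((rd * n + ?u) * n + ?v)) = of_bool ((?u, ?v) \<in> phase_graph ph ?t)"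
        unfolding phase_graph_def rd_def[symmetric] by (rule env_graph[OF env_net_env[OF s(1)] rd uv])
      have rdr: "(if ph = 0 then duration - Suc 0 - ?t else ph * duration + ?t) = rd"
        by (simp add: rd_def round_of_def)
      have cellr: "cell ph ?t ?u ?v = (if ph = 0 then (rd * n + ?v) * n + ?u else (rd * n + ?u) * n + ?v)"
        by (simp add: cell_def rd_def)
      have ec: "edge_cell ph x y = (if ?u \<noteq> ?v \<and> (?u, ?v) \<in> phase_graph ph ?t then Suc (cell ph ?t ?u ?v) else 0)"
        using x y by (simp add: edge_cell_def)
      show ?thesis
      proof (cases "?u = ?v")
        case True
        then show ?thesis
          using s x y len fcs[unfolded cap ec] by (simp add: build_cell_def E)
      next
        case False
        then show ?thesis
          using s x y len rdl cells g rdr fcs[unfolded cap ec cellr]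
          by (cases "ph = 0"; cases "(?u, ?v) \<in> phase_graph ph ?t") (simp_all add: build_cell_def build_edge_def E)
      qed
    next
      case y: False
      then have z: "capacity c ph x y = 0" "edge_cell ph x y = 0"
        using x by (auto simp: capacity_def expanded_def src_def edge_cell_def)
      show ?thesis
        using s x y len fcs[unfolded z] by (cases "y < src") (simp_all add: build_cell_def E)
    qed
  next
    case x: False
    have cap: "capacity c ph x y = (if y < n \<and> y \<in> level c (ph - 1) then n * k else 0)" "edge_cell ph x y = 0"
      using x by (auto simp: capacity_def expanded_def src_def edge_cell_def)
    have mem: "y < n \<Longrightarrow> arr s ''mem'' ((ph - 1) * n + y) = of_bool (y \<in> level c (ph - 1))"
      using env_net_regs(4)[OF s(1) ph1(1)] by blast
    show ?thesis
      using s x ph1 mem fcs[unfolded cap]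
      by (cases "y < n"; cases "y \<in> level c (ph - 1)") (simp_all add: build_cell_def E)
  qed
qed

lemma build_correct:
  assumes tot: "total \<le> n * k" and ph: "ph \<le> last_phase"
  shows "hoare bound (\<lambda>s. env_net c s \<and> reg s ''ph'' = ph \<and> reg s ''pT'' = ph * duration) build
    (\<lambda>s. \<forall>x<W. \<forall>y<W. entry ''cap'' W s x y = capacity c ph x y \<and> entry ''r'' W s x y = capacity c ph x y \<and>
       entry ''eo'' W s x y = edge_cell ph x y)"
proof -
  let ?F = "\<lambda>s. env_net c s \<and> reg s ''ph'' = ph \<and> reg s ''pT'' = ph * duration"
  let ?I = "\<lambda>x y s. filled W (arr s ''cap'') (capacity c ph) x y \<and>
      filled W (arr s ''r'') (capacity c ph) x y \<and> filled W (arr s ''eo'') (edge_cell ph) x y"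
  note b = W_bounds[OF tot]
  have row: "hoare bound (\<lambda>s. ?F s \<and> ?I x 0 s \<and> reg s ''x'' = x) (For ''y'' (Var ''W'') build_cell) (?I (Suc x) 0)"
    if "x < W" for x
  proof (rule hoare_For_wp[where F = "\<lambda>s. env_net c s \<and> reg s ''ph'' = ph \<and> reg s ''pT'' = ph * duration \<and> reg s ''x'' = x"
        and N = W and I = "?I x"], goal_cases)
    case (2)
    show ?case by (rule stable_env_net) (simp_all add: stable_simps)
  next
    case (8 y s)
    then show ?case using that tot ph by (intro build_cell_correct) simp_all
  qed (use b in \<open>simp_all add: filled_row env_net_regs[of c]\<close>)
  show ?thesis unfolding build_def
  proof (rule hoare_For_conseq[where F = ?F and N = W and I = "\<lambda>x. ?I x 0"], goal_cases)
    case 2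
    show ?case by (rule stable_env_net) (simp_all add: stable_simps)
  next
    case (7 x)
    show ?case by (rule row[OF 7])
  next
    case (8 s)
    then show ?case using filledD[of W _ _ W] by (simp add: entry_def)
  qed (use b in \<open>simp_all add: env_net_regs[of c]\<close>)
qed

text \<open>Phase 0 leaves open which initial holder is chosen; feasibility is shown for every
  choice.\<close>

definition dest_ok :: "(nat \<Rightarrow> nat) \<Rightarrow> nat \<Rightarrow> (nat \<Rightarrow> nat) \<Rightarrow> bool" where
  "dest_ok c ph dn \<longleftrightarrow>
     (if ph = 0 then \<forall>i<k. dn i < n \<and> (dn i, i) \<in> init I
      else \<forall>p<n * k. dn p = (if p div k \<in> level c ph then p div k else 0))"

definition has_packets :: "(nat \<Rightarrow> nat) \<Rightarrow> nat \<Rightarrow> state \<Rightarrow> bool" where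
  "has_packets c ph s \<longleftrightarrow> reg s ''P'' = packets ph \<and> (\<forall>p<packets ph. arr s ''tok'' p = p mod k) \<and>
     (\<exists>dn. dest_ok c ph dn \<and> (\<forall>p<packets ph. arr s ''dest'' p = duration * n + dn p))"

lemma gather_packets_correct:
  assumes tot: "total \<le> n * k"
  shows "hoare bound (env_net c) gather_packets (has_packets c 0)"
proof -
  note b = W_bounds[OF tot]
  have b': "n \<le> bound" "k \<le> bound" by (simp_all add: bound_def length_input)
  let ?ok = "\<lambda>j s. \<forall>i<j. arr s ''tok'' i = i \<and> (\<exists>h. h < n \<and> (h, i) \<in> init I \<and> arr s ''dest'' i = duration * n + h)"
  let ?h = "\<lambda>i u s. reg s ''h'' < n \<and> ((\<exists>v<u. (v, i) \<in> init I) \<longrightarrow> (reg s ''h'', i) \<in> init I)"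
  let ?F = "\<lambda>i s. env_net c s \<and> reg s ''i'' = i \<and> ?ok i s"
  let ?inner = "For ''u'' (Var ''n'')
          (Cond (BLess (Const 0) (Read ''input'' (Plus (Var ''ib'') (Plus (Read ''muk'' (Var ''u'')) (Var ''i'')))))
            (Assign ''h'' (Var ''u'')) Skip)"
  note E = env_regs[OF env_net_env[of c]]
  have inner: "hoare bound (\<lambda>s. ?F i s \<and> reg s ''h'' = 0) ?inner (\<lambda>s. ?F i s \<and> ?h i n s)" if i: "i < k" for i
  proof (rule hoare_For_wp[where F = "?F i" and N = n and I = "?h i"], goal_cases)
    case 2
    show ?case by (rule stable_env_net) (simp_all add: stable_simps)
  next
    case (8 u s)
    have "arr s ''input'' (n + k + 2 + (u * k + i)) = of_bool ((u, i) \<in> init I)"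
      by (rule env_init[OF env_net_env[of c]]) (use 8 i in simp_all)
    then show ?case using 8 i by (cases "(u, i) \<in> init I") (auto simp: E less_Suc_eq)
  qed (use b' n_pos in \<open>simp_all add: E\<close>)
  have body: "hoare bound (\<lambda>s. env_net c s \<and> ?ok i s \<and> reg s ''i'' = i)
     (Assign ''h'' (Const 0) ;; ?inner ;;
        Store ''dest'' (Var ''i'') (Plus (Read ''mun'' (Var ''T'')) (Var ''h'')) ;;
        Store ''tok'' (Var ''i'') (Var ''i'')) (?ok (Suc i))" if i: "i < k" for i
  proof (rule hoare_Seq_frame[where F = "?F i", OF hoare_wp _ hoare_Seq[OF hoare_pre[OF inner[OF i]] hoare_wp]])
    show "stable (?F i) (written_regs (Assign ''h'' (Const 0))) (written_arrs (Assign ''h'' (Const 0)))"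
      by (rule stable_env_net) (simp_all add: stable_simps)
    show "wp (Assign ''h'' (Const 0)) (\<lambda>s. reg s ''h'' = 0) s" if True for s by simp
    fix s assume s: "?F i s \<and> ?h i n s"
    obtain u where "u < n" "(u, i) \<in> init I" using gossip i by (auto simp: gossip_instance_def)
    then have "(reg s ''h'', i) \<in> init I" "reg s ''h'' < n" using s by auto
    then show "wp (Store ''dest'' (Var ''i'') (Plus (Read ''mun'' (Var ''T'')) (Var ''h'')) ;;
        Store ''tok'' (Var ''i'') (Var ''i'')) (?ok (Suc i)) s"
      using s b by (simp add: E All_less_Suc)
  qed simp_all
  have loop: "hoare bound (env_net c) (For ''i'' (Var ''k'') (Assign ''h'' (Const 0) ;; ?inner ;;
        Store ''dest'' (Var ''i'') (Plus (Read ''mun'' (Var ''T'')) (Var ''h'')) ;;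
        Store ''tok'' (Var ''i'') (Var ''i''))) (\<lambda>s. env_net c s \<and> True \<and> ?ok k s)"
  proof (rule hoare_For_conseq[where F = "\<lambda>s. env_net c s \<and> True" and N = k and I = ?ok], goal_cases)
    case 2
    show ?case by (rule stable_env_net) (simp_all add: stable_simps)
  next
    case (7 i)
    show ?case by (rule hoare_pre[OF body[OF 7]]) simp
  qed (use b' in \<open>simp_all add: E\<close>)
  have "has_packets c 0 (set_reg ''P'' k s)" if "?ok k s" for s
  proof -
    from that obtain dn where "\<forall>i<k. dn i < n \<and> (dn i, i) \<in> init I \<and> arr s ''dest'' i = duration * n + dn i"
      by metis
    then show ?thesis using that by (auto simp: has_packets_def packets_def dest_ok_def)
  qed
  then show ?thesis unfolding gather_packets_def
    by (intro hoare_Seq[OF loop] hoare_Assign) (simp add: E)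
qed

lemma spread_packets_correct:
  assumes tot: "total \<le> n * k" and ph: "0 < ph" "ph \<le> last_phase"
  shows "hoare bound (\<lambda>s. env_net c s \<and> reg s ''ph'' = ph) spread_packets (has_packets c ph)"
proof -
  note b = W_bounds[OF tot]
  have b': "n \<le> bound" "k \<le> bound" by (simp_all add: bound_def length_input)
  have phl: "ph < length input"
  proof -
    have "ph \<le> Suc last_phase * 1" using ph by simp
    also have "\<dots> \<le> total" unfolding total_def using duration_pos by (intro mult_le_mono2) simp
    also note tot
    also note nk_less_length
    finally show ?thesis .
  qed
  let ?dn = "\<lambda>v. if v \<in> level c ph then v else 0"
  let ?f = "\<lambda>v i. duration * n + ?dn v" and ?g = "\<lambda>v i. i"
  let ?I = "\<lambda>v i s. filled k (arr s ''dest'') ?f v i \<and> filled k (arr s ''tok'') ?g v i"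
  note E = env_regs[OF env_net_env[of c]]
  let ?body = "Assign ''d'' (Const 0) ;;
          Cond (BLess (Const 0) (Read ''mem'' (Plus (Read ''mun'' (Var ''ph'')) (Var ''v'')))) (Assign ''d'' (Var ''v'')) Skip ;;
          Store ''dest'' (Plus (Read ''muk'' (Var ''v'')) (Var ''i'')) (Plus (Read ''mun'' (Var ''T'')) (Var ''d'')) ;;
          Store ''tok'' (Plus (Read ''muk'' (Var ''v'')) (Var ''i'')) (Var ''i'')"
  have row: "hoare bound (\<lambda>s. (env_net c s \<and> reg s ''ph'' = ph) \<and> ?I v 0 s \<and> reg s ''v'' = v)
     (For ''i'' (Var ''k'') (?body)) (?I (Suc v) 0)" if v: "v < n" for v
  proof (rule hoare_For_wp[where F = "\<lambda>s. env_net c s \<and> reg s ''ph'' = ph \<and> reg s ''v'' = v" and N = k and I = "?I v"], goal_cases)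
    case 2
    show ?case by (rule stable_env_net) (simp_all add: stable_simps)
  next
    case (8 i s)
    have mem: "arr s ''mem'' (ph * n + v) = of_bool (v \<in> level c ph)"
      by (rule env_net_regs[of c]) (use 8 v ph in simp_all)
    have "filled k ((arr s ''dest'')(v * k + i := duration * n + ?dn v)) ?f v (Suc i)"
      "filled k ((arr s ''tok'')(v * k + i := i)) ?g v (Suc i)"
      using 8 filled_upd[of k "arr s ''dest''" ?f v i] filled_upd[of k "arr s ''tok''" ?g v i] by simp_all
    then show ?case using 8 v phl b mem
      by (cases "v \<in> level c ph") (simp_all add: E)
  qed (use b' in \<open>simp_all add: E filled_row\<close>)
  have loop: "hoare bound (\<lambda>s. env_net c s \<and> reg s ''ph'' = ph) (For ''v'' (Var ''n'') (For ''i'' (Var ''k'') (?body)))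
      (\<lambda>s. (env_net c s \<and> reg s ''ph'' = ph) \<and> ?I n 0 s)"
  proof (rule hoare_For_conseq[where F = "\<lambda>s. env_net c s \<and> reg s ''ph'' = ph" and N = n and I = "\<lambda>v. ?I v 0"], goal_cases)
    case 2
    show ?case by (rule stable_env_net) (simp_all add: stable_simps)
  next
    case (7 v)
    show ?case by (rule row[OF 7])
  qed (use b' in \<open>simp_all add: E\<close>)
  have "has_packets c ph (set_reg ''P'' (n * k) s)" if "?I n 0 s" for s
  proof -
    have pd: "p div k < n" "p mod k < k" if "p < n * k" for p
    proof -
      have "0 < k" using that by (cases "k = 0") simp_all
      then show "p div k < n" "p mod k < k" using that by (simp_all add: less_mult_imp_div_less)
    qed
    have "arr s ''dest'' p = duration * n + ?dn (p div k)" "arr s ''tok'' p = p mod k" if "p < n * k" for p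
      using filledD[of k "arr s ''dest''" ?f n "p div k" "p mod k"] filledD[of k "arr s ''tok''" ?g n "p div k" "p mod k"]
        \<open>?I n 0 s\<close> pd[OF that] by simp_all
    then show ?thesis using ph
      by (auto simp: has_packets_def packets_def dest_ok_def intro!: exI[of _ "\<lambda>p. ?dn (p div k)"])
  qed
  then show ?thesis unfolding spread_packets_def
    by (intro hoare_Seq[OF loop] hoare_Assign) (simp add: E)
qed

lemma make_packets_correct:
  assumes tot: "total \<le> n * k" and ph: "ph \<le> last_phase"
  shows "hoare bound (\<lambda>s. env_net c s \<and> reg s ''ph'' = ph) make_packets (has_packets c ph)"
  unfolding make_packets_def
proof (rule hoare_Cond, goal_cases)
  case 1
  show ?case
  proof (cases "ph = 0")
    case True
    show ?thesis unfolding True by (rule hoare_pre[OF gather_packets_correct[OF tot]]) simp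
  qed (auto intro: hoare_False)
next
  case 2
  show ?case
  proof (cases "ph = 0")
    case False
    then show ?thesis by (intro hoare_pre[OF spread_packets_correct[OF tot _ ph]]) simp_all
  qed (auto intro: hoare_False)
qed

end

subsection \<open>Tracing the packets back to the source\<close>

text \<open>The test detects an arc on which flow arrives at \<open>y\<close>: the net flow from
  \<open>y\<close> to \<open>x\<close> is \<open>cap y x - r y x\<close>, here negative.\<close>

definition select_next :: com where
  "select_next =
     Assign ''z'' (Const 0) ;;
     For ''x'' (Var ''W'')
       (Cond (BLess (Read ''cap'' (Plus (Read ''muW'' (Var ''y'')) (Var ''x'')))
                    (Read ''r'' (Plus (Read ''muW'' (Var ''y'')) (Var ''x''))))
         (Assign ''z'' (Var ''x'')) Skip)"

text \<open>Going back over an arc cancels one unit of its flow, which is a push against it. At the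
  test, \<open>e\<close> is the index of the arc from \<open>z\<close> to \<open>y\<close>, whose
  cell receives the token.\<close>

definition move_packet :: com where
  "move_packet =
     Assign ''e'' (Plus (Read ''muW'' (Var ''y'')) (Var ''z'')) ;;
     Store ''r'' (Var ''e'') (Minus (Read ''r'' (Var ''e'')) (Const 1)) ;;
     Assign ''e'' (Plus (Read ''muW'' (Var ''z'')) (Var ''y'')) ;;
     Store ''r'' (Var ''e'') (Plus (Read ''r'' (Var ''e'')) (Const 1)) ;;
     Cond (BLess (Const 0) (Read ''eo'' (Var ''e'')))
       (Store ''output'' (Minus (Read ''eo'' (Var ''e'')) (Const 1)) (Plus (Read ''tok'' (Var ''p'')) (Const 1)))
       Skip ;;
     Assign ''y'' (Var ''z'')"

text \<open>\<open>T\<close> steps pass the layers, and one more enters the source.\<close>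

definition trace :: com where
  "trace =
     For ''p'' (Var ''P'')
       (Assign ''y'' (Read ''dest'' (Var ''p'')) ;;
        For ''t'' (Plus (Var ''T'') (Const 1)) (select_next ;; move_packet))"

definition phase :: com where
  "phase = build ;; make_packets ;; flow ;; Cond (BEq (Var ''fail'') (Const 0)) trace Skip"

lemma written_trace [simp]:
  "written_regs select_next = {''x'', ''z''}" "written_arrs select_next = {}"
  "written_regs move_packet = {''e'', ''y''}" "written_arrs move_packet = {''output'', ''r''}"
  "written_regs trace = {''e'', ''p'', ''t'', ''x'', ''y'', ''z''}" "written_arrs trace = {''output'', ''r''}"
  by (simp_all add: select_next_def move_packet_def trace_def set_eq_subset)

lemma written_phase [simp]:
  "written_regs phase = {''P'', ''c'', ''d'', ''e'', ''fail'', ''h'', ''i'', ''o'', ''p'', ''rd'', ''t'', ''tail'', ''u'', ''v'', ''x'', ''y'', ''z''}"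
  "written_arrs phase = {''cap'', ''dest'', ''eo'', ''mark'', ''nxt'', ''output'', ''queue'', ''r'', ''tok''}"
  by (simp_all add: phase_def set_eq_subset)

section \<open>Decomposition of the flow into walks\<close>

context gossip_locale
begin

lemma round_of_inj: "t < duration \<Longrightarrow> t' < duration \<Longrightarrow> round_of ph t = round_of ph t' \<longleftrightarrow> t = t'"
  by (auto simp: round_of_def)

lemma cell_inj:
  assumes "t < duration" "u < n" "v < n" "t' < duration" "u' < n" "v' < n"
  shows "cell ph t u v = cell ph t' u' v' \<longleftrightarrow> t = t' \<and> u = u' \<and> v = v'"
  using assms by (auto simp: cell_def index_eq_iff round_of_inj)

definition walk_ok :: "nat \<Rightarrow> (nat \<Rightarrow> nat) \<Rightarrow> nat \<Rightarrow> (nat \<Rightarrow> nat) \<Rightarrow> nat \<Rightarrow> bool" where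
  "walk_ok ph out p w t \<longleftrightarrow> w t = w (Suc t) \<or>
     (w t, w (Suc t)) \<in> phase_graph ph t \<and> out (cell ph t (w t) (w (Suc t))) = Suc (p mod k)"

text \<open>
  The state after \<open>\<tau>\<close> backward steps of packet \<open>p\<close>, which are now at vertex \<open>y\<close>.  An edge with a token
  written for it carries no more flow, so that it is not used a second time.
\<close>

definition written_ok ::
  "nat \<Rightarrow> (nat \<Rightarrow> nat \<Rightarrow> nat) \<Rightarrow> (nat \<Rightarrow> nat \<Rightarrow> nat) \<Rightarrow> (nat \<Rightarrow> nat \<Rightarrow> nat) \<Rightarrow> (nat \<Rightarrow> nat) \<Rightarrow> nat \<Rightarrow> nat \<Rightarrow> nat \<Rightarrow> bool" where
  "written_ok ph cap r \<pi> out p b t \<longleftrightarrow> (\<forall>u<n. \<forall>v<n. out (cell ph t u v) \<noteq> 0 \<longrightarrow>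
     cap (t * n + u) (Suc t * n + v) \<le> r (t * n + u) (Suc t * n + v) \<and>
     (\<exists>p'\<le>p. (p' = p \<longrightarrow> b \<le> t) \<and> \<pi> p' t = u \<and> \<pi> p' (Suc t) = v \<and> u \<noteq> v \<and> out (cell ph t u v) = Suc (p' mod k)))"

text \<open>While packet \<open>p\<close> is traced, the flow serves the later packets and one
  further unit demanded at the current vertex \<open>y\<close>. The walk is known from time
  \<open>duration - \<tau>\<close> on; the last step leads into the source and thereby shows that
  the walk starts in the source level. \<open>out0\<close> is the output before the phase, so that
  cells of other phases are seen to be untouched.\<close>

definition trace_inv where
  "trace_inv c ph dn dest out0 p \<tau> y r out \<longleftrightarrow>
     residual W (capacity c ph) r \<and> y < W \<and>
     (\<forall>z<W. z \<noteq> src \<longrightarrow> out_sum W r z = out_sum W (capacity c ph) z + demand dest {Suc p..<packets ph} z + of_bool (z = y)) \<and>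
     (\<exists>\<pi>. (\<forall>p'<p. \<pi> p' 0 \<in> level c (ph - 1) \<and> \<pi> p' duration = dn p' \<and> (\<forall>t<duration. walk_ok ph out p' (\<pi> p') t)) \<and>
        \<pi> p duration = dn p \<and> (\<forall>t<duration. duration - \<tau> \<le> t \<longrightarrow> walk_ok ph out p (\<pi> p) t) \<and>
        (if \<tau> \<le> duration then y = (duration - \<tau>) * n + \<pi> p (duration - \<tau>) \<and> \<pi> p (duration - \<tau>) < n
         else y = src \<and> \<pi> p 0 \<in> level c (ph - 1)) \<and>
        (\<forall>t<duration. written_ok ph (capacity c ph) r \<pi> out p (duration - \<tau>) t)) \<and>
     (\<forall>i. out i \<noteq> out0 i \<longrightarrow> (\<exists>t<duration. \<exists>u<n. \<exists>v<n. i = cell ph t u v))"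

definition trace_done where
  "trace_done c ph dn dest out0 p r out \<longleftrightarrow>
     residual W (capacity c ph) r \<and>
     (\<forall>z<W. z \<noteq> src \<longrightarrow> out_sum W r z = out_sum W (capacity c ph) z + demand dest {p..<packets ph} z) \<and>
     (\<exists>\<pi>. (\<forall>p'<p. \<pi> p' 0 \<in> level c (ph - 1) \<and> \<pi> p' duration = dn p' \<and> (\<forall>t<duration. walk_ok ph out p' (\<pi> p') t)) \<and>
        (\<forall>t<duration. written_ok ph (capacity c ph) r \<pi> out p duration t)) \<and>
     (\<forall>i. out i \<noteq> out0 i \<longrightarrow> (\<exists>t<duration. \<exists>u<n. \<exists>v<n. i = cell ph t u v))"

text \<open>Tracing lowers residuals only on arcs that point back in time or to the source. Hence a
  graph edge without flow stays without flow, which protects the cells already written.\<close>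

lemma shift_grow:
  assumes "\<not> (a = x \<and> b = y)"
  shows "r a b \<le> shift x y r a b"
proof -
  have "m \<le> (if Q then m + 1 else m)" for m :: nat and Q by simp
  then show ?thesis unfolding shift_def if_not_P[OF assms] .
qed

lemma trace_start:
  assumes "trace_done c ph dn dest out0 p r out" "p < packets ph" "dest p = duration * n + dn p" "dn p < n"
  shows "trace_inv c ph dn dest out0 p 0 (dest p) r out"
proof -
  obtain \<pi> where \<pi>: "\<And>p'. p' < p \<Longrightarrow> \<pi> p' 0 \<in> level c (ph - 1) \<and> \<pi> p' duration = dn p' \<and> (\<forall>t<duration. walk_ok ph out p' (\<pi> p') t)"
      "\<And>t. t < duration \<Longrightarrow> written_ok ph (capacity c ph) r \<pi> out p duration t"
    using assms(1) unfolding trace_done_def by blast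
  \<comment> \<open>Only the value at time \<open>duration\<close> matters as yet; earlier values
    are replaced step by step.\<close>
  let ?\<pi> = "\<pi>(p := \<lambda>_. dn p)"
  have w: "written_ok ph (capacity c ph) r ?\<pi> out p duration t" if t: "t < duration" for t
    unfolding written_ok_def
  proof (intro allI impI)
    fix u v assume "u < n" "v < n" "out (cell ph t u v) \<noteq> 0"
    then obtain p' where "capacity c ph (t * n + u) (Suc t * n + v) \<le> r (t * n + u) (Suc t * n + v)"
      "p' \<le> p" "p' = p \<longrightarrow> duration \<le> t" "\<pi> p' t = u" "\<pi> p' (Suc t) = v" "u \<noteq> v" "out (cell ph t u v) = Suc (p' mod k)"
      using \<pi>(2)[OF t] unfolding written_ok_def by blast
    moreover have "p' \<noteq> p" using calculation(3) t by auto
    ultimately show "capacity c ph (t * n + u) (Suc t * n + v) \<le> r (t * n + u) (Suc t * n + v) \<and>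
      (\<exists>p'\<le>p. (p' = p \<longrightarrow> duration \<le> t) \<and> ?\<pi> p' t = u \<and> ?\<pi> p' (Suc t) = v \<and> u \<noteq> v \<and> out (cell ph t u v) = Suc (p' mod k))"
      by (intro conjI exI[of _ p']) simp_all
  qed
  have "dest p < src" using index_less[of duration duration "dn p" n] assms(3,4) by (simp add: src_def)
  then have "dest p < W" by (simp add: W_def)
  moreover have "out_sum W r z = out_sum W (capacity c ph) z + demand dest {Suc p..<packets ph} z + of_bool (z = dest p)"
    if "z < W" "z \<noteq> src" for z
    using assms(1) that demand_atLeastLessThan[OF assms(2), of dest z] by (simp add: trace_done_def)
  ultimately show ?thesis unfolding trace_inv_def
    using assms(1,3,4) w \<pi>(1) by (intro conjI exI[of _ ?\<pi>]) (simp_all add: trace_done_def)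
qed

lemma trace_finish:
  assumes "trace_inv c ph dn dest out0 p (Suc duration) y r out"
  shows "trace_done c ph dn dest out0 (Suc p) r out"
proof -
  obtain \<pi> where \<pi>: "\<And>p'. p' < p \<Longrightarrow> \<pi> p' 0 \<in> level c (ph - 1) \<and> \<pi> p' duration = dn p' \<and> (\<forall>t<duration. walk_ok ph out p' (\<pi> p') t)"
    "\<pi> p duration = dn p" "\<And>t. t < duration \<Longrightarrow> walk_ok ph out p (\<pi> p) t" "y = src" "\<pi> p 0 \<in> level c (ph - 1)"
    "\<And>t. t < duration \<Longrightarrow> written_ok ph (capacity c ph) r \<pi> out p 0 t"
    using assms by (auto simp: trace_inv_def)
  have w: "written_ok ph (capacity c ph) r \<pi> out (Suc p) duration t" if t: "t < duration" for t
    unfolding written_ok_def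
  proof (intro allI impI)
    fix u v assume "u < n" "v < n" "out (cell ph t u v) \<noteq> 0"
    then obtain p' where "capacity c ph (t * n + u) (Suc t * n + v) \<le> r (t * n + u) (Suc t * n + v)"
      "p' \<le> p" "\<pi> p' t = u" "\<pi> p' (Suc t) = v" "u \<noteq> v" "out (cell ph t u v) = Suc (p' mod k)"
      using \<pi>(6)[OF t] unfolding written_ok_def by blast
    then show "capacity c ph (t * n + u) (Suc t * n + v) \<le> r (t * n + u) (Suc t * n + v) \<and>
      (\<exists>p'\<le>Suc p. (p' = Suc p \<longrightarrow> duration \<le> t) \<and> \<pi> p' t = u \<and> \<pi> p' (Suc t) = v \<and> u \<noteq> v \<and> out (cell ph t u v) = Suc (p' mod k))"
      by (intro conjI exI[of _ p']) simp_all
  qed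
  have "\<forall>p'<Suc p. \<pi> p' 0 \<in> level c (ph - 1) \<and> \<pi> p' duration = dn p' \<and> (\<forall>t<duration. walk_ok ph out p' (\<pi> p') t)"
    using \<pi>(1,2,3,5) by (simp add: All_less_Suc)
  moreover have "out_sum W r z = out_sum W (capacity c ph) z + demand dest {Suc p..<packets ph} z" if "z < W" "z \<noteq> src" for z
    using assms that \<pi>(4) by (simp add: trace_inv_def)
  ultimately show ?thesis unfolding trace_done_def
    using assms w by (intro conjI exI[of _ \<pi>]) (simp_all add: trace_inv_def)
qed

lemma trace_y_less: "trace_inv c ph dn dest out0 p \<tau> y r out \<Longrightarrow> \<tau> \<le> duration \<Longrightarrow> y < src"
  using index_less[of "duration - \<tau>" duration _ n] by (auto simp: trace_inv_def src_def)

text \<open>A unit is still demanded at \<open>y\<close>, so its residuals sum to more than its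
  capacities and one of them must exceed its capacity.\<close>

lemma trace_continues:
  assumes inv: "trace_inv c ph dn dest out0 p \<tau> y r out" and \<tau>: "\<tau> \<le> duration"
  shows "\<exists>x<W. capacity c ph y x < r y x"
proof (rule ccontr)
  assume "\<not> ?thesis"
  then have "r y x \<le> capacity c ph y x" if "x < W" for x
    using that by (meson not_less)
  then have "out_sum W r y \<le> out_sum W (capacity c ph) y"
    unfolding out_sum_def by (intro sum_mono) simp
  moreover have "y < src" by (rule trace_y_less[OF inv \<tau>])
  ultimately show False using inv by (simp add: trace_inv_def)
qed

text \<open>Flow enters \<open>y\<close> only over arcs of positive capacity, and these come from
  the previous layer or from the source. So every step goes back by exactly one layer and cycles
  cannot occur.\<close>

lemma trace_step:
  assumes inv: "trace_inv c ph dn dest out0 p \<tau> y r out" and \<tau>: "\<tau> \<le> duration"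
    and z: "z < W" "capacity c ph y z < r y z"
    and r': "\<And>a b. a < W \<Longrightarrow> b < W \<Longrightarrow> r' a b = shift y z r a b"
    and out': "out' = (if 0 < edge_cell ph z y then out(edge_cell ph z y - 1 := Suc (p mod k)) else out)"
  shows "trace_inv c ph dn dest out0 p (Suc \<tau>) z r' out'" "y \<noteq> z"
proof -
  let ?cap = "capacity c ph"
  have y: "y < src" "y < W" using trace_y_less[OF inv \<tau>] by (simp_all add: W_def)
  have res: "residual W ?cap r" using inv by (simp add: trace_inv_def)
  have zy: "r z y < ?cap z y"
  proof -
    have "r y z + r z y = ?cap y z + ?cap z y" using res z(1) y(2) by (simp add: residual_def)
    then show ?thesis using z(2) by linarith
  qed
  have zs: "z \<le> Suc duration * n" using z by (simp add: W_def src_def)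
  have "0 < expanded n duration (n * k) (level c (ph - 1)) (phase_graph ph) z y" using zy by (simp add: capacity_def)
  note pos = expanded_pos[OF this zs n_pos]
  obtain \<pi> where \<pi>: "\<And>p'. p' < p \<Longrightarrow> \<pi> p' 0 \<in> level c (ph - 1) \<and> \<pi> p' duration = dn p' \<and> (\<forall>t<duration. walk_ok ph out p' (\<pi> p') t)"
    "\<pi> p duration = dn p" "\<And>t. t < duration \<Longrightarrow> duration - \<tau> \<le> t \<Longrightarrow> walk_ok ph out p (\<pi> p) t"
    "y = (duration - \<tau>) * n + \<pi> p (duration - \<tau>)" "\<pi> p (duration - \<tau>) < n"
    "\<And>t. t < duration \<Longrightarrow> written_ok ph ?cap r \<pi> out p (duration - \<tau>) t"
    using inv \<tau> by (auto simp: trace_inv_def)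
  have frame: "\<And>i. out i \<noteq> out0 i \<Longrightarrow> \<exists>t<duration. \<exists>u<n. \<exists>v<n. i = cell ph t u v"
    using inv by (simp add: trace_inv_def)
  consider (layer) t u v where "t < duration" "u < n" "v < n" "z = t * n + u" "y = Suc t * n + v" "u = v \<or> (u, v) \<in> phase_graph ph t"
    | (source) "z = src" "y < n" "y \<in> level c (ph - 1)"
    using pos by (auto simp: src_def)
  note cases = this
  have ne: "y \<noteq> z"
    using cases by cases (use y n_pos in auto)
  then show "y \<noteq> z" .
  have grow: "r (t' * n + u') (Suc t' * n + v') \<le> r' (t' * n + u') (Suc t' * n + v')"
    if "t' < duration" "u' < n" "v' < n" for t' u' v'
  proof -
    let ?a = "t' * n + u'" and ?b = "Suc t' * n + v'"
    have ab: "?a < src" "?b < src"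
      using index_less[of t' duration u' n] index_less[of "Suc t'" duration v' n] that by (simp_all add: src_def)
    then have abW: "?a < W" "?b < W" by (simp_all add: W_def)
    have "\<not> (?a = y \<and> ?b = z)"
    proof
      assume eq: "?a = y \<and> ?b = z"
      show False using cases
      proof cases
        case (layer t u v)
        then have "t' = Suc t" "Suc t' = t"
          using eq index_eq_iff[of u' n v t' "Suc t"] index_eq_iff[of v' n u "Suc t'" t] that by auto
        then show False by simp
      next
        case source
        then have "?b = src" using eq by blast
        then show False using ab(2) by (simp only: less_irrefl)
      qed
    qed
    then show ?thesis unfolding r'[OF abW] by (rule shift_grow)
  qed
  have res': "residual W ?cap r'"
    using residual_shift[of W ?cap r y z] res z ne residual_cong[of W r' "shift y z r"] r' by simp
  have sums: "out_sum W r' w = out_sum W ?cap w + demand dest {Suc p..<packets ph} w + of_bool (w = z)"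
    if "w < W" "w \<noteq> src" for w
  proof -
    have "out_sum W r' w = out_sum W (shift y z r) w" using r' that(1) by (rule out_sum_cong)
    moreover have "out_sum W (shift y z r) w + of_bool (w = y) = out_sum W r w + of_bool (w = z)"
      using z ne y(2) by (intro out_sum_shift) simp_all
    moreover have "out_sum W r w = out_sum W ?cap w + demand dest {Suc p..<packets ph} w + of_bool (w = y)"
      using inv that by (simp add: trace_inv_def)
    ultimately show ?thesis by linarith
  qed
  show "trace_inv c ph dn dest out0 p (Suc \<tau>) z r' out'"
    using cases
  proof cases
    case source
    have "(duration - \<tau>) * n + \<pi> p (duration - \<tau>) = 0 * n + y" using \<pi>(4) by simp
    then have "duration - \<tau> = 0" "\<pi> p (duration - \<tau>) = y"
      using index_eq_iff[OF \<pi>(5) source(2), of "duration - \<tau>" 0] by auto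
    then have \<tau>T: "\<tau> = duration" "\<pi> p 0 = y" using \<tau> by simp_all
    have "edge_cell ph z y = 0" using source(1) by (simp add: edge_cell_def)
    then have out: "out' = out" using out' by simp
    have "written_ok ph ?cap r' \<pi> out p 0 t" if t: "t < duration" for t
      unfolding written_ok_def
    proof (intro allI impI)
      fix u v assume uv: "u < n" "v < n" "out (cell ph t u v) \<noteq> 0"
      have "?cap (t * n + u) (Suc t * n + v) \<le> r (t * n + u) (Suc t * n + v) \<and>
        (\<exists>p'\<le>p. (p' = p \<longrightarrow> duration - \<tau> \<le> t) \<and> \<pi> p' t = u \<and> \<pi> p' (Suc t) = v \<and> u \<noteq> v \<and> out (cell ph t u v) = Suc (p' mod k))"
        using \<pi>(6)[OF t] uv unfolding written_ok_def by blast
      then show "?cap (t * n + u) (Suc t * n + v) \<le> r' (t * n + u) (Suc t * n + v) \<and>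
        (\<exists>p'\<le>p. (p' = p \<longrightarrow> 0 \<le> t) \<and> \<pi> p' t = u \<and> \<pi> p' (Suc t) = v \<and> u \<noteq> v \<and> out (cell ph t u v) = Suc (p' mod k))"
        using order_trans[OF _ grow[OF t uv(1,2)]] by blast
    qed
    then show ?thesis unfolding trace_inv_def out
      using res' z sums frame \<pi>(1,2,3) \<tau>T source by (intro conjI exI[of _ \<pi>]) simp_all
  next
    case (layer t u v)
    have "duration - \<tau> = Suc t \<and> \<pi> p (duration - \<tau>) = v"
      using index_eq_iff[OF \<pi>(5) layer(3), of "duration - \<tau>" "Suc t"] \<pi>(4) layer(5) by simp
    then have \<tau>t: "duration - \<tau> = Suc t" "\<pi> p (Suc t) = v" "duration - Suc \<tau> = t" "Suc \<tau> \<le> duration"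
      by auto
    let ?\<pi> = "\<pi>(p := (\<pi> p)(t := u))"
    let ?i = "cell ph t u v"
    have cap: "?cap z y = (if u = v then n * k else of_bool ((u, v) \<in> phase_graph ph t))"
      unfolding capacity_def layer(4,5) by (rule expanded_step) (use layer in simp_all)
    have divs: "z div n = t" "z mod n = u" "y div n = Suc t" "y mod n = v"
      using layer(2,3) unfolding layer(4,5) by (simp_all del: mult_Suc)
    have zs': "z < src" using index_less[of t duration u n] layer by (simp add: src_def)
    have ec: "edge_cell ph z y = (if u = v then 0 else Suc ?i)"
      using zs' y(1) divs layer(6) by (auto simp: edge_cell_def)
    \<comment> \<open>An edge whose cell is written carries no flow any more, whereas the selected
      arc carries some.\<close>
    have fresh: "out ?i = 0" if "u \<noteq> v"
    proof (rule ccontr)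
      assume "out ?i \<noteq> 0"
      then have "?cap z y \<le> r z y"
        using \<pi>(6)[OF layer(1)] layer(2,3) unfolding written_ok_def layer(4,5) by blast
      then show False using zy by simp
    qed
    have o: "out' j = (if u \<noteq> v \<and> j = ?i then Suc (p mod k) else out j)" for j
      using out' ec by simp
    have keep: "out' j = out j" if "out j \<noteq> 0" for j
      using o[of j] fresh that by auto
    have walk: "walk_ok ph out' p' w t'" if "walk_ok ph out p' w t'" for p' w t'
      using that keep[of "cell ph t' (w t') (w (Suc t'))"] by (auto simp: walk_ok_def)
    have new_walk: "walk_ok ph out' p (?\<pi> p) t'" if "t' < duration" "t \<le> t'" for t'
    proof (cases "t' = t")
      case True
      show ?thesis unfolding True walk_ok_def using \<tau>t(2) layer(6) o[of ?i] by auto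
    next
      case False
      then have "walk_ok ph out p (\<pi> p) t'" using \<pi>(3)[of t'] that \<tau>t(1) by simp
      from walk[OF this] show ?thesis using False that by (simp add: walk_ok_def)
    qed
    have wr: "written_ok ph ?cap r' ?\<pi> out' p t t'" if t': "t' < duration" for t'
      unfolding written_ok_def
    proof (intro allI impI)
      fix u' v' assume uv': "u' < n" "v' < n" and nz: "out' (cell ph t' u' v') \<noteq> 0"
      let ?a = "t' * n + u'" and ?b = "Suc t' * n + v'"
      show "?cap ?a ?b \<le> r' ?a ?b \<and> (\<exists>p'\<le>p. (p' = p \<longrightarrow> t \<le> t') \<and> ?\<pi> p' t' = u' \<and> ?\<pi> p' (Suc t') = v' \<and> u' \<noteq> v' \<and>
          out' (cell ph t' u' v') = Suc (p' mod k))"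
      proof (cases "u \<noteq> v \<and> cell ph t' u' v' = ?i")
        case True
        then have eq: "t' = t" "u' = u" "v' = v" "u \<noteq> v"
          using cell_inj[OF t' uv' layer(1-3)] by auto
        \<comment> \<open>Here unit capacity matters: cancelling one unit exhausts the edge, and no
          later packet can claim its cell.\<close>
        have "?cap z y \<le> 1" using eq(4) cap by simp
        moreover have "r' z y = Suc (r z y)" using r'[OF z(1) y(2)] ne by (simp add: shift_def)
        ultimately have "?cap ?a ?b \<le> r' ?a ?b" unfolding eq layer(4,5)[symmetric] by simp
        then show ?thesis using eq \<tau>t(2) o[of ?i] by (intro conjI exI[of _ p]) simp_all
      next
        case False
        then have out: "out' (cell ph t' u' v') = out (cell ph t' u' v')" using o by auto
        then obtain p' where p': "?cap ?a ?b \<le> r ?a ?b" "p' \<le> p" "p' = p \<longrightarrow> Suc t \<le> t'" "\<pi> p' t' = u'" "\<pi> p' (Suc t') = v'"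
          "u' \<noteq> v'" "out (cell ph t' u' v') = Suc (p' mod k)"
          using \<pi>(6)[OF t', unfolded \<tau>t(1) written_ok_def] uv' nz[unfolded out] by blast
        have "?cap ?a ?b \<le> r' ?a ?b" using p'(1) grow[OF t' uv'] by (rule order_trans)
        moreover have "p' = p \<longrightarrow> t' \<noteq> t \<and> Suc t' \<noteq> t" using p'(3) by auto
        ultimately show ?thesis using p' out by (intro conjI exI[of _ p']) auto
      qed
    qed
    have frame': "\<exists>t<duration. \<exists>u<n. \<exists>v<n. j = cell ph t u v" if "out' j \<noteq> out0 j" for j
    proof (cases "u \<noteq> v \<and> j = ?i")
      case True
      then show ?thesis using layer(1-3) by blast
    next
      case False
      then show ?thesis using that frame[of j] o[of j] by auto
    qed
    have "\<forall>p'<p. ?\<pi> p' 0 \<in> level c (ph - 1) \<and> ?\<pi> p' duration = dn p' \<and> (\<forall>t<duration. walk_ok ph out' p' (?\<pi> p') t)"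
      using \<pi>(1) walk by simp
    then show ?thesis unfolding trace_inv_def
      using res' z sums frame' \<pi>(2) \<tau>t(3,4) layer(1,2,4) new_walk wr by (intro conjI exI[of _ ?\<pi>]) simp_all
  qed
qed

lemma trace_routed:
  assumes "trace_done c ph dn dest out0 (packets ph) r out"
  shows "routed ph (level c (ph - 1)) dn out"
proof -
  obtain \<pi> where \<pi>: "\<forall>p'<packets ph. \<pi> p' 0 \<in> level c (ph - 1) \<and> \<pi> p' duration = dn p' \<and> (\<forall>t<duration. walk_ok ph out p' (\<pi> p') t)"
    "\<And>t. t < duration \<Longrightarrow> written_ok ph (capacity c ph) r \<pi> out (packets ph) duration t"
    using assms unfolding trace_done_def by blast
  have "\<exists>p<packets ph. \<pi> p t = u \<and> \<pi> p (Suc t) = v \<and> u \<noteq> v \<and> out (cell ph t u v) = Suc (p mod k)"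
    if t: "t < duration" "u < n" "v < n" "out (cell ph t u v) \<noteq> 0" for t u v
  proof -
    obtain p where "p \<le> packets ph" "p = packets ph \<longrightarrow> duration \<le> t" "\<pi> p t = u" "\<pi> p (Suc t) = v" "u \<noteq> v"
      "out (cell ph t u v) = Suc (p mod k)"
      using \<pi>(2)[OF t(1)] t unfolding written_ok_def by blast
    then show ?thesis using t(1) by (intro exI[of _ p]) auto
  qed
  then show ?thesis unfolding routed_def using \<pi>(1) unfolding walk_ok_def by (intro exI[of _ \<pi>]) simp
qed

lemma trace_begin:
  assumes "serves W (capacity c ph) dest {..<packets ph} src r"
    and "\<And>t u v. t < duration \<Longrightarrow> u < n \<Longrightarrow> v < n \<Longrightarrow> out (cell ph t u v) = 0"
  shows "trace_done c ph dn dest out 0 r out"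
  using assms by (simp add: trace_done_def serves_def written_ok_def lessThan_atLeast0)

lemma agree_mono:
  assumes "agree X A s s'" "X \<subseteq> X'" "A \<subseteq> A'"
  shows "agree X' A' s s'"
proof -
  have "x \<notin> X" if "x \<notin> X'" for x using assms(2) that by blast
  moreover have "a \<notin> A" if "a \<notin> A'" for a using assms(3) that by blast
  ultimately show ?thesis using assms(1) by (simp add: agree_def)
qed

lemma select_next_correct:
  assumes tot: "total \<le> n * k"
  shows "hoare bound (\<lambda>s. net_env W s \<and> reg s ''y'' < W \<and>
      (\<exists>x<W. entry ''cap'' W s (reg s ''y'') x < entry ''r'' W s (reg s ''y'') x)) select_next
    (\<lambda>s. reg s ''z'' < W \<and> entry ''cap'' W s (reg s ''y'') (reg s ''z'') < entry ''r'' W s (reg s ''y'') (reg s ''z''))"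
proof -
  let ?less = "\<lambda>s x. arr s ''cap'' (reg s ''y'' * W + x) < arr s ''r'' (reg s ''y'' * W + x)"
  let ?F = "\<lambda>s. net_env W s \<and> reg s ''y'' < W \<and> (\<exists>x<W. ?less s x)"
  let ?I = "\<lambda>j s. (\<exists>x<j. ?less s x) \<longrightarrow> reg s ''z'' < W \<and> ?less s (reg s ''z'')"
  have "hoare bound ?F (For ''x'' (Var ''W'')
       (Cond (BLess (Read ''cap'' (Plus (Read ''muW'' (Var ''y'')) (Var ''x'')))
                    (Read ''r'' (Plus (Read ''muW'' (Var ''y'')) (Var ''x''))))
         (Assign ''z'' (Var ''x'')) Skip)) (\<lambda>s. reg s ''z'' < W \<and> ?less s (reg s ''z''))"
  proof (rule hoare_For_wp[where F = ?F and N = W and I = ?I], goal_cases)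
    case (8 j s)
    then have "arr s ''muW'' (reg s ''y'') = reg s ''y'' * W" by (simp add: net_env_def)
    then show ?case using 8 by (auto simp: less_Suc_eq)
  qed (use W_bounds[OF tot] in \<open>simp_all add: net_env_def stable_simps\<close>)
  then show ?thesis unfolding select_next_def
    by (intro hoare_Seq[OF hoare_Assign]) (simp_all add: entry_def net_env_def)
qed

definition trace_env where
  "trace_env c ph dn dest s \<longleftrightarrow> env_net c s \<and> reg s ''P'' = packets ph \<and>
     (\<forall>p<packets ph. arr s ''tok'' p = p mod k \<and> arr s ''dest'' p = dest p \<and> dest p = duration * n + dn p \<and> dn p < n) \<and>
     (\<forall>x<W. \<forall>y<W. entry ''cap'' W s x y = capacity c ph x y \<and> entry ''eo'' W s x y = edge_cell ph x y)"

lemma stable_trace_env: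
  assumes "X \<subseteq> {''e'', ''p'', ''t'', ''x'', ''y'', ''z''}" "A \<subseteq> {''output'', ''r''}" "stable F X A"
  shows "stable (\<lambda>s. trace_env c ph dn dest s \<and> F s) X A"
proof -
  have "stable (\<lambda>s. env_net c s \<and> (reg s ''P'' = packets ph \<and>
     (\<forall>p<packets ph. arr s ''tok'' p = p mod k \<and> arr s ''dest'' p = dest p \<and> dest p = duration * n + dn p \<and> dn p < n) \<and>
     (\<forall>x<W. \<forall>y<W. entry ''cap'' W s x y = capacity c ph x y \<and> entry ''eo'' W s x y = edge_cell ph x y)))
     {''e'', ''p'', ''t'', ''x'', ''y'', ''z''} {''output'', ''r''}"
    by (rule stable_env_net) (simp_all add: stable_simps entry_def)
  then have "stable (trace_env c ph dn dest) {''e'', ''p'', ''t'', ''x'', ''y'', ''z''} {''output'', ''r''}"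
    by (simp add: trace_env_def[abs_def])
  note E = this
  show ?thesis unfolding stable_def
  proof (intro allI impI)
    fix s s' assume s: "trace_env c ph dn dest s \<and> F s" "agree X A s s'"
    have "agree {''e'', ''p'', ''t'', ''x'', ''y'', ''z''} {''output'', ''r''} s s'"
      by (rule agree_mono[OF s(2) assms(1,2)])
    then show "trace_env c ph dn dest s' \<and> F s'" using E assms(3) s unfolding stable_def by blast
  qed
qed

lemma move_packet_correct:
  assumes inv: "trace_inv c ph dn dest out0 p \<tau> y r out" and \<tau>: "\<tau> \<le> duration"
    and s: "trace_env c ph dn dest s" "p < packets ph" "reg s ''p'' = p" "reg s ''y'' = y" "entry ''r'' W s = r" "arr s ''output'' = out"
    and z: "reg s ''z'' = z" "z < W" "capacity c ph y z < r y z"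
  shows "wp move_packet (\<lambda>s. trace_inv c ph dn dest out0 p (Suc \<tau>) (reg s ''y'') (entry ''r'' W s) (arr s ''output'')) s"
proof -
  have env: "env_net c s" using s(1) by (simp add: trace_env_def)
  have y: "y < W" using inv by (simp add: trace_inv_def)
  let ?f = "arr s ''r''"
  let ?g = "?f(y * W + z := ?f (y * W + z) - 1, z * W + y := Suc (?f (z * W + y)))"
  let ?q = "\<lambda>a b. ?g (a * W + b)"
  define out' where "out' = (if 0 < edge_cell ph z y then out(edge_cell ph z y - 1 := Suc (p mod k)) else out)"
  have q: "?q a b = shift y z r a b" if "y \<noteq> z" "a < W" "b < W" for a b
    using shift_array[OF y z(2) that, of ?f] s(5) unfolding entry_def[abs_def] by metis
  have ne: "y \<noteq> z" by (rule trace_step(2)[OF inv \<tau> z(2,3) refl refl])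
  note step = trace_step(1)[OF inv \<tau> z(2,3) q[OF ne] out'_def]
  have idx: "z * W + y \<noteq> y * W + z" using y z(2) ne by (simp add: index_eq_iff)
  have mu: "arr s ''muW'' y = y * W" "arr s ''muW'' z = z * W" using env_net_regs(3)[OF env] y z(2) by blast+
  have eo: "arr s ''eo'' (z * W + y) = edge_cell ph z y" using s(1) y z(2) by (simp add: trace_env_def entry_def)
  have tok: "arr s ''tok'' p = p mod k" using s(1,2) by (simp add: trace_env_def)
  show ?thesis
    using step s(3,4,6) z(1) mu eo tok idx unfolding move_packet_def out'_def
    by (cases "0 < edge_cell ph z y") (simp_all add: entry_def[abs_def] fun_upd_other del: fun_upd_apply)
qed

lemma trace_correct:
  assumes tot: "total \<le> n * k" and ph: "ph \<le> last_phase"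
  shows "hoare bound (\<lambda>s. trace_env c ph dn dest s \<and> trace_done c ph dn dest out0 0 (entry ''r'' W s) (arr s ''output'')) trace
    (\<lambda>s. trace_done c ph dn dest out0 (packets ph) (entry ''r'' W s) (arr s ''output''))"
proof -
  let ?inv = "\<lambda>p \<tau> s. trace_inv c ph dn dest out0 p \<tau> (reg s ''y'') (entry ''r'' W s) (arr s ''output'')"
  let ?done = "\<lambda>p s. trace_done c ph dn dest out0 p (entry ''r'' W s) (arr s ''output'')"
  let ?E = "trace_env c ph dn dest"
  have b: "Suc duration \<le> bound" "packets ph \<le> bound"
    using W_bounds[OF tot] by (simp_all add: bound_def length_input packets_def)
  have loop: "hoare bound (\<lambda>s. (?E s \<and> reg s ''p'' = p) \<and> ?inv p 0 s)
      (For ''t'' (Plus (Var ''T'') (Const 1)) (select_next ;; move_packet)) (?done (Suc p))" if p: "p < packets ph" for p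
  proof (rule hoare_For_conseq[where F = "\<lambda>s. ?E s \<and> reg s ''p'' = p" and N = "Suc duration" and I = "?inv p"], goal_cases)
    case (2)
    show ?case by (rule stable_trace_env) (simp_all add: stable_simps)
  next
    case (3 s)
    then show ?case using env_regs[OF env_net_env[of c s]] by (simp add: trace_env_def)
  next
    case (7 \<tau>)
    let ?G = "\<lambda>s. ?E s \<and> reg s ''p'' = p \<and> ?inv p \<tau> s"
    show ?case
    proof (rule hoare_Seq_frame[OF select_next_correct[OF tot], where F = ?G])
      show "stable ?G (written_regs select_next) (written_arrs select_next)"
        by (rule stable_trace_env) (simp_all add: stable_simps entry_def[abs_def])
    next
      fix s assume s: "(?E s \<and> reg s ''p'' = p) \<and> ?inv p \<tau> s \<and> reg s ''t'' = \<tau>"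
      then have inv: "?inv p \<tau> s" and E: "?E s" by blast+
      have y: "reg s ''y'' < W" using inv by (simp add: trace_inv_def)
      obtain x where x: "x < W" "capacity c ph (reg s ''y'') x < entry ''r'' W s (reg s ''y'') x"
        using trace_continues[OF inv] 7 by (auto simp: less_Suc_eq_le)
      then have "entry ''cap'' W s (reg s ''y'') x < entry ''r'' W s (reg s ''y'') x"
        using E y by (simp add: trace_env_def)
      then show "(net_env W s \<and> reg s ''y'' < W \<and> (\<exists>x<W. entry ''cap'' W s (reg s ''y'') x < entry ''r'' W s (reg s ''y'') x)) \<and> ?G s"
        using s y x(1) by (auto simp: trace_env_def env_net_def)
    next
      show "hoare bound (\<lambda>s. (reg s ''z'' < W \<and> entry ''cap'' W s (reg s ''y'') (reg s ''z'') < entry ''r'' W s (reg s ''y'') (reg s ''z'')) \<and> ?G s)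
          move_packet (?inv p (Suc \<tau>))"
      proof (rule hoare_wp)
        fix s assume s: "(reg s ''z'' < W \<and> entry ''cap'' W s (reg s ''y'') (reg s ''z'') < entry ''r'' W s (reg s ''y'') (reg s ''z'')) \<and> ?G s"
        then have inv: "?inv p \<tau> s" and E: "?E s" and z: "reg s ''z'' < W" by blast+
        have y: "reg s ''y'' < W" using inv by (simp add: trace_inv_def)
        have "entry ''cap'' W s (reg s ''y'') (reg s ''z'') = capacity c ph (reg s ''y'') (reg s ''z'')"
          using E y z by (simp add: trace_env_def)
        with s have "capacity c ph (reg s ''y'') (reg s ''z'') < entry ''r'' W s (reg s ''y'') (reg s ''z'')"
          by simp
        then show "wp move_packet (?inv p (Suc \<tau>)) s"
          using 7 s by (intro move_packet_correct[OF inv _ E p _ refl refl refl refl z]) simp_all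
      qed
    qed
  qed (use b in \<open>simp_all add: entry_def[abs_def] trace_finish\<close>)
  show ?thesis unfolding trace_def
  proof (rule hoare_For_conseq[where F = ?E and N = "packets ph" and I = ?done], goal_cases)
    case 2
    have "stable (\<lambda>s. ?E s \<and> True) {''e'', ''p'', ''t'', ''x'', ''y'', ''z''} {''output'', ''r''}"
      by (rule stable_trace_env) (simp_all add: stable_simps)
    then show ?case unfolding stable_def agree_def by (simp add: select_next_def move_packet_def)
  next
    case (7 p)
    show ?case
    proof (rule hoare_Seq[OF hoare_Assign loop[OF 7]])
      fix s assume s: "?E s \<and> ?done p s \<and> reg s ''p'' = p"
      have "trace_inv c ph dn dest out0 p 0 (dest p) (entry ''r'' W s) (arr s ''output'')"
        using s 7 by (intro trace_start) (auto simp: trace_env_def)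
      moreover have "?E (set_reg ''y'' i s) = ?E s" for i
        by (simp add: trace_env_def env_net_def env_simps net_env_def entry_def)
      moreover have "arr s ''dest'' p = dest p" using s 7 by (simp add: trace_env_def)
      ultimately show "(?E (set_reg ''y'' (aval (Read ''dest'' (Var ''p'')) s) s) \<and>
          reg (set_reg ''y'' (aval (Read ''dest'' (Var ''p'')) s) s) ''p'' = p) \<and>
          ?inv p 0 (set_reg ''y'' (aval (Read ''dest'' (Var ''p'')) s) s)"
        using s by (simp add: entry_def[abs_def])
    qed
  qed (use b in \<open>simp_all add: trace_env_def entry_def[abs_def]\<close>)
qed

definition phase_feasible :: "(nat \<Rightarrow> nat) \<Rightarrow> nat \<Rightarrow> bool" where
  "phase_feasible c ph \<longleftrightarrow> (\<forall>dn dest. dest_ok c ph dn \<longrightarrow> (\<forall>p<packets ph. dest p = duration * n + dn p) \<longrightarrow>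
     cut_condition W (capacity c ph) dest {..<packets ph} src)"

lemma dest_ok_less: "dest_ok c ph dn \<Longrightarrow> p < packets ph \<Longrightarrow> dn p < n"
  using n_pos by (auto simp: dest_ok_def packets_def level_def split: if_splits)

lemma phase_correct:
  assumes tot: "total \<le> n * k" and ph: "ph \<le> last_phase"
    and y0: "\<And>t u v. t < duration \<Longrightarrow> u < n \<Longrightarrow> v < n \<Longrightarrow> y0 (cell ph t u v) = 0"
  shows "hoare bound (\<lambda>s. env_net c s \<and> reg s ''ph'' = ph \<and> reg s ''pT'' = ph * duration \<and>
      reg s ''fail'' = f \<and> arr s ''output'' = y0) phase
    (\<lambda>s. (reg s ''fail'' = 0 \<longrightarrow> f = 0 \<and>
          (\<exists>dn. dest_ok c ph dn \<and> routed ph (level c (ph - 1)) dn (arr s ''output'')) \<and>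
          (\<forall>i. arr s ''output'' i \<noteq> y0 i \<longrightarrow> (\<exists>t<duration. \<exists>u<n. \<exists>v<n. i = cell ph t u v))) \<and>
       (f = 0 \<and> phase_feasible c ph \<longrightarrow> reg s ''fail'' = 0))"
proof -
  let ?Q = "\<lambda>s. (reg s ''fail'' = 0 \<longrightarrow> f = 0 \<and>
          (\<exists>dn. dest_ok c ph dn \<and> routed ph (level c (ph - 1)) dn (arr s ''output'')) \<and>
          (\<forall>i. arr s ''output'' i \<noteq> y0 i \<longrightarrow> (\<exists>t<duration. \<exists>u<n. \<exists>v<n. i = cell ph t u v))) \<and>
       (f = 0 \<and> phase_feasible c ph \<longrightarrow> reg s ''fail'' = 0)"
  let ?F = "\<lambda>s. env_net c s \<and> reg s ''ph'' = ph \<and> reg s ''fail'' = f \<and> arr s ''output'' = y0"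
  let ?B = "\<lambda>s. \<forall>x<W. \<forall>y<W. entry ''cap'' W s x y = capacity c ph x y \<and> entry ''r'' W s x y = capacity c ph x y \<and>
       entry ''eo'' W s x y = edge_cell ph x y"
  let ?c = "Cond (BEq (Var ''fail'') (Const 0)) trace Skip"
  have last: "hoare bound (\<lambda>s. has_packets c ph s \<and> ?F s \<and> ?B s) (flow ;; ?c) ?Q"
  proof -
    have "hoare bound (\<lambda>s. dest_ok c ph dn \<and> trace_env c ph dn dest s \<and> ?F s \<and> ?B s) (flow ;; ?c) ?Q" for dn dest
    proof (cases "dest_ok c ph dn \<and> (\<forall>p<packets ph. dest p = duration * n + dn p \<and> dn p < n)")
      case False
      then show ?thesis by (intro hoare_False) (auto simp: trace_env_def)
    next
      case True
      let ?G = "\<lambda>s. env_net c s \<and> trace_env c ph dn dest s \<and> arr s ''output'' = y0"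
      let ?R = "\<lambda>s. (reg s ''fail'' = 0 \<longrightarrow> f = 0 \<and> serves W (capacity c ph) dest {..<packets ph} src (entry ''r'' W s)) \<and>
         (f = 0 \<and> cut_condition W (capacity c ph) dest {..<packets ph} src \<longrightarrow> reg s ''fail'' = 0)"
      have feas: "cut_condition W (capacity c ph) dest {..<packets ph} src" if "phase_feasible c ph"
        using that[unfolded phase_feasible_def, rule_format, of dn dest] True by blast
      have dless: "dest p < src" if "p < packets ph" for p
        using True that index_less[of duration duration "dn p" n] by (simp add: src_def)
      show ?thesis
      proof (rule hoare_Seq_frame[where F = ?G and R = ?R, OF flow_correct[of W src bound "packets ph" dest "capacity c ph" f]])
        show "W = Suc src" by (rule W_def)
        show "W \<le> bound" by (rule W_bounds[OF tot])
        show "packets ph \<le> bound" by (simp add: bound_def length_input packets_def)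
        show "stable ?G (written_regs flow) (written_arrs flow)"
          by (rule stable_env_net) (simp_all add: stable_simps trace_env_def entry_def env_net_def env_simps net_env_def)
        show "(net_env W s \<and> reg s ''s'' = src \<and> reg s ''P'' = packets ph \<and> (\<forall>p<packets ph. arr s ''dest'' p = dest p) \<and>
           (\<forall>x<W. \<forall>y<W. entry ''r'' W s x y = capacity c ph x y) \<and> reg s ''fail'' = f) \<and> ?G s"
          if "dest_ok c ph dn \<and> trace_env c ph dn dest s \<and> ?F s \<and> ?B s" for s
          using that by (auto simp: trace_env_def env_net_def)
        show "hoare bound (\<lambda>s. ?R s \<and> ?G s) ?c ?Q"
        proof (rule hoare_Cond)
          have st: "stable (\<lambda>s. reg s ''fail'' = 0 \<and> f = 0) (written_regs trace) (written_arrs trace)"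
            by (simp add: stable_simps)
          show "hoare bound (\<lambda>s. (?R s \<and> ?G s) \<and> bval (BEq (Var ''fail'') (Const 0)) s) trace ?Q"
          proof (rule hoare_conseq[OF hoare_frame[OF trace_correct[OF tot ph, of c dn dest y0] st]])
            fix s assume s: "(?R s \<and> ?G s) \<and> bval (BEq (Var ''fail'') (Const 0)) s"
            have "trace_done c ph dn dest y0 0 (entry ''r'' W s) y0"
              by (rule trace_begin) (use s y0 in simp_all)
            then show "(trace_env c ph dn dest s \<and> trace_done c ph dn dest y0 0 (entry ''r'' W s) (arr s ''output'')) \<and>
                reg s ''fail'' = 0 \<and> f = 0" using s by simp
          next
            fix s assume s: "trace_done c ph dn dest y0 (packets ph) (entry ''r'' W s) (arr s ''output'') \<and> reg s ''fail'' = 0 \<and> f = 0"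
            then have "routed ph (level c (ph - 1)) dn (arr s ''output'')" using trace_routed by blast
            moreover have "\<forall>i. arr s ''output'' i \<noteq> y0 i \<longrightarrow> (\<exists>t<duration. \<exists>u<n. \<exists>v<n. i = cell ph t u v)"
              using s by (simp add: trace_done_def)
            ultimately show "?Q s" using s True by blast
          qed
          show "hoare bound (\<lambda>s. (?R s \<and> ?G s) \<and> \<not> bval (BEq (Var ''fail'') (Const 0)) s) Skip ?Q"
            by (rule hoare_Skip) (use feas in auto)
        qed
      qed (use dless in simp)
    qed
    then have "hoare bound (\<lambda>s. \<exists>dn dest. dest_ok c ph dn \<and> trace_env c ph dn dest s \<and> ?F s \<and> ?B s) (flow ;; ?c) ?Q"
      by (intro hoare_ex)
    then show ?thesis
    proof (rule hoare_pre)
      fix s assume s: "has_packets c ph s \<and> ?F s \<and> ?B s"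
      then obtain dn where dn: "dest_ok c ph dn" "\<forall>p<packets ph. arr s ''dest'' p = duration * n + dn p"
        by (auto simp: has_packets_def)
      have "trace_env c ph dn (\<lambda>p. duration * n + dn p) s"
        using s dn dest_ok_less[OF dn(1)] by (simp add: trace_env_def has_packets_def)
      then show "\<exists>dn dest. dest_ok c ph dn \<and> trace_env c ph dn dest s \<and> ?F s \<and> ?B s"
        using s dn(1) by blast
    qed
  qed
  show ?thesis unfolding phase_def
  proof (rule hoare_Seq_frame[OF build_correct[OF tot ph, of c], where F = ?F])
    show "stable ?F (written_regs build) (written_arrs build)"
      by (rule stable_env_net) (simp_all add: stable_simps)
    show "hoare bound (\<lambda>s. ?B s \<and> ?F s) (make_packets ;; flow ;; ?c) ?Q"
    proof (rule hoare_Seq_frame[OF make_packets_correct[OF tot ph, of c], where F = "\<lambda>s. env_net c s \<and> (reg s ''ph'' = ph \<and> reg s ''fail'' = f \<and> arr s ''output'' = y0) \<and> ?B s"])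
      show "stable (\<lambda>s. env_net c s \<and> (reg s ''ph'' = ph \<and> reg s ''fail'' = f \<and> arr s ''output'' = y0) \<and> ?B s) (written_regs make_packets) (written_arrs make_packets)"
        by (rule stable_env_net) (simp_all add: stable_simps entry_def)
      show "hoare bound (\<lambda>s. has_packets c ph s \<and> env_net c s \<and> (reg s ''ph'' = ph \<and> reg s ''fail'' = f \<and> arr s ''output'' = y0) \<and> ?B s) (flow ;; ?c) ?Q"
        by (rule hoare_pre[OF last]) blast
    qed blast
  qed blast
qed

end

subsection \<open>Flooding and the main program\<close>

text \<open>Cells without a token are set to 0 explicitly, since phases that ran before a failure
  may have left entries behind.\<close>

definition flood_row :: com where
  "flood_row =
     For ''v'' (Var ''n'')
       (Cond (BAnd (BLess (Const 0) (Read ''have'' (Var ''u'')))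
                   (BLess (Const 0) (Read ''input'' (Plus (Var ''gb'') (Plus (Var ''e'') (Var ''v''))))))
         (Store ''output'' (Plus (Var ''e'') (Var ''v'')) (Plus (Var ''i'') (Const 1)) ;;
          Store ''new'' (Var ''v'') (Const 1))
         (Store ''output'' (Plus (Var ''e'') (Var ''v'')) (Const 0)))"

text \<open>The receivers are collected in \<open>new\<close>, so that a token is not forwarded in
  the round in which it arrives.\<close>

definition flood_round :: com where
  "flood_round =
     For ''u'' (Var ''n'') (Store ''new'' (Var ''u'') (Read ''have'' (Var ''u''))) ;;
     For ''u'' (Var ''n'')
       (Assign ''e'' (Read ''mun'' (Plus (Read ''mun'' (Plus (Read ''mun'' (Var ''i'')) (Var ''t''))) (Var ''u''))) ;;
        flood_row) ;;
     For ''u'' (Var ''n'') (Store ''have'' (Var ''u'') (Read ''new'' (Var ''u'')))"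

definition flood :: com where
  "flood =
     For ''i'' (Var ''k'')
       (For ''u'' (Var ''n'')
          (Store ''have'' (Var ''u'') (Read ''input'' (Plus (Var ''ib'') (Plus (Read ''muk'' (Var ''u'')) (Var ''i''))))) ;;
        For ''t'' (Var ''n'') flood_round)"

definition run_phases :: com where
  "run_phases =
     For ''ph'' (Plus (Var ''m'') (Const 1))
       (Cond (BEq (Var ''fail'') (Const 0)) phase Skip ;;
        Assign ''pT'' (Plus (Var ''pT'') (Var ''T'')))"

definition main_com :: com where
  "main_com =
     Assign ''fail'' (Const 0) ;;
     Assign ''pT'' (Const 0) ;;
     Cond (BLess (Var ''nk'') (Var ''tot'')) (Assign ''fail'' (Const 1)) (prepare ;; run_phases) ;;
     Cond (BEq (Var ''fail'') (Const 0)) Skip flood"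

lemma written_flood [simp]:
  "written_regs flood_row = {''v''}" "written_arrs flood_row = {''new'', ''output''}"
  "written_regs flood_round = {''e'', ''u'', ''v''}" "written_arrs flood_round = {''have'', ''new'', ''output''}"
  by (simp_all add: flood_row_def flood_round_def set_eq_subset)

context gossip_locale
begin

lemma stable_env:
  assumes "\<forall>x \<in> {''length'', ''n'', ''k'', ''nk'', ''m'', ''T'', ''tot'', ''ib'', ''gb''}. x \<notin> X"
    "\<forall>x \<in> {''input'', ''mun'', ''muk'', ''tim'', ''nod''}. x \<notin> A" "stable F X A"
  shows "stable (\<lambda>s. env s \<and> F s) X A"
  unfolding stable_def
proof (intro allI impI)
  fix s s' assume s: "env s \<and> F s" "agree X A s s'"
  have r: "reg s' x = reg s x" if "x \<in> {''length'', ''n'', ''k'', ''nk'', ''m'', ''T'', ''tot'', ''ib'', ''gb''}" for x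
    by (rule agree_reg[OF s(2)]) (rule bspec[OF assms(1) that])
  have a: "arr s' x = arr s x" if "x \<in> {''input'', ''mun'', ''muk'', ''tim'', ''nod''}" for x
    by (rule agree_arr[OF s(2)]) (rule bspec[OF assms(2) that])
  have "env s'" using s(1) by (simp add: env_simps r a)
  moreover have "F s'" using assms(3) s unfolding stable_def by blast
  ultimately show "env s' \<and> F s'" by simp
qed

text \<open>Token \<open>i\<close> owns the rounds \<open>i * n + 1\<close> to
  \<open>i * n + n\<close>, and \<open>t\<close> counts the rounds within this block.\<close>

primrec reach :: "nat \<Rightarrow> nat \<Rightarrow> nat set" where
  "reach i 0 = {u. u < n \<and> (u, i) \<in> init I}"
| "reach i (Suc t) = reach i t \<union> {v. v < n \<and> (\<exists>u<n. u \<in> reach i t \<and> (u, v) \<in> graph I (Suc (i * n + t)))}"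

text \<open>\<open>x\<close> is a row of the output matrix, the number of the round times
  \<open>n\<close> plus the sender; the token flooded in that round can be read off from it.\<close>

definition flood_value :: "nat \<Rightarrow> nat \<Rightarrow> nat" where
  "flood_value x v =
     (let r = x div n; i = r div n
      in if x mod n \<in> reach i (r mod n) \<and> (x mod n, v) \<in> graph I (Suc r) then Suc i else 0)"

lemma flood_value_eq:
  assumes "t < n" "u < n"
  shows "flood_value ((i * n + t) * n + u) v =
    (if u \<in> reach i t \<and> (u, v) \<in> graph I (Suc (i * n + t)) then Suc i else 0)"
  using assms by (simp add: flood_value_def Let_def)

lemma flood_row_correct:
  assumes i: "i < k" and t: "t < n" and u: "u < n"
  defines "G \<equiv> graph I (Suc (i * n + t))"
  shows "hoare bound (\<lambda>s. env s \<and> reg s ''i'' = i \<and> reg s ''u'' = u \<and> reg s ''e'' = ((i * n + t) * n + u) * n \<and>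
      (\<forall>w<n. arr s ''have'' w = of_bool (w \<in> reach i t)) \<and>
      filled n (arr s ''output'') flood_value ((i * n + t) * n + u) 0 \<and>
      (\<forall>w<n. arr s ''new'' w = of_bool (w \<in> reach i t \<or> (\<exists>u'<u. u' \<in> reach i t \<and> (u', w) \<in> G)))) flood_row
    (\<lambda>s. filled n (arr s ''output'') flood_value ((i * n + t) * n + Suc u) 0 \<and>
      (\<forall>w<n. arr s ''new'' w = of_bool (w \<in> reach i t \<or> (\<exists>u'<Suc u. u' \<in> reach i t \<and> (u', w) \<in> G))))"
  unfolding flood_row_def
proof (rule hoare_For_wp[where N = n and F = "\<lambda>s. env s \<and> reg s ''i'' = i \<and> reg s ''u'' = u \<and>
      reg s ''e'' = ((i * n + t) * n + u) * n \<and> (\<forall>w<n. arr s ''have'' w = of_bool (w \<in> reach i t))" and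
      I = "\<lambda>v s. filled n (arr s ''output'') flood_value ((i * n + t) * n + u) v \<and>
        (\<forall>w<n. arr s ''new'' w = of_bool (w \<in> reach i t \<or> (\<exists>u'<u. u' \<in> reach i t \<and> (u', w) \<in> G) \<or>
          (w < v \<and> u \<in> reach i t \<and> (u, w) \<in> G)))"], goal_cases)
  case 2
  show ?case by (rule stable_env) (simp_all add: stable_simps)
next
  case (7 s)
  then show ?case by (simp add: filled_row Ex_less_Suc)
next
  case (8 v s)
  have r: "i * n + t < n * k" using mult_add_less[OF i t] by (simp add: mult.commute)
  have env: "env s" using 8 by blast
  note g = env_graph[OF env r u 8(1), folded G_def]
  let ?x = "(i * n + t) * n + u"
  let ?w = "if u \<in> reach i t \<and> (u, v) \<in> G then Suc i else 0"
  have fill: "filled n ((arr s ''output'')(?x * n + v := ?w)) flood_value ?x (Suc v)"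
    using 8 filled_upd[of n "arr s ''output''" flood_value ?x v ?w] flood_value_eq[OF t u, of i v] by (simp add: G_def)
  show ?case
  proof (cases "u \<in> reach i t \<and> (u, v) \<in> G")
    case True
    then have "filled n ((arr s ''output'')(?x * n + v := Suc i)) flood_value ?x (Suc v)" using fill by simp
    then show ?thesis using 8 True g u by (auto simp: env_regs[OF env] less_Suc_eq)
  next
    case False
    then have "?w = 0" by (rule if_not_P)
    note fill = fill[unfolded this]
    then show ?thesis using 8 False g u by (auto simp: env_regs[OF env] less_Suc_eq)
  qed
qed (simp_all add: env_regs bound_def length_input)

lemma flood_round_correct:
  assumes i: "i < k" and t: "t < n"
  shows "hoare bound (\<lambda>s. env s \<and> reg s ''i'' = i \<and> reg s ''t'' = t \<and>
      (\<forall>w<n. arr s ''have'' w = of_bool (w \<in> reach i t)) \<and>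
      filled n (arr s ''output'') flood_value ((i * n + t) * n) 0) flood_round
    (\<lambda>s. (\<forall>w<n. arr s ''have'' w = of_bool (w \<in> reach i (Suc t))) \<and>
      filled n (arr s ''output'') flood_value ((i * n + Suc t) * n) 0)"
proof -
  let ?F = "\<lambda>s. env s \<and> reg s ''i'' = i \<and> reg s ''t'' = t"
  let ?H = "\<lambda>s. (\<forall>w<n. arr s ''have'' w = of_bool (w \<in> reach i t))"
  let ?O = "\<lambda>u s. filled n (arr s ''output'') flood_value ((i * n + t) * n + u) 0"
  let ?N = "\<lambda>u s. \<forall>w<n. arr s ''new'' w = of_bool (w \<in> reach i t \<or> (\<exists>u'<u. u' \<in> reach i t \<and> (u', w) \<in> graph I (Suc (i * n + t))))"
  have b: "n \<le> bound" by (simp add: bound_def length_input)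
  have r: "i * n + t < n * k" using mult_add_less[OF i t] by (simp add: mult.commute)
  have il: "i < length input" using i n_pos by (simp add: length_input)
  have 1: "hoare bound (\<lambda>s. ?F s \<and> ?H s \<and> ?O 0 s) (For ''u'' (Var ''n'') (Store ''new'' (Var ''u'') (Read ''have'' (Var ''u''))))
    (\<lambda>s. (?F s \<and> ?H s) \<and> ?O 0 s \<and> ?N 0 s)"
  proof (rule hoare_For_wp[where N = n and F = "\<lambda>s. env s \<and> (reg s ''i'' = i \<and> reg s ''t'' = t) \<and> ?H s \<and> ?O 0 s" and
      I = "\<lambda>u s. \<forall>w<u. arr s ''new'' w = of_bool (w \<in> reach i t)"], goal_cases)
    case 2
    show ?case by (rule stable_env) (simp_all add: stable_simps)
  qed (use b in \<open>simp_all add: env_regs All_less_Suc\<close>)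
  have 2: "hoare bound (\<lambda>s. (?F s \<and> ?H s) \<and> ?O 0 s \<and> ?N 0 s)
     (For ''u'' (Var ''n'')
       (Assign ''e'' (Read ''mun'' (Plus (Read ''mun'' (Plus (Read ''mun'' (Var ''i'')) (Var ''t''))) (Var ''u''))) ;; flood_row))
     (\<lambda>s. ?F s \<and> ?O n s \<and> ?N n s)"
  proof (rule hoare_For_conseq[where N = n and F = "\<lambda>s. env s \<and> (reg s ''i'' = i \<and> reg s ''t'' = t) \<and> ?H s" and I = "\<lambda>u s. ?O u s \<and> ?N u s"], goal_cases)
    case 2
    show ?case by (rule stable_env) (simp_all add: stable_simps)
  next
    case (7 u)
    show ?case
    proof (rule hoare_Seq[OF hoare_Assign flood_row_correct[OF i t 7]])
      fix s assume s: "(env s \<and> (reg s ''i'' = i \<and> reg s ''t'' = t) \<and> ?H s) \<and> (?O u s \<and> ?N u s) \<and> reg s ''u'' = u"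
      let ?e = "Read ''mun'' (Plus (Read ''mun'' (Plus (Read ''mun'' (Var ''i'')) (Var ''t''))) (Var ''u''))"
      have env: "env s" using s by blast
      have rl: "i * n + t < length input" using r nk_less_length by simp
      have e: "aval ?e s = ((i * n + t) * n + u) * n"
        using s il rl row_less_length[OF r 7] by (simp add: env_regs[OF env])
      have "env (set_reg ''e'' x s)" for x using env by (simp add: env_simps)
      then show "env (set_reg ''e'' (aval ?e s) s) \<and> reg (set_reg ''e'' (aval ?e s) s) ''i'' = i \<and>
          reg (set_reg ''e'' (aval ?e s) s) ''u'' = u \<and> reg (set_reg ''e'' (aval ?e s) s) ''e'' = ((i * n + t) * n + u) * n \<and>
          ?H (set_reg ''e'' (aval ?e s) s) \<and> ?O u (set_reg ''e'' (aval ?e s) s) \<and> ?N u (set_reg ''e'' (aval ?e s) s)"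
        unfolding e using s by simp
    qed
  qed (use b in \<open>simp_all add: env_regs\<close>)
  have 3: "hoare bound (\<lambda>s. ?F s \<and> ?O n s \<and> ?N n s) (For ''u'' (Var ''n'') (Store ''have'' (Var ''u'') (Read ''new'' (Var ''u''))))
    (\<lambda>s. (\<forall>w<n. arr s ''have'' w = of_bool (w \<in> reach i (Suc t))) \<and>
      filled n (arr s ''output'') flood_value ((i * n + Suc t) * n) 0)"
  proof (rule hoare_For_wp[where N = n and F = "\<lambda>s. env s \<and> ?O n s \<and> ?N n s" and
      I = "\<lambda>u s. \<forall>w<u. arr s ''have'' w = of_bool (w \<in> reach i (Suc t))"], goal_cases)
    case 2
    show ?case by (rule stable_env) (simp_all add: stable_simps)
  next
    case (7 s)
    then show ?case by (simp add: algebra_simps)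
  next
    case (8 u s)
    have "u \<in> reach i (Suc t) \<longleftrightarrow> u \<in> reach i t \<or> (\<exists>u'<n. u' \<in> reach i t \<and> (u', u) \<in> graph I (Suc (i * n + t)))"
      using 8(1) by simp
    then have "arr s ''new'' u = of_bool (u \<in> reach i (Suc t))" using 8 by (simp del: reach.simps)
    then show ?case using 8 by (simp add: All_less_Suc del: reach.simps)
  qed (use b in \<open>simp_all add: env_regs\<close>)
  show ?thesis unfolding flood_round_def
    by (rule hoare_pre[OF hoare_Seq[OF 1 hoare_Seq[OF 2 3]]]) simp
qed

lemma flood_correct:
  "hoare bound env flood (\<lambda>s. filled n (arr s ''output'') flood_value (n * k * n) 0)"
proof -
  let ?O = "\<lambda>x s. filled n (arr s ''output'') flood_value (x * n) 0"
  have b: "n \<le> bound" "k \<le> bound" by (simp_all add: bound_def length_input)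
  have 1: "hoare bound (\<lambda>s. env s \<and> reg s ''i'' = i \<and> ?O (i * n) s)
      (For ''u'' (Var ''n'') (Store ''have'' (Var ''u'') (Read ''input'' (Plus (Var ''ib'') (Plus (Read ''muk'' (Var ''u'')) (Var ''i''))))))
      (\<lambda>s. (env s \<and> reg s ''i'' = i) \<and> (\<forall>w<n. arr s ''have'' w = of_bool (w \<in> reach i 0)) \<and> ?O (i * n + 0) s)" if i: "i < k" for i
  proof (rule hoare_For_wp[where N = n and F = "\<lambda>s. env s \<and> reg s ''i'' = i \<and> ?O (i * n) s" and
      I = "\<lambda>u s. \<forall>w<u. arr s ''have'' w = of_bool (w \<in> reach i 0)"], goal_cases)
    case 2
    show ?case by (rule stable_env) (simp_all add: stable_simps)
  next
    case (8 u s)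
    then have env: "env s" by blast
    show ?case using 8 env_init[OF env 8(1) i] by (simp add: env_regs[OF env] All_less_Suc)
  qed (use b in \<open>simp_all add: env_regs\<close>)
  have 2: "hoare bound (\<lambda>s. (env s \<and> reg s ''i'' = i) \<and> (\<forall>w<n. arr s ''have'' w = of_bool (w \<in> reach i 0)) \<and> ?O (i * n + 0) s)
      (For ''t'' (Var ''n'') flood_round) (?O (Suc i * n))" if i: "i < k" for i
  proof (rule hoare_For_conseq[where N = n and F = "\<lambda>s. env s \<and> reg s ''i'' = i" and
      I = "\<lambda>t s. (\<forall>w<n. arr s ''have'' w = of_bool (w \<in> reach i t)) \<and> ?O (i * n + t) s"], goal_cases)
    case 2
    show ?case by (rule stable_env) (simp_all add: stable_simps)
  next
    case (7 t)
    show ?case by (rule hoare_pre[OF flood_round_correct[OF i 7]]) simp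
  next
    case (8 s)
    then show ?case by (simp add: add.commute)
  qed (use b in \<open>simp_all add: env_regs\<close>)
  show ?thesis unfolding flood_def
  proof (rule hoare_For_conseq[where N = k and F = "\<lambda>s. env s \<and> True" and I = "\<lambda>i. ?O (i * n)"], goal_cases)
    case 2
    show ?case by (rule stable_env) (simp_all add: stable_simps)
  next
    case (7 i)
    show ?case by (rule hoare_pre[OF hoare_Seq[OF 1[OF 7] 2[OF 7]]]) simp
  next
    case (8 s)
    then show ?case by (simp add: mult.commute)
  qed (use b in \<open>simp_all add: env_regs\<close>)
qed

lemma reach_subset: "reach i t \<subseteq> {..<n}"
  by (induction t) auto

text \<open>As long as some node is missing, an edge of the connected graph leads out of the reached
  set. So every round adds a node, and \<open>n\<close> rounds are enough.\<close>

lemma reach_card: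
  assumes i: "i < k" and t: "t \<le> n"
  shows "min n (Suc t) \<le> card (reach i t)"
  using t
proof (induction t)
  case 0
  have "reach i 0 \<noteq> {}" using gossip i by (auto simp: gossip_instance_def)
  then have "0 < card (reach i 0)" using finite_subset[OF reach_subset] by (simp add: card_gt_0_iff)
  then show ?case by simp
next
  case (Suc t)
  have fin: "finite (reach i t)" for t by (rule finite_subset[OF reach_subset]) simp
  have sub: "reach i t \<subseteq> reach i (Suc t)" by auto
  show ?case
  proof (cases "reach i t = {..<n}")
    case True
    then have "n \<le> card (reach i (Suc t))" using card_mono[OF fin sub] by simp
    then show ?thesis by simp
  next
    case False
    have "0 < card (reach i t)" using Suc n_pos by auto
    then obtain x where x: "x \<in> reach i t" by (metis card_gt_0_iff ex_in_conv)
    have "i * n + t < k * n" using mult_add_less[of i k t n] i Suc.prems by simp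
    then have "connected_graph n (graph I (Suc (i * n + t)))"
      using gossip by (simp add: gossip_instance_def rounds_def mult.commute)
    from connected_graph_leaves[OF this reach_subset x False]
    obtain u v where "u \<in> reach i t" "v \<in> {..<n} - reach i t" "(u, v) \<in> graph I (Suc (i * n + t))" .
    moreover have "u < n" using calculation(1) reach_subset by auto
    ultimately have "v \<in> reach i (Suc t)" "v \<notin> reach i t" by auto
    then have "card (reach i t) < card (reach i (Suc t))"
      using sub by (intro psubset_card_mono fin) blast
    then show ?thesis using Suc by simp
  qed
qed

lemma flood_schedule:
  assumes y: "filled n y flood_value (n * k * n) 0"
  shows "valid_schedule I (decode I y) \<and> disseminates I (decode I y)"
proof -
  define S where "S = decode I y"
  have val: "y ((r * n + u) * n + v) = (if u \<in> reach (r div n) (r mod n) \<and> (u, v) \<in> graph I (Suc r) then Suc (r div n) else 0)"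
    if "r < n * k" "u < n" "v < n" for r u v
    using filledD[OF y mult_add_less[OF that(1,2)] that(3)] that(2) by (simp add: flood_value_def Let_def)
  have held: "u \<in> reach i t \<Longrightarrow> i \<in> held I S (i * n + t) u" if i: "i < k" and t: "t \<le> n" for i t u
    using t
  proof (induction t arbitrary: u)
    case 0
    then show ?case using held_mono[of 0 "i * n"] by auto
  next
    case (Suc t)
    have r: "i * n + t < n * k" using mult_add_less[of i k t n] i Suc.prems by (simp add: mult.commute)
    show ?case
    proof (cases "u \<in> reach i t")
      case True
      then show ?thesis using Suc held_mono[of "i * n + t" "i * n + Suc t"] by auto
    next
      case False
      then obtain w where w: "w < n" "w \<in> reach i t" "(w, u) \<in> graph I (Suc (i * n + t))" "u < n"
        using Suc.prems by auto
      have "y (((i * n + t) * n + w) * n + u) = Suc i"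
        using val[OF r w(1,4)] w Suc.prems by simp
      from decode_eq[of "i * n + t" w u y i, OF r w(1,4) this] show ?thesis using w(3) by (auto simp: S_def)
    qed
  qed
  have valid: "valid_schedule I S"
    unfolding valid_schedule_def
  proof (intro allI impI)
    fix t u v i assume "S t u v = Some i"
    note d = decode_Some[OF this[unfolded S_def]]
    obtain r where r: "t = Suc r" "r < n * k" using d(1) by (cases t) (auto simp: rounds_def)
    have u: "u \<in> reach (r div n) (r mod n)" "(u, v) \<in> graph I (Suc r)" "i = r div n"
      using val[OF r(2) d(2,3)] d(4) r(1) by (auto split: if_splits)
    have "r div n < k" using r(2) by (simp add: less_mult_imp_div_less mult.commute)
    then have "i \<in> held I S (r div n * n + r mod n) u"
      unfolding u(3) using u(1) n_pos by (intro held) (simp_all add: less_imp_le)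
    then show "t \<in> rounds I \<and> (u, v) \<in> graph I t \<and> i \<in> held I S (t - 1) u"
      using d(1) u(2) r(1) by simp
  qed
  have "held I S (n * k) u = {..<k}" if "u < n" for u
  proof
    show "held I S (n * k) u \<subseteq> {..<k}" by (rule held_subset_tokens[OF valid])
    show "{..<k} \<subseteq> held I S (n * k) u"
    proof
      fix i assume "i \<in> {..<k}"
      then have i: "i < k" by simp
      have "reach i n = {..<n}"
        using reach_card[OF i order_refl] reach_subset by (intro card_subset_eq) (auto simp: min_def intro: antisym card_mono[OF _ reach_subset, simplified])
      then have "i \<in> held I S (i * n + n) u" using that i by (intro held) simp_all
      moreover have "i * n + n \<le> n * k" using mult_le_mono1[of "Suc i" k n] i by (simp add: mult.commute add.commute)
      ultimately show "i \<in> held I S (n * k) u" using held_mono by blast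
    qed
  qed
  then show ?thesis using valid by (simp add: disseminates_def S_def)
qed

section \<open>Combining the phases, which write to disjoint parts of the output\<close>

lemma cell_form:
  assumes "u < n" "v < n"
  obtains a b where "a < n" "b < n" "cell ph t u v = (round_of ph t * n + a) * n + b"
  using assms by (cases "ph = 0") (auto simp: cell_def intro: that)

lemma round_of_phase: "t < duration \<Longrightarrow> round_of ph t div duration = ph"
  by (auto simp: round_of_def)

lemma cell_eq_round:
  assumes "cell ph t u v = (r * n + a) * n + b" "u < n" "v < n" "a < n" "b < n"
  shows "r = round_of ph t"
proof -
  obtain a' b' where "a' < n" "b' < n" "cell ph t u v = (round_of ph t * n + a') * n + b'"
    by (rule cell_form[OF assms(2,3)])
  then show ?thesis using assms by (simp add: index_eq_iff)
qed

text \<open>Lets the result of a phase survive the later phases, which write to other cells.\<close>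

lemma routed_cong:
  assumes r: "routed ph A dn y" and tot: "total \<le> n * k" "ph \<le> last_phase"
    and eq: "\<And>t u v. t < duration \<Longrightarrow> u < n \<Longrightarrow> v < n \<Longrightarrow> y' (cell ph t u v) = y (cell ph t u v)"
  shows "routed ph A dn y'"
proof -
  have less: "u < n \<and> v < n" if "t < duration" "(u, v) \<in> phase_graph ph t" for t u v
    using phase_graph_connected[OF tot that(1)] that(2) by (auto simp: connected_graph_def)
  obtain \<pi> where \<pi>: "\<And>p. p<packets ph \<Longrightarrow> \<pi> p 0 \<in> A \<and> \<pi> p duration = dn p"
    "\<And>p t. p<packets ph \<Longrightarrow> t<duration \<Longrightarrow> \<pi> p t = \<pi> p (Suc t) \<or>
           (\<pi> p t, \<pi> p (Suc t)) \<in> phase_graph ph t \<and>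
           y (cell ph t (\<pi> p t) (\<pi> p (Suc t))) = Suc (p mod k)"
    "\<And>t u v. t<duration \<Longrightarrow> u<n \<Longrightarrow> v<n \<Longrightarrow> y (cell ph t u v) \<noteq> 0 \<Longrightarrow>
        (\<exists>p<packets ph. \<pi> p t = u \<and> \<pi> p (Suc t) = v \<and> u \<noteq> v \<and> y (cell ph t u v) = Suc (p mod k))"
    using r unfolding routed_def by blast
  have "\<pi> p t = \<pi> p (Suc t) \<or> (\<pi> p t, \<pi> p (Suc t)) \<in> phase_graph ph t \<and>
           y' (cell ph t (\<pi> p t) (\<pi> p (Suc t))) = Suc (p mod k)" if "p < packets ph" "t < duration" for p t
    using \<pi>(2)[OF that] less[OF that(2)] eq[OF that(2)] by metis
  moreover have "\<exists>p<packets ph. \<pi> p t = u \<and> \<pi> p (Suc t) = v \<and> u \<noteq> v \<and> y' (cell ph t u v) = Suc (p mod k)"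
    if "t < duration" "u < n" "v < n" "y' (cell ph t u v) \<noteq> 0" for t u v
    using \<pi>(3)[OF that(1-3)] that eq[OF that(1-3)] by simp
  ultimately show ?thesis unfolding routed_def using \<pi>(1) by (intro exI[of _ \<pi>]) simp
qed

text \<open>The zero cells are the blank output that the next phase relies on. At the end they show
  that nothing is sent after \<open>total\<close> rounds.\<close>

definition phases_done :: "(nat \<Rightarrow> nat) \<Rightarrow> nat \<Rightarrow> (nat \<Rightarrow> nat) \<Rightarrow> bool" where
  "phases_done c ph y \<longleftrightarrow>
     (\<forall>ph'<ph. \<exists>dn. dest_ok c ph' dn \<and> routed ph' (level c (ph' - 1)) dn y) \<and>
     (\<forall>r u v. ph * duration \<le> r \<longrightarrow> r < n * k \<longrightarrow> u < n \<longrightarrow> v < n \<longrightarrow> y ((r * n + u) * n + v) = 0)"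

lemma phases_done_zero:
  assumes "phases_done c ph y" "total \<le> n * k" "ph \<le> last_phase" "t < duration" "u < n" "v < n"
  shows "y (cell ph t u v) = 0"
proof -
  obtain a b where ab: "a < n" "b < n" "cell ph t u v = (round_of ph t * n + a) * n + b"
    by (rule cell_form[OF assms(5,6)])
  have "round_of ph t < n * k" using round_of_less[OF assms(3,4)] assms(2) by simp
  moreover have "ph * duration \<le> round_of ph t" by (simp add: round_of_def)
  ultimately show ?thesis using assms(1) ab unfolding phases_done_def by metis
qed

lemma phases_done_Suc:
  assumes prev: "phases_done c ph y" and tot: "total \<le> n * k" and ph: "ph \<le> last_phase"
    and new: "dest_ok c ph dn" "routed ph (level c (ph - 1)) dn y'"
    and frame: "\<And>i. y' i \<noteq> y i \<Longrightarrow> \<exists>t<duration. \<exists>u<n. \<exists>v<n. i = cell ph t u v"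
  shows "phases_done c (Suc ph) y'"
  unfolding phases_done_def
proof (intro conjI allI impI)
  fix ph' assume "ph' < Suc ph"
  show "\<exists>dn. dest_ok c ph' dn \<and> routed ph' (level c (ph' - 1)) dn y'"
  proof (cases "ph' = ph")
    case False
    then have ph': "ph' < ph" using \<open>ph' < Suc ph\<close> by simp
    then obtain dn' where dn': "dest_ok c ph' dn'" "routed ph' (level c (ph' - 1)) dn' y"
      using prev unfolding phases_done_def by blast
    \<comment> \<open>A common cell would put both phases into the same round, but the round
      determines the phase.\<close>
    have "y' (cell ph' t u v) = y (cell ph' t u v)" if tuv: "t < duration" "u < n" "v < n" for t u v
    proof (rule ccontr)
      assume "y' (cell ph' t u v) \<noteq> y (cell ph' t u v)"
      then obtain t' u' v' where *: "t' < duration" "u' < n" "v' < n" "cell ph' t u v = cell ph t' u' v'"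
        using frame by blast
      obtain a b where "a < n" "b < n" "cell ph' t u v = (round_of ph' t * n + a) * n + b"
        by (rule cell_form[OF tuv(2,3)])
      then have "round_of ph' t = round_of ph t'" using * by (intro cell_eq_round[of ph t' u' v' _ a b]) simp_all
      then show False using round_of_phase[OF tuv(1), of ph'] round_of_phase[OF *(1), of ph] False by simp
    qed
    then show ?thesis using routed_cong[OF dn'(2) tot _] dn'(1) ph ph' by (intro exI[of _ dn']) simp
  qed (use new in blast)
next
  fix r u v assume r: "Suc ph * duration \<le> r" "r < n * k" "u < n" "v < n"
  show "y' ((r * n + u) * n + v) = 0"
  proof (rule ccontr)
    assume nz: "y' ((r * n + u) * n + v) \<noteq> 0"
    have "y ((r * n + u) * n + v) = 0" using prev r unfolding phases_done_def by simp
    then obtain t u' v' where t: "t < duration" "u' < n" "v' < n" "(r * n + u) * n + v = cell ph t u' v'"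
      using nz frame by metis
    have "r = round_of ph t" by (rule cell_eq_round[OF t(4)[symmetric] t(2,3) r(3,4)])
    moreover have "round_of ph t < Suc ph * duration" using t(1) by (simp add: round_of_def)
    ultimately show False using r(1) by simp
  qed
qed

lemma run_phases_correct:
  assumes tot: "total \<le> n * k"
  shows "hoare bound (\<lambda>s. env_net c s \<and> reg s ''fail'' = 0 \<and> reg s ''pT'' = 0 \<and> arr s ''output'' = (\<lambda>_. 0)) run_phases
    (\<lambda>s. env s \<and> (reg s ''fail'' = 0 \<longrightarrow> phases_done c (Suc last_phase) (arr s ''output'')) \<and>
       ((\<forall>ph\<le>last_phase. phase_feasible c ph) \<longrightarrow> reg s ''fail'' = 0))"
proof -
  define J where "J ph s \<longleftrightarrow> reg s ''pT'' = ph * duration \<and> (reg s ''fail'' = 0 \<longrightarrow> phases_done c ph (arr s ''output'')) \<and>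
       ((\<forall>ph\<le>last_phase. phase_feasible c ph) \<longrightarrow> reg s ''fail'' = 0)" for ph and s :: state
  have "Suc last_phase * 1 \<le> total" unfolding total_def using duration_pos by (intro mult_le_mono2) simp
  then have b: "Suc last_phase \<le> bound" using tot by (simp add: bound_def length_input)
  have body: "hoare bound (\<lambda>s. (env_net c s \<and> True) \<and> J ph s \<and> reg s ''ph'' = ph)
     (Cond (BEq (Var ''fail'') (Const 0)) phase Skip ;; Assign ''pT'' (Plus (Var ''pT'') (Var ''T''))) (J (Suc ph))"
    if ph: "ph \<le> last_phase" for ph
  proof (rule hoare_Seq[where R = "\<lambda>s. env_net c s \<and> reg s ''pT'' = ph * duration \<and>
      (reg s ''fail'' = 0 \<longrightarrow> phases_done c (Suc ph) (arr s ''output'')) \<and> ((\<forall>ph\<le>last_phase. phase_feasible c ph) \<longrightarrow> reg s ''fail'' = 0)"])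
    let ?R = "\<lambda>s. env_net c s \<and> reg s ''pT'' = ph * duration \<and>
      (reg s ''fail'' = 0 \<longrightarrow> phases_done c (Suc ph) (arr s ''output'')) \<and> ((\<forall>ph\<le>last_phase. phase_feasible c ph) \<longrightarrow> reg s ''fail'' = 0)"
    show "hoare bound (\<lambda>s. (env_net c s \<and> True) \<and> J ph s \<and> reg s ''ph'' = ph) (Cond (BEq (Var ''fail'') (Const 0)) phase Skip) ?R"
    proof (rule hoare_Cond)
      show "hoare bound (\<lambda>s. ((env_net c s \<and> True) \<and> J ph s \<and> reg s ''ph'' = ph) \<and> \<not> bval (BEq (Var ''fail'') (Const 0)) s) Skip ?R"
        by (rule hoare_Skip) (auto simp: J_def)
      have "hoare bound (\<lambda>s. ((env_net c s \<and> True) \<and> J ph s \<and> reg s ''ph'' = ph) \<and> reg s ''fail'' = 0 \<and> arr s ''output'' = y) phase ?R" for y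
      proof (cases "phases_done c ph y")
        case False
        then show ?thesis by (intro hoare_False) (auto simp: J_def)
      next
        case True
        have st: "stable (\<lambda>s. env_net c s \<and> reg s ''pT'' = ph * duration) (written_regs phase) (written_arrs phase)"
          by (rule stable_env_net) (simp_all add: stable_simps)
        show ?thesis
        proof (rule hoare_conseq[OF hoare_frame[OF phase_correct[OF tot ph, of y c 0] st]])
          show "y (cell ph t u v) = 0" if "t < duration" "u < n" "v < n" for t u v
            using phases_done_zero[OF True tot ph that] .
        next
          fix s assume "((env_net c s \<and> True) \<and> J ph s \<and> reg s ''ph'' = ph) \<and> reg s ''fail'' = 0 \<and> arr s ''output'' = y"
          then show "(env_net c s \<and> reg s ''ph'' = ph \<and> reg s ''pT'' = ph * duration \<and> reg s ''fail'' = 0 \<and> arr s ''output'' = y) \<and>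
              env_net c s \<and> reg s ''pT'' = ph * duration" by (simp add: J_def)
        next
          fix s assume s: "((reg s ''fail'' = 0 \<longrightarrow> (0::nat) = 0 \<and>
                (\<exists>dn. dest_ok c ph dn \<and> routed ph (level c (ph - 1)) dn (arr s ''output'')) \<and>
                (\<forall>i. arr s ''output'' i \<noteq> y i \<longrightarrow> (\<exists>t<duration. \<exists>u<n. \<exists>v<n. i = cell ph t u v))) \<and>
             ((0::nat) = 0 \<and> phase_feasible c ph \<longrightarrow> reg s ''fail'' = 0)) \<and> env_net c s \<and> reg s ''pT'' = ph * duration"
          have "phases_done c (Suc ph) (arr s ''output'')" if "reg s ''fail'' = 0"
            using s that phases_done_Suc[OF True tot ph] by blast
          then show "?R s" using s ph by blast
        qed
      qed
      then have "hoare bound (\<lambda>s. \<exists>y. ((env_net c s \<and> True) \<and> J ph s \<and> reg s ''ph'' = ph) \<and> reg s ''fail'' = 0 \<and> arr s ''output'' = y) phase ?R"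
        by (rule hoare_ex)
      then show "hoare bound (\<lambda>s. ((env_net c s \<and> True) \<and> J ph s \<and> reg s ''ph'' = ph) \<and> bval (BEq (Var ''fail'') (Const 0)) s) phase ?R"
        by (rule hoare_pre) simp
    qed
    show "hoare bound ?R (Assign ''pT'' (Plus (Var ''pT'') (Var ''T''))) (J (Suc ph))"
    proof (rule hoare_Assign)
      fix s assume s: "?R s"
      then have "reg s ''T'' = duration" by (intro env_regs env_net_env) blast
      then show "J (Suc ph) (set_reg ''pT'' (aval (Plus (Var ''pT'') (Var ''T'')) s) s)" using s by (simp add: J_def)
    qed
  qed
  show ?thesis unfolding run_phases_def
  proof (rule hoare_For_conseq[where F = "\<lambda>s. env_net c s \<and> True" and N = "Suc last_phase" and I = J], goal_cases)
    case 2
    show ?case by (rule stable_env_net) (simp_all add: stable_simps)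
  next
    case (3 s)
    then show ?case by (simp add: env_regs[OF env_net_env[of c]])
  next
    case (7 j)
    show ?case by (rule body) (use 7 in simp)
  next
    case (8 s)
    then show ?case using env_net_env[of c s] by (simp add: J_def)
  qed (use b in \<open>simp_all add: J_def phases_done_def\<close>)
qed

lemma level_props: "level c 0 = {0}" "level c last_phase = {..<n}" "level c ph \<subseteq> {..<n}"
proof -
  show "level c 0 = {0}" using n_pos by (auto simp: level_def)
  show "level c ph \<subseteq> {..<n}" by (auto simp: level_def)
  show "level c last_phase = {..<n}"
  proof (cases "last_phase = 0")
    case True
    \<comment> \<open>No phases beyond the first means a single node, and then level 0 contains all
      nodes.\<close>
    then have "n \<le> 1" using log_ceil[of n] by (simp add: last_phase_def)
    then show ?thesis using n_pos by (auto simp: level_def)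
  qed (auto simp: level_def)
qed

lemma phases_done_schedule:
  assumes "phases_done c (Suc last_phase) y" "total \<le> n * k"
  shows "valid_schedule I (decode I y) \<and> disseminates I (decode I y) \<and> schedule_length I (decode I y) \<le> total"
proof -
  have "\<forall>ph. \<exists>dn. ph \<le> last_phase \<longrightarrow> dest_ok c ph dn \<and> routed ph (level c (ph - 1)) dn y"
    using assms(1) unfolding phases_done_def by (metis less_Suc_eq_le)
  then obtain dn where dn: "\<And>ph. ph \<le> last_phase \<Longrightarrow> dest_ok c ph (dn ph) \<and> routed ph (level c (ph - 1)) (dn ph) y"
    by metis
  \<comment> \<open>\<open>dn\<close> is determined only for existing phases and packets. Elsewhere
    it is completed by the formula that it satisfies there.\<close>
  define dn' where "dn' ph p = (if ph = 0 then dn 0 p else if p div k \<in> level c ph then p div k else 0)" for ph p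
  have routed: "routed ph (level c (ph - 1)) (dn' ph) y" if "ph \<le> last_phase" for ph
  proof -
    have "dn' ph p = dn ph p" if "p < packets ph" for p
      using dn[OF \<open>ph \<le> last_phase\<close>] that by (cases "ph = 0") (auto simp: dn'_def dest_ok_def packets_def)
    then show ?thesis using dn[OF that] unfolding routed_def by auto
  qed
  show ?thesis
  proof (rule routed_schedule[where B = "level c" and dn = dn'])
    show "(dn' 0 i, i) \<in> init I" if "i < k" for i
      using dn[of 0] that by (simp add: dest_ok_def dn'_def)
    show "dn' ph (u * k + i) = u" if "ph \<noteq> 0" "u \<in> level c ph" "i < k" for ph u i
      using that by (simp add: dn'_def)
    show "y ((r * n + u) * n + v) = 0" if "total \<le> r" "r < n * k" "u < n" "v < n" for r u v
      using assms(1) that unfolding phases_done_def total_def by blast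
  qed (use routed level_props assms(2) in simp_all)
qed

lemma schedule_length_nk: "schedule_length I S \<le> n * k"
  by (rule schedule_length_le) (simp add: rounds_def)

text \<open>The length bound includes the case that the phases do not fit: flooding then ends within
  \<open>n * k < total\<close> rounds. Only an infeasible phase can make the schedule too
  long.\<close>

lemma main_correct:
  "hoare bound (\<lambda>s. env s \<and> arr s ''coin'' = c \<and> arr s ''output'' = (\<lambda>_. 0)) main_com
    (\<lambda>s. let S = decode I (arr s ''output'') in valid_schedule I S \<and> disseminates I S \<and>
       ((total \<le> n * k \<longrightarrow> (\<forall>ph\<le>last_phase. phase_feasible c ph)) \<longrightarrow> schedule_length I S \<le> total))"
proof -
  let ?P = "\<lambda>s. env s \<and> arr s ''coin'' = c \<and> arr s ''output'' = (\<lambda>_. 0)"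
  let ?Q = "\<lambda>s. let S = decode I (arr s ''output'') in valid_schedule I S \<and> disseminates I S \<and>
       ((total \<le> n * k \<longrightarrow> (\<forall>ph\<le>last_phase. phase_feasible c ph)) \<longrightarrow> schedule_length I S \<le> total)"
  let ?R = "\<lambda>s. env s \<and> (reg s ''fail'' = 0 \<longrightarrow> total \<le> n * k \<and> phases_done c (Suc last_phase) (arr s ''output'')) \<and>
       (total \<le> n * k \<and> (\<forall>ph\<le>last_phase. phase_feasible c ph) \<longrightarrow> reg s ''fail'' = 0)"
  have env_set: "env (set_reg ''fail'' x s) = env s" "env (set_reg ''pT'' x s) = env s" for x s
    by (simp_all add: env_simps)
  have 1: "hoare bound (\<lambda>s. ?P s \<and> reg s ''fail'' = 0 \<and> reg s ''pT'' = 0)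
     (Cond (BLess (Var ''nk'') (Var ''tot'')) (Assign ''fail'' (Const 1)) (prepare ;; run_phases)) ?R"
  proof (rule hoare_Cond)
    show "hoare bound (\<lambda>s. (?P s \<and> reg s ''fail'' = 0 \<and> reg s ''pT'' = 0) \<and> bval (BLess (Var ''nk'') (Var ''tot'')) s)
        (Assign ''fail'' (Const 1)) ?R"
      by (rule hoare_Assign) (auto simp: env_set env_regs)
    show "hoare bound (\<lambda>s. (?P s \<and> reg s ''fail'' = 0 \<and> reg s ''pT'' = 0) \<and> \<not> bval (BLess (Var ''nk'') (Var ''tot'')) s)
        (prepare ;; run_phases) ?R"
    proof (cases "total \<le> n * k")
      case False
      then show ?thesis by (intro hoare_False) (auto simp: env_regs)
    next
      case True
      let ?G = "\<lambda>s. reg s ''fail'' = 0 \<and> reg s ''pT'' = 0 \<and> arr s ''output'' = (\<lambda>_. 0)"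
      have st: "stable ?G (written_regs prepare) (written_arrs prepare)" by (simp add: stable_simps)
      show ?thesis
      proof (rule hoare_Seq_frame[OF prepare_correct[OF True, of c] st])
        show "hoare bound (\<lambda>s. env_net c s \<and> ?G s) run_phases ?R"
          by (rule hoare_post[OF run_phases_correct[OF True, of c]]) (use True in simp)
      qed simp
    qed
  qed
  have 2: "hoare bound ?R (Cond (BEq (Var ''fail'') (Const 0)) Skip flood) ?Q"
  proof (rule hoare_Cond)
    show "hoare bound (\<lambda>s. ?R s \<and> bval (BEq (Var ''fail'') (Const 0)) s) Skip ?Q"
      by (rule hoare_Skip) (use phases_done_schedule in \<open>auto simp: Let_def\<close>)
    show "hoare bound (\<lambda>s. ?R s \<and> \<not> bval (BEq (Var ''fail'') (Const 0)) s) flood ?Q"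
    proof (cases "total \<le> n * k \<and> (\<forall>ph\<le>last_phase. phase_feasible c ph)")
      case True
      then show ?thesis by (intro hoare_False) auto
    next
      case False
      have "?Q s" if "filled n (arr s ''output'') flood_value (n * k * n) 0" for s
        using flood_schedule[OF that] schedule_length_nk[of "decode I (arr s ''output'')"] False
        by (auto simp: Let_def)
      then show ?thesis by (intro hoare_conseq[OF flood_correct]) simp_all
    qed
  qed
  show ?thesis unfolding main_com_def
    apply (rule hoare_Seq[where R = "\<lambda>s. ?P s \<and> reg s ''fail'' = 0"])
     apply (rule hoare_Assign, simp add: env_set)
    apply (rule hoare_Seq[OF hoare_Assign hoare_Seq[OF 1 2]])
    apply (simp add: env_set)
    done
qed

end

subsection \<open>Random levels\<close>

text \<open>Conditioning on the first stage; used to fix all coins except those of one row.\<close>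

lemma prob_bind_pmf_le:
  assumes "\<And>x. x \<in> set_pmf p \<Longrightarrow> measure_pmf.prob (f x) E \<le> c" "0 \<le> c"
  shows "measure_pmf.prob (bind_pmf p f) E \<le> c"
proof -
  have "emeasure (bind_pmf p f) E = (\<integral>\<^sup>+x. emeasure (f x) E \<partial>p)" by simp
  also have "\<dots> \<le> (\<integral>\<^sup>+x. ennreal c \<partial>p)"
    using assms by (intro nn_integral_mono_AE) (auto simp: AE_measure_pmf_iff measure_pmf.emeasure_eq_measure)
  also have "\<dots> = ennreal c" by simp
  finally show ?thesis using assms(2) by (simp add: measure_pmf.emeasure_eq_measure)
qed

text \<open>Transfers the probability of favourable coins to the run of the program that uses
  them.\<close>

lemma prob_bind_pmf_ge:
  assumes "\<And>x. x \<in> set_pmf p \<Longrightarrow> x \<in> A \<Longrightarrow> measure_pmf.prob (f x) E = 1"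
  shows "measure_pmf.prob p A \<le> measure_pmf.prob (bind_pmf p f) E"
proof -
  have "emeasure p A = (\<integral>\<^sup>+x. indicator A x \<partial>p)" by simp
  also have "\<dots> \<le> (\<integral>\<^sup>+x. emeasure (f x) E \<partial>p)"
    using assms by (intro nn_integral_mono_AE)
      (auto simp: AE_measure_pmf_iff measure_pmf.emeasure_eq_measure indicator_def)
  also have "\<dots> = emeasure (bind_pmf p f) E" by simp
  finally show ?thesis by (simp add: measure_pmf.emeasure_eq_measure)
qed

text \<open>Markov's inequality for the number of events that occur. No independence is involved,
  which is essential because all rounds of a phase share the same coins.\<close>

lemma prob_many_le:
  assumes T: "finite T" and B: "\<And>t. t \<in> T \<Longrightarrow> measure_pmf.prob p (B t) \<le> \<epsilon>" and m: "0 < m"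
  shows "measure_pmf.prob p {\<omega>. m \<le> card {t \<in> T. \<omega> \<in> B t}} \<le> real (card T) * \<epsilon> / real m"
proof -
  let ?u = "\<lambda>\<omega>. \<Sum>t\<in>T. indicat_real (B t) \<omega>"
  have u: "?u \<omega> = real (card {t \<in> T. \<omega> \<in> B t})" for \<omega>
    using T by (simp add: indicator_def of_bool_def[symmetric] sum.If_cases Int_def)
  have int: "integrable p (indicat_real (B t))" for t
    by (rule measure_pmf.integrable_const_bound[where B = 1]) auto
  have "measure_pmf.prob p {\<omega>. m \<le> card {t \<in> T. \<omega> \<in> B t}} = measure p {\<omega> \<in> space p. ?u \<omega> \<ge> real m}"
    by (simp add: u)
  also have "\<dots> \<le> (\<integral>\<omega>. ?u \<omega> \<partial>p) / real m"
    by (rule integral_Markov_inequality_measure[where A = "{}"])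
      (use int m in \<open>auto intro!: Bochner_Integration.integrable_sum sum_nonneg\<close>)
  also have "(\<integral>\<omega>. ?u \<omega> \<partial>p) = (\<Sum>t\<in>T. measure_pmf.prob p (B t))"
    using int by (subst Bochner_Integration.integral_sum) auto
  also have "\<dots> \<le> real (card T) * \<epsilon>" using sum_mono[of T "\<lambda>t. measure_pmf.prob p (B t)" "\<lambda>_. \<epsilon>", OF B] by simp
  finally show ?thesis using m by (simp add: divide_right_mono)
qed

definition coins :: "nat set \<Rightarrow> (nat \<Rightarrow> bool) pmf" where
  "coins A = Pi_pmf A False (\<lambda>_. bernoulli_pmf (1/2))"

lemma prob_coins:
  assumes A: "finite A" and K: "K \<subseteq> A"
  shows "measure_pmf.prob (coins A) {\<omega>. \<forall>x\<in>K. \<omega> x = b} = (1/2) ^ card K"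
proof -
  let ?B = "\<lambda>x. if x \<in> K then {b} else UNIV"
  have half: "measure_pmf.prob (bernoulli_pmf (1/2)) {b} = 1/2" for b
    by (cases b) (simp_all add: measure_pmf_single)
  have "{\<omega>. \<forall>x\<in>K. \<omega> x = b} = Pi A ?B" using K by (auto simp: Pi_def)
  then have "measure_pmf.prob (coins A) {\<omega>. \<forall>x\<in>K. \<omega> x = b} = (\<Prod>x\<in>A. measure_pmf.prob (bernoulli_pmf (1/2)) (?B x))"
    unfolding coins_def using A by (simp add: measure_Pi_pmf_Pi)
  also have "\<dots> = (\<Prod>x\<in>A. if x \<in> K then 1/2 else 1)"
    by (intro prod.cong refl) (simp add: half)
  also have "\<dots> = (1/2) ^ card K" using A K by (simp add: prod.If_cases Int_absorb1)
  finally show ?thesis .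
qed

lemma coins_union:
  assumes "finite A" "finite B" "A \<inter> B = {}"
  shows "coins (A \<union> B) = bind_pmf (coins A) (\<lambda>f. map_pmf (\<lambda>g x. if x \<in> A then f x else g x) (coins B))"
  unfolding coins_def Pi_pmf_union[OF assms] pair_pmf_def by (simp add: map_bind_pmf map_pmf_def bind_assoc_pmf bind_return_pmf)

text \<open>
  The coins \<open>r ` {..<n}\<close> are fresh: the set \<open>X\<close> does not depend on them.  A window of \<open>q\<close> consecutive
  members of \<open>X\<close> is missed by the random subset \<open>A\<close> with probability at most \<open>2 ^ - q\<close>.
\<close>

lemma prob_unhit_window:
  fixes X A :: "(nat \<Rightarrow> bool) \<Rightarrow> nat set" and r :: "nat \<Rightarrow> nat"
  assumes fin: "finite N" and R: "r ` {..<n} \<subseteq> N" "inj_on r {..<n}"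
    and X: "\<And>\<omega> \<omega>'. (\<And>x. x \<in> N - r ` {..<n} \<Longrightarrow> \<omega> x = \<omega>' x) \<Longrightarrow> X \<omega> = X \<omega>'"
    and A: "\<And>\<omega> v. v < n \<Longrightarrow> v \<in> X \<omega> \<Longrightarrow> \<omega> (r v) \<Longrightarrow> v \<in> A \<omega>"
    and xs: "distinct xs" "set xs = {..<n}" and q: "0 < q"
  shows "measure_pmf.prob (coins N) {\<omega>. \<not> hit_windows q (A \<omega>) (filter (\<lambda>v. v \<in> X \<omega>) xs)} \<le> real n * (1/2) ^ q"
proof -
  let ?R = "r ` {..<n}"
  let ?E = "{\<omega>. \<not> hit_windows q (A \<omega>) (filter (\<lambda>v. v \<in> X \<omega>) xs)}"
  have N: "N = (N - ?R) \<union> ?R" using R by blast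
  \<comment> \<open>All coins outside the row are fixed to those of \<open>f\<close>. Then
    \<open>X\<close>, and with it the list and its windows, is no longer random.\<close>
  have each: "measure_pmf.prob (map_pmf (\<lambda>g x. if x \<in> N - ?R then f x else g x) (coins ?R)) ?E \<le> real n * (1/2) ^ q" for f
  proof -
    let ?m = "\<lambda>g x. if x \<in> N - ?R then f x else g x"
    define ys where "ys = filter (\<lambda>v. v \<in> X f) xs"
    have Xm: "X (?m g) = X f" for g by (rule X) simp
    have len: "length ys \<le> n"
    proof -
      have "length ys \<le> length xs" by (simp add: ys_def)
      also have "\<dots> = n" using distinct_card[OF xs(1)] xs(2) by simp
      finally show ?thesis .
    qed
    have ysn: "j < length ys \<Longrightarrow> ys ! j < n \<and> ys ! j \<in> X f" for j
      using nth_mem[of j ys] xs by (auto simp: ys_def)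
    let ?J = "{j. j + q \<le> length ys}"
    let ?K = "\<lambda>j. (\<lambda>l. r (ys ! l)) ` {j..<j + q}"
    have finJ: "finite ?J" "card ?J \<le> n"
    proof -
      have "?J \<subseteq> {..<length ys}" using q by auto
      then show "finite ?J" "card ?J \<le> n" using len card_mono[of "{..<length ys}" ?J] finite_subset by auto
    qed
    have "?m -` ?E \<subseteq> (\<Union>j\<in>?J. {g. \<forall>x\<in>?K j. g x = False})"
    proof
      fix g assume "g \<in> ?m -` ?E"
      then have "\<not> hit_windows q (A (?m g)) ys"
        unfolding vimage_eq mem_Collect_eq Xm ys_def .
      then obtain j where j: "j + q \<le> length ys" "\<And>l. l \<in> {j..<j + q} \<Longrightarrow> ys ! l \<notin> A (?m g)"
        by (auto simp: hit_windows_def)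
      \<comment> \<open>A head would put this member of the window into \<open>A\<close>.\<close>
      have "g (r (ys ! l)) = False" if "l \<in> {j..<j + q}" for l
      proof (rule ccontr)
        assume "g (r (ys ! l)) \<noteq> False"
        then have "?m g (r (ys ! l))" using ysn[of l] that j(1) by auto
        then have "ys ! l \<in> A (?m g)" using ysn[of l] that j(1) A[of "ys ! l" "?m g"] Xm by auto
        then show False using j(2)[OF that] by simp
      qed
      then show "g \<in> (\<Union>j\<in>?J. {g. \<forall>x\<in>?K j. g x = False})" using j(1) by blast
    qed
    then have "measure_pmf.prob (coins ?R) (?m -` ?E) \<le> measure_pmf.prob (coins ?R) (\<Union>j\<in>?J. {g. \<forall>x\<in>?K j. g x = False})"
      by (intro measure_pmf.finite_measure_mono) auto
    also have "\<dots> \<le> (\<Sum>j\<in>?J. measure_pmf.prob (coins ?R) {g. \<forall>x\<in>?K j. g x = False})"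
      using finJ by (intro measure_pmf.finite_measure_subadditive_finite) auto
    also have "\<dots> = (\<Sum>j\<in>?J. (1/2) ^ q)"
    proof (rule sum.cong[OF refl])
      fix j assume "j \<in> ?J"
      then have lt: "l \<in> {j..<j + q} \<Longrightarrow> l < length ys" for l by auto
      have "inj_on (\<lambda>l. r (ys ! l)) {j..<j + q}"
      proof (rule inj_onI)
        fix l l' assume l: "l \<in> {j..<j + q}" "l' \<in> {j..<j + q}" "r (ys ! l) = r (ys ! l')"
        then have "ys ! l = ys ! l'" using inj_onD[OF R(2) l(3)] ysn lt by auto
        then show "l = l'" using nth_eq_iff_index_eq[of ys l l'] lt l xs(1) by (simp add: ys_def)
      qed
      then have "card (?K j) = q" by (simp add: card_image)
      moreover have "?K j \<subseteq> ?R" using ysn lt by auto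
      ultimately show "measure_pmf.prob (coins ?R) {g. \<forall>x\<in>?K j. g x = False} = (1/2) ^ q"
        using prob_coins[of ?R "?K j" False] by simp
    qed
    also have "\<dots> \<le> real n * (1/2) ^ q" using finJ by simp
    finally show ?thesis by (simp add: measure_map_pmf)
  qed
  have "coins ((N - ?R) \<union> ?R) = bind_pmf (coins (N - ?R)) (\<lambda>f. map_pmf (\<lambda>g x. if x \<in> N - ?R then f x else g x) (coins ?R))"
    by (rule coins_union) (use fin in auto)
  then have cN: "coins N = bind_pmf (coins (N - ?R)) (\<lambda>f. map_pmf (\<lambda>g x. if x \<in> N - ?R then f x else g x) (coins ?R))"
    unfolding N[symmetric] .
  show ?thesis unfolding cN by (rule prob_bind_pmf_le[OF each]) simp
qed

context gossip_locale
begin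

section \<open>Probability that some phase is infeasible\<close>

definition spread_good :: "(nat \<Rightarrow> nat) \<Rightarrow> nat \<Rightarrow> bool" where
  "spread_good c ph \<longleftrightarrow> n + k * width \<le>
     card {t. t < duration \<and> good_round width (level c (ph - 1)) (level c ph) (phase_graph ph t)}"

text \<open>The coins matter only through \<open>spread_good\<close>; gathering is feasible for all
  coins.\<close>

lemma phase_feasibleI:
  assumes tot: "total \<le> n * k" and ph: "ph \<le> last_phase" and good: "0 < ph \<Longrightarrow> spread_good c ph"
  shows "phase_feasible c ph"
  unfolding phase_feasible_def
proof (intro allI impI)
  fix dn dest assume dn: "dest_ok c ph dn" and dest: "\<forall>p<packets ph. dest p = duration * n + dn p"
  note conn = phase_graph_connected[OF tot ph]
  show "cut_condition W (capacity c ph) dest {..<packets ph} src"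
  proof (cases "ph = 0")
    case True
    have "n + k \<le> duration" by (simp add: duration_def width_def)
    moreover have "k \<le> n * k" using n_pos by simp
    moreover have "level c (ph - 1) = {0}" using level_props(1) True by simp
    ultimately show ?thesis
      using gather_cut_condition[OF n_pos, of k duration "n * k" "phase_graph 0" dest dn] conn dn dest True
      by (simp add: W_def src_def capacity_def packets_def dest_ok_def)
  next
    case False
    have 0: "0 \<in> level c (ph - 1)" using n_pos by (simp add: level_def)
    have "dest p = duration * n + (if p div k \<in> level c ph then p div k else 0)" if "p < n * k" for p
      using dn dest that False by (simp add: dest_ok_def packets_def)
    then show ?thesis
      using spread_cut_condition[OF n_pos _ level_props(3) 0 conn good[unfolded spread_good_def]] False
      by (simp add: W_def src_def capacity_def packets_def width_def)
  qed
qed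

definition coin_array :: "(nat \<Rightarrow> bool) \<Rightarrow> nat \<Rightarrow> nat" where
  "coin_array \<omega> i = of_bool (i < length input \<and> \<omega> i)"

lemma coin_index:
  assumes "total \<le> n * k" "i < last_phase" "v < n"
  shows "i * n + v < length input"
proof -
  have "last_phase \<le> n * k"
  proof -
    have "Suc last_phase * 1 \<le> total" unfolding total_def using duration_pos by (intro mult_le_mono2) simp
    then show ?thesis using assms(1) by simp
  qed
  then show ?thesis using row_less_length[of i v] assms(2,3) by simp
qed

text \<open>Row \<open>last_phase - ph\<close> decides which members of level \<open>ph\<close> stay
  in level \<open>ph - 1\<close>, while level \<open>ph\<close> itself does not depend on it. Hence
  the window bound applies to each round. Phase 1 is different, as level 0 is not drawn by
  coins.\<close>

lemma prob_not_spread_good: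
  assumes tot: "total \<le> n * k" and ph: "1 < ph" "ph \<le> last_phase"
  shows "measure_pmf.prob (coins {..<length input}) {\<omega>. \<not> spread_good (coin_array \<omega>) ph} \<le> 2 * real n * (1/2) ^ width"
proof -
  let ?N = "{..<length input}" and ?i = "last_phase - ph"
  let ?r = "\<lambda>v. ?i * n + v"
  let ?X = "\<lambda>\<omega>. level (coin_array \<omega>) ph" and ?A = "\<lambda>\<omega>. level (coin_array \<omega>) (ph - 1)"
  have i: "?i < last_phase" "last_phase - (ph - 1) = Suc ?i" using ph by auto
  let ?B = "\<lambda>t. {\<omega>. \<not> good_round width (?A \<omega>) (?X \<omega>) (phase_graph ph t)}"
  have w: "0 < width" by (simp add: width_def)
  have B: "measure_pmf.prob (coins ?N) (?B t) \<le> real n * (1/2) ^ width" if t: "t < duration" for t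
  proof -
    obtain xs where xs: "distinct xs" "set xs = {..<n}"
      "\<And>C. 0 \<notin> C \<Longrightarrow> entries C False xs \<le> cut_edges (phase_graph ph t) C"
      using arrangement_exists[OF phase_graph_connected[OF tot ph(2) t] n_pos] by metis
    have "?B t \<subseteq> {\<omega>. \<not> hit_windows width (?A \<omega>) (filter (\<lambda>v. v \<in> ?X \<omega>) xs)}"
    proof
      fix \<omega> assume "\<omega> \<in> ?B t"
      moreover have "0 \<in> ?A \<omega>" using n_pos by (simp add: level_def)
      ultimately show "\<omega> \<in> {\<omega>. \<not> hit_windows width (?A \<omega>) (filter (\<lambda>v. v \<in> ?X \<omega>) xs)}"
        using good_roundI[OF xs level_props(3), of "?A \<omega>" width "coin_array \<omega>" ph] by blast
    qed
    then have "measure_pmf.prob (coins ?N) (?B t) \<le>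
        measure_pmf.prob (coins ?N) {\<omega>. \<not> hit_windows width (?A \<omega>) (filter (\<lambda>v. v \<in> ?X \<omega>) xs)}"
      by (intro measure_pmf.finite_measure_mono) auto
    also have "\<dots> \<le> real n * (1/2) ^ width"
    proof (rule prob_unhit_window[where r = ?r, OF _ _ _ _ _ xs(1,2) w])
      show "?r ` {..<n} \<subseteq> ?N" using coin_index[OF tot i(1)] by auto
      show "inj_on ?r {..<n}" by (simp add: inj_on_def)
      show "?X \<omega> = ?X \<omega>'" if eq: "\<And>x. x \<in> ?N - ?r ` {..<n} \<Longrightarrow> \<omega> x = \<omega>' x" for \<omega> \<omega>'
      proof -
        have "coin_array \<omega> (j * n + v) = coin_array \<omega>' (j * n + v)" if "j < ?i" "v < n" for j v
        proof (cases "j * n + v < length input")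
          case True
          have "j * n + v \<notin> ?r ` {..<n}"
          proof
            assume "j * n + v \<in> ?r ` {..<n}"
            then obtain v' where "v' < n" "j * n + v = ?i * n + v'" by auto
            then have "j = ?i" using index_eq_iff[OF that(2)] by blast
            then show False using that(1) by simp
          qed
          then show ?thesis using eq True by (simp add: coin_array_def)
        qed (simp add: coin_array_def)
        then show ?thesis by (auto simp: level_def)
      qed
      show "v \<in> ?A \<omega>" if "v < n" "v \<in> ?X \<omega>" "\<omega> (?r v)" for \<omega> v
      proof -
        have "0 < coin_array \<omega> (?r v)" using that coin_index[OF tot i(1)] by (simp add: coin_array_def)
        then show ?thesis using that(2) ph unfolding level_def i(2) by (auto simp: less_Suc_eq)
      qed
    qed simp
    finally show ?thesis .
  qed
  let ?m = "n + k * width"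
  \<comment> \<open>If the phase is not good, at least \<open>?m\<close> of its
    \<open>2 * ?m\<close> rounds are bad. The ratio is the factor 2 of the result.\<close>
  have dur: "duration = 2 * ?m" by (simp add: duration_def)
  have gen: "2 * m * z / m = 2 * z" if "0 < m" for m z :: real using that by simp
  have "{\<omega>. \<not> spread_good (coin_array \<omega>) ph} \<subseteq> {\<omega>. ?m \<le> card {t \<in> {..<duration}. \<omega> \<in> ?B t}}"
  proof
    fix \<omega> assume bad: "\<omega> \<in> {\<omega>. \<not> spread_good (coin_array \<omega>) ph}"
    let ?G = "{t. t < duration \<and> good_round width (?A \<omega>) (?X \<omega>) (phase_graph ph t)}"
    have "card {..<duration} = card (?G \<union> {t \<in> {..<duration}. \<omega> \<in> ?B t})"
      by (rule arg_cong[of _ _ card]) auto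
    then have "duration \<le> card ?G + card {t \<in> {..<duration}. \<omega> \<in> ?B t}"
      using card_Un_le[of ?G "{t \<in> {..<duration}. \<omega> \<in> ?B t}"] unfolding card_lessThan by linarith
    then show "\<omega> \<in> {\<omega>. ?m \<le> card {t \<in> {..<duration}. \<omega> \<in> ?B t}}"
      using bad dur by (simp add: spread_good_def)
  qed
  then have "measure_pmf.prob (coins ?N) {\<omega>. \<not> spread_good (coin_array \<omega>) ph} \<le>
      measure_pmf.prob (coins ?N) {\<omega>. ?m \<le> card {t \<in> {..<duration}. \<omega> \<in> ?B t}}"
    by (intro measure_pmf.finite_measure_mono) auto
  also have "\<dots> \<le> real (card {..<duration}) * (real n * (1/2) ^ width) / real ?m"
    by (rule prob_many_le) (use B n_pos in auto)
  also have "real (card {..<duration}) = 2 * real ?m" by (simp add: dur)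
  also have "2 * real ?m * (real n * (1/2) ^ width) / real ?m = 2 * (real n * (1/2) ^ width)"
  proof (rule gen)
    have "0 < ?m" using n_pos by simp
    then show "0 < real ?m" unfolding of_nat_0_less_iff .
  qed
  also have "\<dots> = 2 * real n * (1/2) ^ width" by simp
  finally show ?thesis .
qed

text \<open>If level 1 is just node 0, every round is good by \<open>good_round_subset\<close>.
  Otherwise some node shows heads in \<open>last_phase - 1\<close> rows, and a union bound over the
  nodes applies.\<close>

lemma prob_not_first_good:
  assumes tot: "total \<le> n * k" and last: "0 < last_phase"
  shows "measure_pmf.prob (coins {..<length input}) {\<omega>. \<not> spread_good (coin_array \<omega>) 1} \<le> real n * (1/2) ^ (last_phase - 1)"
proof -
  let ?N = "{..<length input}"
  let ?K = "\<lambda>v. (\<lambda>i. i * n + v) ` {..<last_phase - 1}"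
  have "{\<omega>. \<not> spread_good (coin_array \<omega>) 1} \<subseteq> (\<Union>v\<in>{..<n}. {\<omega>. \<forall>x\<in>?K v. \<omega> x = True})"
  proof
    fix \<omega> assume bad: "\<omega> \<in> {\<omega>. \<not> spread_good (coin_array \<omega>) 1}"
    have "\<not> level (coin_array \<omega>) 1 \<subseteq> {0}"
    proof
      assume "level (coin_array \<omega>) 1 \<subseteq> {0}"
      then have "{t. t < duration \<and> good_round width (level (coin_array \<omega>) (1 - 1)) (level (coin_array \<omega>) 1) (phase_graph 1 t)} = {..<duration}"
        using level_props(1) good_round_subset by auto
      then show False using bad by (simp add: spread_good_def duration_def)
    qed
    then obtain v where v: "v \<in> level (coin_array \<omega>) 1" "v \<noteq> 0" by blast
    then have "v < n" "\<And>i. i < last_phase - 1 \<Longrightarrow> \<omega> (i * n + v)"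
      by (auto simp: level_def coin_array_def)
    then show "\<omega> \<in> (\<Union>v\<in>{..<n}. {\<omega>. \<forall>x\<in>?K v. \<omega> x = True})" by auto
  qed
  then have "measure_pmf.prob (coins ?N) {\<omega>. \<not> spread_good (coin_array \<omega>) 1} \<le>
      measure_pmf.prob (coins ?N) (\<Union>v\<in>{..<n}. {\<omega>. \<forall>x\<in>?K v. \<omega> x = True})"
    by (intro measure_pmf.finite_measure_mono) auto
  also have "\<dots> \<le> (\<Sum>v\<in>{..<n}. measure_pmf.prob (coins ?N) {\<omega>. \<forall>x\<in>?K v. \<omega> x = True})"
    by (intro measure_pmf.finite_measure_subadditive_finite) auto
  also have "\<dots> = (\<Sum>v\<in>{..<n}. (1/2) ^ (last_phase - 1))"
  proof (rule sum.cong[OF refl])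
    fix v assume v: "v \<in> {..<n}"
    have "inj_on (\<lambda>i. i * n + v) {..<last_phase - 1}" using n_pos by (simp add: inj_on_def)
    then have "card (?K v) = last_phase - 1" by (simp add: card_image)
    moreover have "?K v \<subseteq> ?N" using coin_index[OF tot] v by auto
    ultimately show "measure_pmf.prob (coins ?N) {\<omega>. \<forall>x\<in>?K v. \<omega> x = True} = (1/2) ^ (last_phase - 1)"
      using prob_coins[of ?N "?K v" True] by simp
  qed
  finally show ?thesis by simp
qed

lemma prob_feasible:
  assumes tot: "total \<le> n * k" and n2: "2 \<le> n"
  shows "1 - 1 / real n \<le> measure_pmf.prob (coins {..<length input}) {\<omega>. \<forall>ph\<le>last_phase. phase_feasible (coin_array \<omega>) ph}"
proof -
  let ?P = "measure_pmf.prob (coins {..<length input})"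
  let ?F = "\<lambda>ph. {\<omega>. \<not> spread_good (coin_array \<omega>) ph}"
  define l where "l = log_ceil n"
  have l: "n \<le> 2 ^ l" "l \<le> n" "0 < l"
  proof -
    show le: "n \<le> 2 ^ l" "l \<le> n" using log_ceil log_ceil_le by (simp_all add: l_def)
    show "0 < l" using le(1) n2 by (cases l) simp_all
  qed
  have inv: "(1/2) ^ l \<le> 1 / real n"
  proof -
    have "real n \<le> 2 ^ l" using l(1) by (metis of_nat_le_iff of_nat_numeral of_nat_power)
    then show ?thesis using n2 by (simp add: field_simps power_divide)
  qed
  have last: "last_phase = 4 * l" "width = 8 * l + 1" by (simp_all add: last_phase_def width_def l_def)
  have "?P (- {\<omega>. \<forall>ph\<le>last_phase. phase_feasible (coin_array \<omega>) ph}) \<le> ?P (?F 1 \<union> (\<Union>ph\<in>{2..last_phase}. ?F ph))"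
  proof (rule measure_pmf.finite_measure_mono)
    show "- {\<omega>. \<forall>ph\<le>last_phase. phase_feasible (coin_array \<omega>) ph} \<subseteq> ?F 1 \<union> (\<Union>ph\<in>{2..last_phase}. ?F ph)"
    proof
      fix \<omega> assume "\<omega> \<in> - {\<omega>. \<forall>ph\<le>last_phase. phase_feasible (coin_array \<omega>) ph}"
      then obtain ph where ph: "ph \<le> last_phase" "\<not> phase_feasible (coin_array \<omega>) ph" by auto
      then have "0 < ph" "\<not> spread_good (coin_array \<omega>) ph" using phase_feasibleI[OF tot] by blast+
      then show "\<omega> \<in> ?F 1 \<union> (\<Union>ph\<in>{2..last_phase}. ?F ph)" using ph(1) by (cases "ph = 1") auto
    qed
  qed simp
  also have "\<dots> \<le> ?P (?F 1) + ?P (\<Union>ph\<in>{2..last_phase}. ?F ph)"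
    by (rule measure_Un_le) auto
  also have "?P (\<Union>ph\<in>{2..last_phase}. ?F ph) \<le> (\<Sum>ph\<in>{2..last_phase}. ?P (?F ph))"
    by (rule measure_pmf.finite_measure_subadditive_finite) auto
  also have "\<dots> \<le> (\<Sum>ph\<in>{2..last_phase}. 2 * real n * (1/2) ^ width)"
    by (rule sum_mono, rule prob_not_spread_good[OF tot]) auto
  \<comment> \<open>A generous count of the phases: \<open>last_phase = 4 * l\<close> and
    \<open>l \<le> n\<close>.\<close>
  also have "\<dots> \<le> real (4 * n) * (2 * real n * (1/2) ^ width)"
  proof -
    have "real (card {2..last_phase}) \<le> real (4 * n)" using l(2) last(1) by simp
    then show ?thesis unfolding sum_constant by (rule mult_right_mono) simp
  qed
  also have "?P (?F 1) \<le> real n * (1/2) ^ (last_phase - 1)"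
    using prob_not_first_good[OF tot] last l(3) by simp
  finally have "?P (- {\<omega>. \<forall>ph\<le>last_phase. phase_feasible (coin_array \<omega>) ph}) \<le>
      real n * (1/2) ^ (last_phase - 1) + real (4 * n) * (2 * real n * (1/2) ^ width)" by simp
  also have "\<dots> \<le> 1 / real n"
  proof -
    \<comment> \<open>In terms of \<open>a\<close> the two contributions are at most
      \<open>2 * a^3\<close> and \<open>4 * a^6\<close>, and \<open>a \<le> 1/2\<close> bounds each
      of them by \<open>a / 2\<close>.\<close>
    define a where "a = 1 / real n"
    have a: "0 < a" "a \<le> 1/2" "real n = 1 / a" using n2 by (auto simp: a_def field_simps)
    have la: "0 \<le> (1/2 :: real) ^ l" "(1/2) ^ l \<le> a" using inv by (auto simp: a_def)
    have "(1/2 :: real) ^ (last_phase - 1) = 2 * ((1/2) ^ l) ^ 4"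
    proof -
      have "(1/2 :: real) ^ last_phase = (1/2) * (1/2) ^ (last_phase - 1)"
        using l(3) last(1) by (metis power_Suc Suc_diff_1 mult_pos_pos zero_less_numeral)
      moreover have "(1/2 :: real) ^ last_phase = ((1/2) ^ l) ^ 4" unfolding last by (metis power_mult mult.commute)
      ultimately show ?thesis by simp
    qed
    then have 1: "(1/2 :: real) ^ (last_phase - 1) \<le> 2 * a ^ 4" using la by (simp add: power_mono)
    have "(1/2 :: real) ^ width = (1/2) * ((1/2) ^ l) ^ 8"
      unfolding last by (simp add: power_mult[symmetric] mult.commute)
    then have 2: "(1/2 :: real) ^ width \<le> (1/2) * a ^ 8" using la by (simp add: power_mono)
    have "real n * (1/2) ^ (last_phase - 1) + real (4 * n) * (2 * real n * (1/2) ^ width)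
        \<le> (1/a) * (2 * a ^ 4) + (4 * (1/a)) * (2 * (1/a) * ((1/2) * a ^ 8))"
      using 1 2 a(1) by (intro add_mono mult_mono) (simp_all add: a(3))
    also have "\<dots> = 2 * a ^ 2 * a + 4 * a ^ 5 * a"
      using a(1) by (simp add: field_simps power_numeral_reduce)
    also have "\<dots> \<le> (1/2) * a + (1/2) * a"
    proof (intro add_mono mult_right_mono)
      show "2 * a ^ 2 \<le> 1/2" using power_mono[of a "1/2" 2] a by (simp add: power2_eq_square)
      show "4 * a ^ 5 \<le> 1/2" using power_mono[of a "1/2" 5] a by (simp add: power_divide)
    qed (use a in simp_all)
    finally show ?thesis by (simp add: a_def)
  qed
  finally show ?thesis
    using measure_pmf.prob_compl[of "{\<omega>. \<forall>ph\<le>last_phase. phase_feasible (coin_array \<omega>) ph}" "coins {..<length input}"]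
    by (simp add: Compl_eq_Diff_UNIV)
qed

end

subsection \<open>The algorithm\<close>

text \<open>One coin per input bit is enough for the levels when \<open>total \<le> n * k\<close>,
  and this number is available before the input has been parsed.\<close>

definition flip_coins :: com where
  "flip_coins = For ''a'' (Var ''length'') (Flip ''b'' ;; Store ''coin'' (Var ''a'') (Var ''b''))"

definition gossip_alg :: com where
  "gossip_alg = flip_coins ;; setup_com ;; main_com"

text \<open>Here the distribution of a run is needed and not only its support. An iteration takes
  exactly 7 steps: 5 for the body, one to leave it and one for the test. The induction is on the
  number \<open>d\<close> of coins still to be flipped, whose joint law is extended by the current
  coin.\<close>

lemma coin_loop_distribution:
  fixes N :: nat
  defines "w \<equiv> While (BLess (Var ''a'') (Var ''length'')) ((Flip ''b'' ;; Store ''coin'' (Var ''a'') (Var ''b'')) ;; Incr ''a'')"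
  assumes "d \<le> N" "reg s ''a'' = N - d" "reg s ''length'' = N"
  shows "map_pmf (\<lambda>cs. arr (snd cs) ''coin'') (run (Suc (d * 7)) (w, s)) =
      map_pmf (\<lambda>\<omega> i. if N - d \<le> i \<and> i < N then of_bool (\<omega> i) else arr s ''coin'' i) (coins {N - d..<N})
    \<and> (\<forall>cs \<in> set_pmf (run (Suc (d * 7)) (w, s)). fst cs = Skip)"
  using assms(2-4)
proof (induction d arbitrary: s)
  case 0
  then have "\<not> reg s ''a'' < reg s ''length''" by simp
  then show ?case using 0
    by (simp add: w_def bind_return_pmf coins_def map_pmf_def[symmetric]) (auto simp: map_return_pmf map_pmf_const)
next
  case (Suc d)
  let ?c = "(Flip ''b'' ;; Store ''coin'' (Var ''a'') (Var ''b'')) ;; Incr ''a''"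
  let ?j = "N - Suc d"
  define s' where "s' b = set_reg ''a'' (Suc ?j) (set_arr ''coin'' ?j (of_bool b) (set_reg ''b'' (of_bool b) s))" for b
  have j: "?j < N" "Suc ?j = N - d" using Suc.prems by auto
  have body: "run 5 (?c, s) = map_pmf (\<lambda>b. (Skip, s' b)) (bernoulli_pmf (1/2))"
    using Suc.prems j by (simp add: numeral_eq_Suc bind_return_pmf bind_map_pmf map_pmf_def[symmetric] s'_def)
  have IH: "map_pmf (\<lambda>cs. arr (snd cs) ''coin'') (run (Suc (d * 7)) (w, s' b)) =
      map_pmf (\<lambda>\<omega> i. if N - d \<le> i \<and> i < N then of_bool (\<omega> i) else arr (s' b) ''coin'' i) (coins {N - d..<N})"
    "\<forall>cs \<in> set_pmf (run (Suc (d * 7)) (w, s' b)). fst cs = Skip" for b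
    using Suc.IH[of "s' b"] Suc.prems j by (simp_all add: s'_def)
  have "run (Suc (Suc d * 7)) (w, s) = run (Suc (5 + Suc (d * 7))) (?c ;; w, s)"
  proof -
    have eq: "Suc (Suc d * 7) = Suc (Suc (5 + Suc (d * 7)))" by simp
    have "reg s ''a'' < reg s ''length''" using Suc.prems j by simp
    then show ?thesis unfolding eq by (subst run.simps(2)) (simp add: w_def bind_return_pmf del: run.simps)
  qed
  also have "\<dots> = bind_pmf (run 5 (?c, s)) (\<lambda>cs. run (Suc (d * 7)) (w, snd cs))"
    by (rule run_Seq) (unfold body, use IH(2) in auto)
  also have "\<dots> = bind_pmf (bernoulli_pmf (1/2)) (\<lambda>b. run (Suc (d * 7)) (w, s' b))"
    unfolding body by (simp add: bind_map_pmf del: run.simps)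
  finally have run: "run (Suc (Suc d * 7)) (w, s) = bind_pmf (bernoulli_pmf (1/2)) (\<lambda>b. run (Suc (d * 7)) (w, s' b))" .
  have ins: "{?j..<N} = insert ?j {N - d..<N}" using j by auto
  have "map_pmf (\<lambda>cs. arr (snd cs) ''coin'') (run (Suc (Suc d * 7)) (w, s)) =
     bind_pmf (bernoulli_pmf (1/2)) (\<lambda>b.
       map_pmf (\<lambda>\<omega> i. if N - d \<le> i \<and> i < N then of_bool (\<omega> i) else arr (s' b) ''coin'' i) (coins {N - d..<N}))"
    unfolding run map_bind_pmf IH(1) ..
  also have "\<dots> = map_pmf (\<lambda>\<omega> i. if ?j \<le> i \<and> i < N then of_bool (\<omega> i) else arr s ''coin'' i) (coins {?j..<N})"
  proof -
    have "coins {?j..<N} = bind_pmf (bernoulli_pmf (1/2)) (\<lambda>b. map_pmf (\<lambda>f. f(?j := b)) (coins {N - d..<N}))"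
      unfolding ins coins_def by (subst Pi_pmf_insert') (use j in \<open>auto simp: map_pmf_def\<close>)
    moreover have "(\<lambda>i. if N - d \<le> i \<and> i < N then of_bool (f i) else arr (s' b) ''coin'' i) =
        (\<lambda>i. if ?j \<le> i \<and> i < N then of_bool ((f(?j := b)) i) else arr s ''coin'' i)" for f b
      using j by (auto simp: s'_def fun_eq_iff)
    ultimately show ?thesis by (simp add: map_bind_pmf map_pmf_comp)
  qed
  finally show ?case using run IH(2) by (simp del: run.simps)
qed

context gossip_locale
begin

definition start :: state where
  "start = initial_state input"

lemma start_props:
  "reg start ''length'' = length input" "has_input start" "reg start ''n'' = 0" "reg start ''k'' = 0"
  "arr start ''output'' = (\<lambda>_. 0)" "arr start ''coin'' = (\<lambda>_. 0)"
proof -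
  have r: "reg start x = (if x = ''length'' then length input else 0)" for x
    by (simp add: start_def initial_state_def)
  have a: "arr start b i = (if b = ''input'' \<and> i < length input then of_bool (input ! i) else 0)" for b i
    by (simp add: start_def initial_state_def)
  have "arr start ''input'' = (\<lambda>i. of_bool (i < length input \<and> input ! i))"
    by (rule ext) (simp add: a)
  moreover have "reg start ''length'' = length input" by (simp add: r)
  ultimately show "has_input start" unfolding has_input_def by (rule conjI[rotated])
  show "reg start ''length'' = length input" "reg start ''n'' = 0" "reg start ''k'' = 0"
    by (simp_all add: r)
  show "arr start ''output'' = (\<lambda>_. 0)" "arr start ''coin'' = (\<lambda>_. 0)"
    by (rule ext, simp add: a)+
qed

lemma flip_coins_correct:
  "hoare bound (\<lambda>s. s = start) flip_coins
    (\<lambda>s. has_input s \<and> reg s ''n'' = 0 \<and> reg s ''k'' = 0 \<and> arr s ''output'' = (\<lambda>_. 0))"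
proof -
  define F where "F s \<longleftrightarrow> has_input s \<and> reg s ''n'' = 0 \<and> reg s ''k'' = 0 \<and> arr s ''output'' = (\<lambda>_. 0)" for s
  have "F start" by (simp add: F_def start_props)
  moreover have "F s \<Longrightarrow> reg s ''length'' = length input" for s
    by (simp add: F_def has_input_def)
  ultimately have "hoare bound (\<lambda>s. s = start) flip_coins F"
    unfolding flip_coins_def
    by (rule_tac hoare_For_wp[where F = F and N = "length input" and I = "\<lambda>_ _. True"])
      (simp_all add: F_def has_input_def stable_simps bound_def)
  then show ?thesis unfolding F_def .
qed

lemma flip_coins_distribution:
  "map_pmf (\<lambda>cs. arr (snd cs) ''coin'') (run (time_bound bound flip_coins) (flip_coins, start)) =
   map_pmf coin_array (coins {..<length input})"
proof -
  define w where "w = While (BLess (Var ''a'') (Var ''length'')) ((Flip ''b'' ;; Store ''coin'' (Var ''a'') (Var ''b'')) ;; Incr ''a'')"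
  let ?s = "set_reg ''a'' 0 start"
  let ?N = "length input"
  have D: "map_pmf (\<lambda>cs. arr (snd cs) ''coin'') (run (Suc (?N * 7)) (w, ?s)) =
      map_pmf (\<lambda>\<omega> i. if ?N - ?N \<le> i \<and> i < ?N then of_bool (\<omega> i) else arr ?s ''coin'' i) (coins {?N - ?N..<?N})"
    "\<forall>cs \<in> set_pmf (run (Suc (?N * 7)) (w, ?s)). fst cs = Skip"
    using coin_loop_distribution[of ?N ?N ?s, folded w_def] start_props(1) by simp_all
  \<comment> \<open>The excess of \<open>bound\<close> over the number of coins is idle
    time.\<close>
  have H: "run (Suc (bound * 7)) (w, ?s) = run (Suc (?N * 7)) (w, ?s)"
    by (rule run_halted[OF D(2)]) (simp add: bound_def)
  have tb: "time_bound bound flip_coins = Suc (1 + Suc (bound * 7))"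
    by (simp add: flip_coins_def For_def)
  have "run (time_bound bound flip_coins) (flip_coins, start) = run (Suc (1 + Suc (bound * 7))) (Assign ''a'' (Const 0) ;; w, start)"
    unfolding tb unfolding flip_coins_def For_def w_def ..
  also have "\<dots> = bind_pmf (run 1 (Assign ''a'' (Const 0), start)) (\<lambda>cs. run (Suc (bound * 7)) (w, snd cs))"
    by (rule run_Seq) (use D(2) H in \<open>simp add: bind_return_pmf del: run.simps(2)[of "bound * 7"]\<close>)
  also have "run 1 (Assign ''a'' (Const 0), start) = return_pmf (Skip, ?s)"
    by (simp add: bind_return_pmf)
  finally have run: "run (time_bound bound flip_coins) (flip_coins, start) = run (Suc (?N * 7)) (w, ?s)"
    by (simp only: bind_return_pmf snd_conv H)
  have "(\<lambda>\<omega> i. if ?N - ?N \<le> i \<and> i < ?N then of_bool (\<omega> i) else arr ?s ''coin'' i) = coin_array"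
    by (auto simp: fun_eq_iff coin_array_def start_props(6))
  then show ?thesis unfolding run D(1) by (simp add: lessThan_atLeast0)
qed

definition good_output :: "(nat \<Rightarrow> nat) \<Rightarrow> bool" where
  "good_output y \<longleftrightarrow> valid_schedule I (decode I y) \<and> disseminates I (decode I y)"

text \<open>The coin array is a logical variable \<open>c\<close> here, so the triple applies to
  each outcome of the coin flips separately.\<close>

lemma rest_correct:
  "hoare bound (\<lambda>s. (has_input s \<and> reg s ''n'' = 0 \<and> reg s ''k'' = 0 \<and> arr s ''output'' = (\<lambda>_. 0)) \<and> arr s ''coin'' = c)
     (setup_com ;; main_com)
    (\<lambda>s. good_output (arr s ''output'') \<and>
       ((total \<le> n * k \<longrightarrow> (\<forall>ph\<le>last_phase. phase_feasible c ph)) \<longrightarrow> schedule_length I (decode I (arr s ''output'')) \<le> total))"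
proof (rule hoare_Seq_frame[OF setup_correct, where F = "\<lambda>s. arr s ''coin'' = c \<and> arr s ''output'' = (\<lambda>_. 0)"])
  show "stable (\<lambda>s. arr s ''coin'' = c \<and> arr s ''output'' = (\<lambda>_. 0)) (written_regs setup_com) (written_arrs setup_com)"
    by (simp add: stable_simps setup_com_def)
  show "hoare bound (\<lambda>s. env s \<and> arr s ''coin'' = c \<and> arr s ''output'' = (\<lambda>_. 0)) main_com
    (\<lambda>s. good_output (arr s ''output'') \<and>
       ((total \<le> n * k \<longrightarrow> (\<forall>ph\<le>last_phase. phase_feasible c ph)) \<longrightarrow> schedule_length I (decode I (arr s ''output'')) \<le> total))"
    by (rule hoare_post[OF main_correct]) (simp add: good_output_def Let_def)
qed simp

lemma alg_run:
  defines "rest \<equiv> setup_com ;; main_com"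
  shows "run (time_bound bound gossip_alg) (gossip_alg, start) =
    bind_pmf (run (time_bound bound flip_coins) (flip_coins, start)) (\<lambda>cs. run (time_bound bound rest) (rest, snd cs))"
proof -
  have tb: "time_bound bound gossip_alg = Suc (time_bound bound flip_coins + time_bound bound rest)"
    by (simp add: gossip_alg_def rest_def)
  show ?thesis unfolding tb unfolding gossip_alg_def rest_def[symmetric]
    using flip_coins_correct rest_correct unfolding rest_def[symmetric] hoare_def by (intro run_Seq) blast
qed

lemma alg_correct:
  "cs \<in> set_pmf (run (time_bound bound gossip_alg) (gossip_alg, start)) \<Longrightarrow>
     fst cs = Skip \<and> good_output (arr (snd cs) ''output'') \<and>
     (n * k < total \<longrightarrow> schedule_length I (decode I (arr (snd cs) ''output'')) \<le> total)"
proof -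
  assume "cs \<in> set_pmf (run (time_bound bound gossip_alg) (gossip_alg, start))"
  then obtain cs0 where cs0: "cs0 \<in> set_pmf (run (time_bound bound flip_coins) (flip_coins, start))"
    "cs \<in> set_pmf (run (time_bound bound (setup_com ;; main_com)) (setup_com ;; main_com, snd cs0))"
    unfolding alg_run by auto
  have "has_input (snd cs0) \<and> reg (snd cs0) ''n'' = 0 \<and> reg (snd cs0) ''k'' = 0 \<and> arr (snd cs0) ''output'' = (\<lambda>_. 0)"
    using flip_coins_correct[unfolded hoare_def] cs0(1) by blast
  then have "fst cs = Skip \<and> good_output (arr (snd cs) ''output'') \<and>
       ((total \<le> n * k \<longrightarrow> (\<forall>ph\<le>last_phase. phase_feasible (arr (snd cs0) ''coin'') ph)) \<longrightarrow>
         schedule_length I (decode I (arr (snd cs) ''output'')) \<le> total)"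
    using rest_correct[of "arr (snd cs0) ''coin''", unfolded hoare_def] cs0(2) by blast
  then show ?thesis by auto
qed

lemma alg_halts: "halts_within gossip_alg input (time_bound bound gossip_alg)"
  using alg_correct by (auto simp: halts_within_def start_def)

text \<open>The least halting time is not known, but all halting times give the same
  distribution.\<close>

lemma output_pmf_eq:
  "output_pmf gossip_alg input = map_pmf (\<lambda>cs. arr (snd cs) ''output'') (run (time_bound bound gossip_alg) (gossip_alg, start))"
proof -
  let ?T = "LEAST T. halts_within gossip_alg input T"
  have "halts_within gossip_alg input ?T" "?T \<le> time_bound bound gossip_alg"
    using alg_halts by (rule LeastI, rule Least_le)
  then have "run (time_bound bound gossip_alg) (gossip_alg, start) = run ?T (gossip_alg, start)"
    by (intro run_halted) (auto simp: halts_within_def start_def)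
  then show ?thesis by (simp add: output_pmf_def start_def)
qed

lemma prob_length_le_total:
  assumes "2 \<le> n"
  shows "1 - 1 / real n \<le> measure_pmf.prob (output_pmf gossip_alg input) {y. schedule_length I (decode I y) \<le> total}"
proof (cases "total \<le> n * k")
  case False
  have "measure_pmf.prob (output_pmf gossip_alg input) {y. schedule_length I (decode I y) \<le> total} = 1"
    unfolding output_pmf_eq using alg_correct False
    by (subst measure_pmf.prob_eq_1) (auto simp: AE_measure_pmf_iff)
  then show ?thesis by simp
next
  case True
  let ?rest = "setup_com ;; main_com"
  let ?Y = "{y. schedule_length I (decode I y) \<le> total}"
  let ?feas = "\<lambda>c. \<forall>ph\<le>last_phase. phase_feasible c ph"
  let ?p = "run (time_bound bound flip_coins) (flip_coins, start)"
  have rest: "measure_pmf.prob (map_pmf (\<lambda>cs. arr (snd cs) ''output'') (run (time_bound bound ?rest) (?rest, snd cs))) ?Y = 1"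
    if "cs \<in> set_pmf ?p" "cs \<in> {cs. ?feas (arr (snd cs) ''coin'')}" for cs
  proof -
    have "schedule_length I (decode I (arr (snd cs') ''output'')) \<le> total"
      if "cs' \<in> set_pmf (run (time_bound bound ?rest) (?rest, snd cs))" for cs'
      using flip_coins_correct rest_correct[of "arr (snd cs) ''coin''"] that \<open>cs \<in> set_pmf ?p\<close> \<open>cs \<in> {cs. _ cs}\<close>
      unfolding hoare_def by blast
    then show ?thesis by (subst measure_pmf.prob_eq_1) (auto simp: AE_measure_pmf_iff)
  qed
  have "1 - 1 / real n \<le> measure_pmf.prob (coins {..<length input}) {\<omega>. ?feas (coin_array \<omega>)}"
    by (rule prob_feasible[OF True assms])
  also have "\<dots> = measure_pmf.prob (map_pmf coin_array (coins {..<length input})) {c. ?feas c}"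
    by simp
  also have "\<dots> = measure_pmf.prob ?p {cs. ?feas (arr (snd cs) ''coin'')}"
    unfolding flip_coins_distribution[symmetric] by (simp add: vimage_def)
  also have "\<dots> \<le> measure_pmf.prob (output_pmf gossip_alg input) ?Y"
    unfolding output_pmf_eq alg_run map_bind_pmf by (rule prob_bind_pmf_ge[OF rest])
  finally show ?thesis .
qed

text \<open>For \<open>n \<ge> 2\<close> the rounded logarithm \<open>l\<close> is at least 1 and at
  most \<open>2 * log 2 n\<close>. At most \<open>5 * l\<close> phases of at most
  \<open>18 * l * (n + k)\<close> rounds then give \<open>5 * 18 * 2^2 = 360\<close>. One factor
  \<open>l\<close> stems from the number of levels and one from the window length.\<close>

lemma total_le:
  assumes n2: "2 \<le> n"
  shows "real total \<le> 360 * (real n + real k) * (log 2 (real n))\<^sup>2"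
proof -
  define l where "l = log_ceil n"
  have "0 < l"
  proof (rule gr0I)
    assume "l = 0"
    then show False using log_ceil[of n] n2 by (simp add: l_def)
  qed
  have "real (2 ^ (l - 1)) < real n"
    using log_ceil_least[of "l - 1" n] \<open>0 < l\<close> unfolding of_nat_less_iff by (simp add: l_def)
  then have "2 ^ (l - 1) < real n" by simp
  then have "real (l - 1) < log 2 (real n)" using n2 by (simp add: less_log_iff powr_realpow)
  moreover have "1 \<le> log 2 (real n)" using n2 by simp
  ultimately have l: "real l \<le> 2 * log 2 (real n)" "1 \<le> real l" using \<open>0 < l\<close> by (simp_all add: of_nat_diff)
  have "total \<le> (5 * l) * (18 * l * (n + k))"
    unfolding total_def
  proof (rule mult_le_mono)
    show "Suc last_phase \<le> 5 * l" using \<open>0 < l\<close> by (simp add: last_phase_def l_def)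
    have "width \<le> 9 * l" using \<open>0 < l\<close> by (simp add: width_def l_def)
    then have "2 * (n * 1) + 2 * (k * width) \<le> 2 * (n * (9 * l)) + 2 * (k * (9 * l))"
      using \<open>0 < l\<close> by (intro add_mono mult_le_mono2) simp_all
    also have "\<dots> = 18 * l * (n + k)" by (simp add: algebra_simps)
    finally show "duration \<le> 18 * l * (n + k)" by (simp add: duration_def mult.assoc)
  qed
  then have "real total \<le> real ((5 * l) * (18 * l * (n + k)))" unfolding of_nat_le_iff .
  also have "\<dots> = 90 * (real n + real k) * (real l)\<^sup>2" by (simp add: power2_eq_square)
  also have "\<dots> \<le> 90 * (real n + real k) * (2 * log 2 (real n))\<^sup>2"
    using l by (intro mult_left_mono power_mono) simp_all
  also have "\<dots> = 360 * (real n + real k) * (log 2 (real n))\<^sup>2" by (simp add: power2_eq_square)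
  finally show ?thesis .
qed

end

theorem theorem4:
  "\<exists>alg :: com.
     polynomial_time alg (encode ` {I. gossip_instance I}) \<and>
     (\<forall>I. gossip_instance I \<longrightarrow>
        (\<forall>y \<in> set_pmf (output_pmf alg (encode I)).
           valid_schedule I (decode I y) \<and> disseminates I (decode I y))) \<and>
     (\<exists>C a :: real. C > 0 \<and> a > 0 \<and>
        (\<forall>I. gossip_instance I \<longrightarrow>
           measure_pmf.prob (output_pmf alg (encode I))
             {y. real (schedule_length I (decode I y))
                   \<le> C * (real (nodes I) + real (tokens I)) * (log 2 (real (nodes I)))\<^sup>2}
           \<ge> 1 - real (nodes I) powr (- a)))"
proof (rule exI[of _ gossip_alg], intro conjI allI impI ballI)
  obtain q :: "nat poly" where q: "\<forall>M. time_bound M gossip_alg = poly q M"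
    using time_bound_poly by blast
  show "polynomial_time gossip_alg (encode ` {I. gossip_instance I})"
    unfolding polynomial_time_def
  \<comment> \<open>\<open>[:8, 8:]\<close> expresses \<open>bound\<close> as a polynomial in the
    input length.\<close>
  proof (intro exI[of _ "pcompose q [:8, 8:]"] ballI)
    fix w assume "w \<in> encode ` {I. gossip_instance I}"
    then obtain I where I: "gossip_instance I" "w = encode I" by blast
    interpret gossip_locale I by unfold_locales (rule I(1))
    have "poly (pcompose q [:8, 8:]) (length w) = time_bound bound gossip_alg"
      using q by (simp add: poly_pcompose bound_def input_def I(2) algebra_simps)
    then show "halts_within gossip_alg w (poly (pcompose q [:8, 8:]) (length w))"
      using alg_halts by (simp add: I(2) input_def)
  qed
next
  fix I y assume I: "gossip_instance I" and y: "y \<in> set_pmf (output_pmf gossip_alg (encode I))"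
  interpret gossip_locale I by unfold_locales (rule I)
  have "good_output y" using y alg_correct unfolding input_def[symmetric] output_pmf_eq by auto
  then show "valid_schedule I (decode I y)" "disseminates I (decode I y)" by (simp_all add: good_output_def)
next
  have "1 - real (nodes I) powr (- 1) \<le> measure_pmf.prob (output_pmf gossip_alg (encode I))
      {y. real (schedule_length I (decode I y)) \<le> 360 * (real (nodes I) + real (tokens I)) * (log 2 (real (nodes I)))\<^sup>2}"
    if I: "gossip_instance I" for I
  proof -
    interpret gossip_locale I by unfold_locales (rule I)
    let ?E = "{y. real (schedule_length I (decode I y)) \<le> 360 * (real (nodes I) + real (tokens I)) * (log 2 (real (nodes I)))\<^sup>2}"
    show "1 - real (nodes I) powr (- 1) \<le> measure_pmf.prob (output_pmf gossip_alg (encode I)) ?E"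
    proof (cases "2 \<le> nodes I")
      case True
      have "1 - real (nodes I) powr (- 1) = 1 - 1 / real (nodes I)"
        using True by (simp add: powr_minus_divide)
      also have "\<dots> \<le> measure_pmf.prob (output_pmf gossip_alg (encode I)) {y. schedule_length I (decode I y) \<le> total}"
        using prob_length_le_total[OF True] by (simp add: input_def)
      also have "\<dots> \<le> measure_pmf.prob (output_pmf gossip_alg (encode I)) ?E"
      proof (rule measure_pmf.finite_measure_mono)
        show "{y. schedule_length I (decode I y) \<le> total} \<subseteq> ?E"
          using total_le[OF True] by (auto intro: order_trans[rotated])
      qed simp
      finally show ?thesis .
    next
      case False
      \<comment> \<open>With one node the logarithm vanishes, but so does the required probability
        \<open>1 - 1 powr (- 1)\<close>.\<close>
      then have "nodes I = 1" using n_pos by simp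
      then show ?thesis by simp
    qed
  qed
  then show "\<exists>C a :: real. C > 0 \<and> a > 0 \<and>
        (\<forall>I. gossip_instance I \<longrightarrow>
           measure_pmf.prob (output_pmf gossip_alg (encode I))
             {y. real (schedule_length I (decode I y))
                   \<le> C * (real (nodes I) + real (tokens I)) * (log 2 (real (nodes I)))\<^sup>2}
           \<ge> 1 - real (nodes I) powr (- a))"
    by (intro exI[of _ 360] exI[of _ 1]) simp
qed

end
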